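(* Let $\mathcal X$ be a geometric $G$-crystal on $(X,\gamma)$, and let $\theta:T'\to X$ be a positive structure on $\mathcal X$, where $T'$ is an algebraic torus. Let $\tilde\gamma_\theta=Trop(\gamma\circ\theta):X_\star(T')\to\Lambda^\vee$, let $\tilde e_i^{\,\bullet}=Trop(e_{i;\theta}):\mathbb Z\times X_\star(T')\to X_\star(T')$, and let $\tilde e_i=\tilde e_i^{\,1}$, $i\in I$. Then the free combinatorial pre-crystal $Trop_\theta(\mathcal X)$ on $(X_\star(T'),\tilde\gamma_\theta)$ given by the bijections $\tilde e_i$, $i\in I$, is a free combinatorial $W$-crystal.
   Context: $G$ is a split reductive algebraic group over $\mathbb Q$, $T$ a maximal torus, $\Lambda^\vee=X_\star(T)$ and $\Lambda$ its cocharacter and character lattices, $I$ the vertex set of the Dynkin diagram, $\alpha_i\in\Lambda$, $\alpha_i^\vee\in\Lambda^\vee$ simple roots and coroots, $W$ the Weyl group with simple reflections $s_i$. Geometric crystals. A rational action $\alpha:H\times X\to X$ is unital if its domain of definition contains $\{e\}\times X$. Let $X$ be an irreducible variety over $\mathbb Q$ and $\gamma:X\to T$ a rational morphism. A geometric $G$-pre-crystal on $(X,\gamma)$ is a family of unital rational actions $e_i:\mathbb G_m\times X\to X$, $(c,x)\mapsto e_i^c(x)$, $i\in I$, with $\gamma(e_i^c(x))=\alpha_i^\vee(c)\gamma(x)$. For a reduced sequence $\mathbf i=(i_1,\dots,i_l)$ put $e_{\mathbf i}^t(x)=e_{i_1}^{\alpha^{(1)}(t)}\circ\cdots\circ e_{i_l}^{\alpha^{(l)}(t)}(x)$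 for $t\in T$, $\alpha^{(k)}=s_{i_l}\cdots s_{i_{k+1}}(\alpha_{i_k})$. It is a geometric crystal if $e_{\mathbf i}=e_{\mathbf i'}$ for all reduced sequences $\mathbf i,\mathbf i'$ of the same element of $W$. Positivity. A rational function on a torus $T'$ is positive if it is a ratio $f'/f''$ of linear combinations of characters with positive integer coefficients. A rational morphism $f:T'\to T''$ of tori is positive if $\mu\circ f$ is positive for each character $\mu$ of $T''$. Positive morphisms compose. A positive structure on a geometric pre-crystal is a birational isomorphism $\theta:T'\to X$, $T'$ an algebraic torus, such that $\gamma\circ\theta:T'\to T$ is positive and, for each $i\in I$, the morphism $e_{i;\theta}:\mathbb G_m\times T'\to T'$, $e_{i;\theta}(c,t')=\theta^{-1}(e_i^c(\theta(t')))$, is positive. Tropicalization. For a torus $T'$ let $\mathcal L(T')$ be the set of formal loops $\phi:\mathbb G_m\to T'$ (so $\mathcal L(\mathbb G_m)$ is the set of non-zero Laurent series in a variable $c$) and $\mathcal L_0(T')\subset\mathcal L(T')$ the set of $\phi$ such that $\mu\circ\phi$ is an invertible Taylor series in $c$ for every character $\mu$; $\mathcal L_0(T')$ is an irreducible pro-algebraic variety. Multiplication $X_\star(T')\times\mathcal L_0(T')\to\mathcal L(T')$ is a bijection, which gives a map $\deg_{T'}:\mathcal L(T')\to X_\star(T')$, each fibre being identified with $\mathcal L_0(T')$. For a rational morphism $f:T'\to T''$ and $\lambda\in X_\star(T')$ there is a unique $\mu=:\deg(f)(\lambda)\in X_\star(T'')$ such that $\{\phi\in\deg_{T'}^{-1}(\lambda):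 f\circ\phi\in\deg_{T''}^{-1}(\mu)\}$ is dense in $\deg_{T'}^{-1}(\lambda)$. On the category of tori with positive rational morphisms, $Trop(T')=X_\star(T')$, $Trop(f)=\deg(f)$ is a functor to sets. One identifies $X_\star(\mathbb G_m)=\mathbb Z$. Combinatorial crystals. A free combinatorial pre-crystal on $(B,\tilde\gamma)$, where $B$ is a set and $\tilde\gamma:B\to\Lambda^\vee$ a map, is a family of bijections $\tilde e_i:B\to B$, $i\in I$, with $\tilde\gamma(\tilde e_i(b))=\tilde\gamma(b)+\alpha_i^\vee$. It is a free combinatorial $W$-crystal if the involutions $\tilde s_i(b)=\tilde e_i^{\,-\langle\tilde\gamma(b),\alpha_i\rangle}(b)$, $i\in I$, satisfy the braid relations of $W$. *)

theory Defs
  imports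
    "HOL-Analysis.Analysis"
    "HOL-Library.Poly_Mapping"
    "HOL-Computational_Algebra.Formal_Laurent_Series"
begin

section \<open>Polynomials\<close>

text \<open>
  Formal polynomials in variables indexed by 'v. Coefficients are mapped into the ring of values by
  h; for polynomials over the rationals h = of_rat, and the values may be complex numbers or formal
  Laurent series. A point of affine n-space is a sequence vanishing from index n on, so that variables
  with index at least n contribute nothing and need not be excluded.
\<close>

type_synonym ('v, 'c) pol = "('v \<Rightarrow>\<^sub>0 nat) \<Rightarrow>\<^sub>0 'c"

definition peval :: "('c::zero \<Rightarrow> 'k) \<Rightarrow> ('v, 'c) pol \<Rightarrow> ('v \<Rightarrow> 'k::field) \<Rightarrow> 'k" where
  "peval h p x =
     (\<Sum>m\<in>Poly_Mapping.keys p. h (Poly_Mapping.lookup p m) *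
        (\<Prod>v\<in>Poly_Mapping.keys m. x v ^ Poly_Mapping.lookup m v))"

abbreviation qeval :: "('v, rat) pol \<Rightarrow> ('v \<Rightarrow> 'k::field_char_0) \<Rightarrow> 'k" where
  "qeval \<equiv> peval of_rat"


section \<open>Varieties over the rationals\<close>

text \<open>
  A variety over the rationals is represented by its set of complex points, together with the Zariski
  topology and the regular functions defined over the rationals. The latter are given by a finite
  atlas: a chart (D, n, \<phi>) identifies D with a subset of affine n-space that is closed over the
  rationals. (Two Galois conjugate points lie in the same open sets.)
\<close>

type_synonym 'a chart = "'a set \<times> nat \<times> ('a \<Rightarrow> nat \<Rightarrow> complex)"

type_synonym 'a atlas = "'a chart set"

definition affine_space :: "nat \<Rightarrow> (nat \<Rightarrow> complex) set" where
  "affine_space n = {x. \<forall>i\<ge>n. x i = 0}"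

definition affine_chart :: "'a chart \<Rightarrow> bool" where
  "affine_chart = (\<lambda>(D, n, \<phi>). inj_on \<phi> D \<and>
     (\<exists>P. \<phi> ` D = {y \<in> affine_space n. \<forall>p\<in>P. qeval p y = 0}))"

definition points :: "'a atlas \<Rightarrow> 'a set" where
  "points X = (\<Union>(D, n, \<phi>)\<in>X. D)"

definition zopen :: "'a atlas \<Rightarrow> 'a set \<Rightarrow> bool" where
  "zopen X U \<longleftrightarrow> U \<subseteq> points X \<and>
     (\<forall>(D, n, \<phi>)\<in>X. \<exists>P. U \<inter> D = {x \<in> D. \<exists>p\<in>P. qeval p (\<phi> x) \<noteq> 0})"

definition zdense :: "'a atlas \<Rightarrow> 'a set \<Rightarrow> bool" where
  "zdense X U \<longleftrightarrow> (\<forall>V. zopen X V \<and> V \<noteq> {} \<longrightarrow> U \<inter> V \<noteq> {})"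

definition regular_on :: "'a atlas \<Rightarrow> 'a set \<Rightarrow> ('a \<Rightarrow> complex) \<Rightarrow> bool" where
  "regular_on X U g \<longleftrightarrow>
     (\<forall>(D, n, \<phi>)\<in>X. \<forall>x\<in>U \<inter> D. \<exists>p q V. zopen X V \<and> x \<in> V \<and> V \<subseteq> U \<and>
        (\<forall>y\<in>V \<inter> D. qeval q (\<phi> y) \<noteq> 0 \<and> g y = qeval p (\<phi> y) / qeval q (\<phi> y)))"

definition prod_atlas :: "'a atlas \<Rightarrow> 'b atlas \<Rightarrow> ('a \<times> 'b) atlas" (infixr \<open>\<otimes>\<^sub>v\<close> 80) where
  "X \<otimes>\<^sub>v Y = (\<lambda>((D, n, \<phi>), (E, m, \<psi>)).
      (D \<times> E, n + m, \<lambda>(x, y) i. if i < n then \<phi> x i else \<psi> y (i - n))) ` (X \<times> Y)"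

definition variety :: "'a atlas \<Rightarrow> bool" where
  "variety X \<longleftrightarrow> finite X \<and> (\<forall>c\<in>X. affine_chart c) \<and>
     (\<forall>(D, n, \<phi>)\<in>X. zopen X D \<and> (\<forall>k<n. regular_on X D (\<lambda>x. \<phi> x k))) \<and>
     zopen (X \<otimes>\<^sub>v X) {(x, y). x \<in> points X \<and> y \<in> points X \<and> x \<noteq> y}"

definition irreducible_variety :: "'a atlas \<Rightarrow> bool" where
  "irreducible_variety X \<longleftrightarrow> variety X \<and> points X \<noteq> {} \<and>
     (\<forall>U V. zopen X U \<and> zopen X V \<and> U \<noteq> {} \<and> V \<noteq> {} \<longrightarrow> U \<inter> V \<noteq> {})"

text \<open>
  A rational morphism is given by a representative: a partial function that is a morphism on a dense
  open domain, not necessarily the largest possible one. Equality of rational morphisms is \<open>rat_eq\<close>.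
\<close>

definition rational_map :: "'a atlas \<Rightarrow> 'b atlas \<Rightarrow> ('a \<rightharpoonup> 'b) \<Rightarrow> bool" where
  "rational_map X Y f \<longleftrightarrow> zopen X (dom f) \<and> zdense X (dom f) \<and> ran f \<subseteq> points Y \<and>
     (\<forall>(E, m, \<psi>)\<in>Y. zopen X {x \<in> dom f. the (f x) \<in> E} \<and>
        (\<forall>k<m. regular_on X {x \<in> dom f. the (f x) \<in> E} (\<lambda>x. \<psi> (the (f x)) k)))"

definition rat_eq :: "'a atlas \<Rightarrow> ('a \<rightharpoonup> 'b) \<Rightarrow> ('a \<rightharpoonup> 'b) \<Rightarrow> bool" where
  "rat_eq X f g \<longleftrightarrow> (\<exists>V. zopen X V \<and> zdense X V \<and> V \<subseteq> dom f \<inter> dom g \<and> (\<forall>x\<in>V. f x = g x))"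

definition rat_inverse :: "'a atlas \<Rightarrow> 'b atlas \<Rightarrow> ('a \<rightharpoonup> 'b) \<Rightarrow> ('b \<rightharpoonup> 'a) \<Rightarrow> bool" where
  "rat_inverse X Y f g \<longleftrightarrow> rational_map X Y f \<and> rational_map Y X g \<and>
     rat_eq X (g \<circ>\<^sub>m f) Some \<and> rat_eq Y (f \<circ>\<^sub>m g) Some"

definition birational_iso :: "'a atlas \<Rightarrow> 'b atlas \<Rightarrow> ('a \<rightharpoonup> 'b) \<Rightarrow> bool" where
  "birational_iso X Y f \<longleftrightarrow> (\<exists>g. rat_inverse X Y f g)"

definition rat_inv :: "'a atlas \<Rightarrow> 'b atlas \<Rightarrow> ('a \<rightharpoonup> 'b) \<Rightarrow> ('b \<rightharpoonup> 'a)" where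
  "rat_inv X Y f = (SOME g. rat_inverse X Y f g)"


section \<open>Tori\<close>

text \<open>
  A torus is \<open>\<bbbG>\<^sub>m\<^sup>n\<close>; both lattices of characters and cocharacters are then the group of integer
  vectors of length n. Points are taken over an arbitrary field, since formal loops are points over
  the field of Laurent series.
\<close>

definition torus :: "nat \<Rightarrow> (nat \<Rightarrow> 'k::field) set" where
  "torus n = {x. (\<forall>i<n. x i \<noteq> 0) \<and> (\<forall>i\<ge>n. x i = 0)}"

definition lattice :: "nat \<Rightarrow> (nat \<Rightarrow> int) set" where
  "lattice n = {v. \<forall>i\<ge>n. v i = 0}"

definition pairing :: "nat \<Rightarrow> (nat \<Rightarrow> int) \<Rightarrow> (nat \<Rightarrow> int) \<Rightarrow> int" where
  "pairing n v \<mu> = (\<Sum>i<n. v i * \<mu> i)"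

definition chr :: "nat \<Rightarrow> (nat \<Rightarrow> int) \<Rightarrow> (nat \<Rightarrow> 'k::field) \<Rightarrow> 'k" where
  "chr n \<mu> x = (\<Prod>i<n. x i powi \<mu> i)"

definition cochr :: "nat \<Rightarrow> (nat \<Rightarrow> int) \<Rightarrow> 'k::field \<Rightarrow> (nat \<Rightarrow> 'k)" where
  "cochr n v c = (\<lambda>i. if i < n then c powi v i else 0)"

definition tmult :: "(nat \<Rightarrow> 'k::field) \<Rightarrow> (nat \<Rightarrow> 'k) \<Rightarrow> (nat \<Rightarrow> 'k)" where
  "tmult x y = (\<lambda>i. x i * y i)"

definition torus_coords :: "nat \<Rightarrow> (nat \<Rightarrow> complex) \<Rightarrow> (nat \<Rightarrow> complex)" where
  "torus_coords n x = (\<lambda>i. if i < n then x i else if i < 2 * n then inverse (x (i - n)) else 0)"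

definition torus_var :: "nat \<Rightarrow> (nat \<Rightarrow> complex) atlas" where
  "torus_var n = {(torus n, 2 * n, torus_coords n)}"

definition Gm_var :: "complex atlas" where
  "Gm_var = {({c. c \<noteq> 0}, 2, \<lambda>c i. if i = 0 then c else if i = 1 then inverse c else 0)}"


section \<open>Split reductive groups and their root data\<close>

text \<open>
  Linear algebraic groups are closed subgroups of \<open>GL\<^sub>n\<close>, given by their complex points. The map h
  into the complex numbers fixes the field of definition: of_rat for objects over the rationals, id
  for objects over the complex numbers.
\<close>

definition entries :: "complex^'n^'n \<Rightarrow> 'n \<times> 'n \<Rightarrow> complex" where
  "entries A = (\<lambda>(i, j). A $ i $ j)"

definition gl_closed :: "('c::zero \<Rightarrow> complex) \<Rightarrow> (complex^'n^'n) set \<Rightarrow> bool" where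
  "gl_closed h Z \<longleftrightarrow>
     (\<exists>P :: ('n \<times> 'n, 'c) pol set. Z = {A. invertible A \<and> (\<forall>p\<in>P. peval h p (entries A) = 0)})"

definition gl_subgroup :: "(complex^'n^'n) set \<Rightarrow> bool" where
  "gl_subgroup H \<longleftrightarrow> (\<forall>A\<in>H. invertible A \<and> matrix_inv A \<in> H) \<and> mat 1 \<in> H \<and>
     (\<forall>A\<in>H. \<forall>B\<in>H. A ** B \<in> H)"

definition gl_connected :: "(complex^'n^'n) set \<Rightarrow> bool" where
  "gl_connected S \<longleftrightarrow> \<not> (\<exists>Z Z'. gl_closed (id :: complex \<Rightarrow> complex) Z \<and>
     gl_closed (id :: complex \<Rightarrow> complex) Z' \<and>
     S \<subseteq> Z \<union> Z' \<and> S \<inter> Z \<inter> Z' = {} \<and> S \<inter> Z \<noteq> {} \<and> S \<inter> Z' \<noteq> {})"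

definition unipotent :: "complex^'n^'n \<Rightarrow> bool" where
  "unipotent A \<longleftrightarrow> (\<exists>k. (((**) (A - mat 1)) ^^ k) (mat 1) = 0)"

definition reductive_group :: "(complex^'n^'n) set \<Rightarrow> bool" where
  "reductive_group G \<longleftrightarrow> gl_subgroup G \<and> gl_closed (of_rat :: rat \<Rightarrow> complex) G \<and> gl_connected G \<and>
     (\<forall>U. gl_subgroup U \<and> gl_closed (id :: complex \<Rightarrow> complex) U \<and> gl_connected U \<and> U \<subseteq> G \<and>
          (\<forall>g\<in>G. \<forall>u\<in>U. g ** u ** matrix_inv g \<in> U) \<and> (\<forall>u\<in>U. unipotent u) \<longrightarrow> U = {mat 1})"

text \<open>
  \<open>\<tau>\<close> is an isomorphism of algebraic groups from \<open>\<bbbG>\<^sub>m\<^sup>r\<close> onto the closed subgroup S. The last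
  conjunct says that its inverse is regular: regular functions on a closed subset of \<open>GL\<^sub>n\<close> are
  polynomials in the entries divided by powers of the determinant.
\<close>

definition gl_torus ::
  "('c::zero \<Rightarrow> complex) \<Rightarrow> nat \<Rightarrow> ((nat \<Rightarrow> complex) \<Rightarrow> complex^'n^'n) \<Rightarrow> (complex^'n^'n) set \<Rightarrow> bool" where
  "gl_torus h r \<tau> S \<longleftrightarrow> gl_closed h S \<and> bij_betw \<tau> (torus r) S \<and>
     (\<forall>x\<in>torus r. \<forall>y\<in>torus r. \<tau> (tmult x y) = \<tau> x ** \<tau> y) \<and>
     (\<forall>i j. \<exists>p. \<forall>x\<in>torus r. \<tau> x $ i $ j = peval h p (torus_coords r x)) \<and>
     (\<forall>k<r. \<exists>p N. \<forall>x\<in>torus r. x k = peval h p (entries (\<tau> x)) / det (\<tau> x) ^ N)"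

definition split_maximal_torus ::
  "(complex^'n^'n) set \<Rightarrow> nat \<Rightarrow> ((nat \<Rightarrow> complex) \<Rightarrow> complex^'n^'n) \<Rightarrow> bool" where
  "split_maximal_torus G r \<tau> \<longleftrightarrow>
     gl_torus (of_rat :: rat \<Rightarrow> complex) r \<tau> (\<tau> ` torus r) \<and> \<tau> ` torus r \<subseteq> G \<and>
     (\<forall>r' \<tau>' S. gl_torus (id :: complex \<Rightarrow> complex) r' \<tau>' S \<and> S \<subseteq> G \<and> \<tau> ` torus r \<subseteq> S \<longrightarrow>
        S = \<tau> ` torus r)"

text \<open>The tangent space of G at the identity; \<open>mat s ** M\<close> is the scalar multiple of M by s.\<close>

definition lie_algebra :: "(complex^'n^'n) set \<Rightarrow> (complex^'n^'n) set" where
  "lie_algebra G = {M. \<forall>p :: ('n \<times> 'n, complex) pol. (\<forall>A\<in>G. peval id p (entries A) = 0) \<longrightarrow>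
     ((\<lambda>s. peval id p (entries (mat 1 + mat s ** M))) has_field_derivative 0) (at 0)}"

definition is_root ::
  "(complex^'n^'n) set \<Rightarrow> nat \<Rightarrow> ((nat \<Rightarrow> complex) \<Rightarrow> complex^'n^'n) \<Rightarrow> (nat \<Rightarrow> int) \<Rightarrow> bool" where
  "is_root G r \<tau> \<beta> \<longleftrightarrow> \<beta> \<in> lattice r \<and> \<beta> \<noteq> (\<lambda>_. 0) \<and>
     (\<exists>M\<in>lie_algebra G. M \<noteq> 0 \<and>
        (\<forall>x\<in>torus r. \<tau> x ** M ** matrix_inv (\<tau> x) = mat (chr r \<beta> x) ** M))"

definition simple_roots ::
  "(complex^'n^'n) set \<Rightarrow> nat \<Rightarrow> ((nat \<Rightarrow> complex) \<Rightarrow> complex^'n^'n) \<Rightarrow> 'i set \<Rightarrow>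
   ('i \<Rightarrow> nat \<Rightarrow> int) \<Rightarrow> bool" where
  "simple_roots G r \<tau> I \<alpha> \<longleftrightarrow> finite I \<and> (\<forall>i\<in>I. is_root G r \<tau> (\<alpha> i)) \<and>
     (\<forall>a :: 'i \<Rightarrow> int. (\<forall>k. (\<Sum>i\<in>I. a i * \<alpha> i k) = 0) \<longrightarrow> (\<forall>i\<in>I. a i = 0)) \<and>
     (\<forall>\<beta>. is_root G r \<tau> \<beta> \<longrightarrow>
        (\<exists>a :: 'i \<Rightarrow> int. \<beta> = (\<lambda>k. \<Sum>i\<in>I. a i * \<alpha> i k) \<and>
           ((\<forall>i\<in>I. a i \<ge> 0) \<or> (\<forall>i\<in>I. a i \<le> 0))))"

definition mat2 :: "complex \<Rightarrow> complex \<Rightarrow> complex \<Rightarrow> complex \<Rightarrow> complex^2^2" where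
  "mat2 a b c d = vector [vector [a, b], vector [c, d]]"

text \<open>
  The coroot of \<open>\<beta>\<close> is the restriction to the diagonal torus of a homomorphism \<open>SL\<^sub>2 \<rightarrow> G\<close> over the
  rationals that maps the upper and lower unitriangular subgroups to the root subgroups of \<open>\<beta>\<close> and
  \<open>-\<beta>\<close>.
\<close>

definition is_coroot ::
  "(complex^'n^'n) set \<Rightarrow> nat \<Rightarrow> ((nat \<Rightarrow> complex) \<Rightarrow> complex^'n^'n) \<Rightarrow> (nat \<Rightarrow> int) \<Rightarrow>
   (nat \<Rightarrow> int) \<Rightarrow> bool" where
  "is_coroot G r \<tau> \<beta> \<beta>' \<longleftrightarrow> \<beta>' \<in> lattice r \<and>
     (\<exists>\<phi> :: complex^2^2 \<Rightarrow> complex^'n^'n.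
        (\<forall>A. det A = 1 \<longrightarrow> \<phi> A \<in> G) \<and>
        (\<forall>A B. det A = 1 \<and> det B = 1 \<longrightarrow> \<phi> (A ** B) = \<phi> A ** \<phi> B) \<and>
        (\<forall>i j. \<exists>p. \<forall>A. det A = 1 \<longrightarrow> \<phi> A $ i $ j = qeval p (entries A)) \<and>
        (\<forall>s. s \<noteq> 0 \<longrightarrow> \<phi> (mat2 s 0 0 (inverse s)) = \<tau> (cochr r \<beta>' s)) \<and>
        inj (\<lambda>a. \<phi> (mat2 1 a 0 1)) \<and> inj (\<lambda>a. \<phi> (mat2 1 0 a 1)) \<and>
        (\<forall>x\<in>torus r. \<forall>a.
           \<tau> x ** \<phi> (mat2 1 a 0 1) ** matrix_inv (\<tau> x) = \<phi> (mat2 1 (chr r \<beta> x * a) 0 1) \<and>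
           \<tau> x ** \<phi> (mat2 1 0 a 1) ** matrix_inv (\<tau> x) = \<phi> (mat2 1 0 (inverse (chr r \<beta> x) * a) 1)))"

text \<open>
  From here on the maximal torus is identified with \<open>\<bbbG>\<^sub>m\<^sup>r\<close> along \<open>\<tau>\<close>, \<open>\<alpha>\<close> and \<open>\<alpha>'\<close> are the families of
  simple roots and simple coroots. The Weyl group is the group of automorphisms of the character
  lattice generated by the simple reflections.
\<close>

definition refl ::
  "nat \<Rightarrow> ('i \<Rightarrow> nat \<Rightarrow> int) \<Rightarrow> ('i \<Rightarrow> nat \<Rightarrow> int) \<Rightarrow> 'i \<Rightarrow> (nat \<Rightarrow> int) \<Rightarrow> (nat \<Rightarrow> int)" where
  "refl r \<alpha> \<alpha>' i \<mu> = (\<lambda>k. \<mu> k - pairing r (\<alpha>' i) \<mu> * \<alpha> i k)"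

definition same_element ::
  "nat \<Rightarrow> ('i \<Rightarrow> nat \<Rightarrow> int) \<Rightarrow> ('i \<Rightarrow> nat \<Rightarrow> int) \<Rightarrow> 'i list \<Rightarrow> 'i list \<Rightarrow> bool" where
  "same_element r \<alpha> \<alpha>' w w' \<longleftrightarrow>
     (\<forall>\<mu>\<in>lattice r. foldr (refl r \<alpha> \<alpha>') w \<mu> = foldr (refl r \<alpha> \<alpha>') w' \<mu>)"

definition reduced_word ::
  "nat \<Rightarrow> 'i set \<Rightarrow> ('i \<Rightarrow> nat \<Rightarrow> int) \<Rightarrow> ('i \<Rightarrow> nat \<Rightarrow> int) \<Rightarrow> 'i list \<Rightarrow> bool" where
  "reduced_word r I \<alpha> \<alpha>' w \<longleftrightarrow> set w \<subseteq> I \<and>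
     (\<forall>w'. set w' \<subseteq> I \<and> same_element r \<alpha> \<alpha>' w w' \<longrightarrow> length w \<le> length w')"

definition is_order ::
  "nat \<Rightarrow> ('i \<Rightarrow> nat \<Rightarrow> int) \<Rightarrow> ('i \<Rightarrow> nat \<Rightarrow> int) \<Rightarrow> 'i \<Rightarrow> 'i \<Rightarrow> nat \<Rightarrow> bool" where
  "is_order r \<alpha> \<alpha>' i j m \<longleftrightarrow>
     (let trivial = (\<lambda>k. \<forall>\<mu>\<in>lattice r. ((refl r \<alpha> \<alpha>' i \<circ> refl r \<alpha> \<alpha>' j) ^^ k) \<mu> = \<mu>)
      in 0 < m \<and> trivial m \<and> (\<forall>k. 0 < k \<and> k < m \<longrightarrow> \<not> trivial k))"


section \<open>Geometric crystals\<close>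

definition rational_action :: "'x atlas \<Rightarrow> (complex \<times> 'x \<rightharpoonup> 'x) \<Rightarrow> bool" where
  "rational_action X a \<longleftrightarrow> rational_map (Gm_var \<otimes>\<^sub>v X) X a \<and>
     rat_eq (Gm_var \<otimes>\<^sub>v Gm_var \<otimes>\<^sub>v X)
       (\<lambda>(c, c', x). Option.bind (a (c', x)) (\<lambda>y. a (c, y)))
       (\<lambda>(c, c', x). a (c * c', x))"

text \<open>
  The domain of definition consists of the points at which some representative b of the rational
  morphism a is defined. The axiom that the identity element acts as the identity is part of this
  definition, because it only makes sense when the domain of definition meets \<open>{1} \<times> X\<close>.
\<close>

definition unital_action :: "'x atlas \<Rightarrow> (complex \<times> 'x \<rightharpoonup> 'x) \<Rightarrow> bool" where
  "unital_action X a \<longleftrightarrow> rational_action X a \<and>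
     (\<forall>x\<in>points X. \<exists>b. rational_map (Gm_var \<otimes>\<^sub>v X) X b \<and> rat_eq (Gm_var \<otimes>\<^sub>v X) a b \<and> b (1, x) = Some x)"

definition geometric_precrystal ::
  "nat \<Rightarrow> 'i set \<Rightarrow> ('i \<Rightarrow> nat \<Rightarrow> int) \<Rightarrow> 'x atlas \<Rightarrow> ('x \<rightharpoonup> (nat \<Rightarrow> complex)) \<Rightarrow>
   ('i \<Rightarrow> complex \<times> 'x \<rightharpoonup> 'x) \<Rightarrow> bool" where
  "geometric_precrystal r I \<alpha>' X \<gamma> e \<longleftrightarrow> irreducible_variety X \<and> rational_map X (torus_var r) \<gamma> \<and>
     (\<forall>i\<in>I. unital_action X (e i) \<and>
        rat_eq (Gm_var \<otimes>\<^sub>v X) (\<gamma> \<circ>\<^sub>m e i) (\<lambda>(c, x). map_option (tmult (cochr r (\<alpha>' i) c)) (\<gamma> x)))"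

text \<open>
  For a word \<open>i\<^sub>1 \<dots> i\<^sub>l\<close> the character \<open>\<alpha>\<^sup>(\<^sup>1\<^sup>)\<close> is \<open>s\<^bsub>i\<^sub>l\<^esub> \<dots> s\<^bsub>i\<^sub>2\<^esub> (\<alpha>\<^bsub>i\<^sub>1\<^esub>)\<close>, which is the value of
  \<open>fold\<close> below; the remaining \<open>\<alpha>\<^sup>(\<^sup>k\<^sup>)\<close> are those of the word \<open>i\<^sub>2 \<dots> i\<^sub>l\<close>.
\<close>

primrec e_word ::
  "nat \<Rightarrow> ('i \<Rightarrow> nat \<Rightarrow> int) \<Rightarrow> ('i \<Rightarrow> nat \<Rightarrow> int) \<Rightarrow> ('i \<Rightarrow> complex \<times> 'x \<rightharpoonup> 'x) \<Rightarrow> 'i list \<Rightarrow>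
   (nat \<Rightarrow> complex) \<times> 'x \<rightharpoonup> 'x" where
  "e_word r \<alpha> \<alpha>' e [] = (\<lambda>(t, x). Some x)"
| "e_word r \<alpha> \<alpha>' e (i # w) = (\<lambda>(t, x). Option.bind (e_word r \<alpha> \<alpha>' e w (t, x))
     (\<lambda>y. e i (chr r (fold (refl r \<alpha> \<alpha>') w (\<alpha> i)) t, y)))"

definition geometric_crystal ::
  "nat \<Rightarrow> 'i set \<Rightarrow> ('i \<Rightarrow> nat \<Rightarrow> int) \<Rightarrow> ('i \<Rightarrow> nat \<Rightarrow> int) \<Rightarrow> 'x atlas \<Rightarrow>
   ('x \<rightharpoonup> (nat \<Rightarrow> complex)) \<Rightarrow> ('i \<Rightarrow> complex \<times> 'x \<rightharpoonup> 'x) \<Rightarrow> bool" where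
  "geometric_crystal r I \<alpha> \<alpha>' X \<gamma> e \<longleftrightarrow> geometric_precrystal r I \<alpha>' X \<gamma> e \<and>
     (\<forall>w w'. reduced_word r I \<alpha> \<alpha>' w \<and> reduced_word r I \<alpha> \<alpha>' w' \<and> same_element r \<alpha> \<alpha>' w w' \<longrightarrow>
        rat_eq (torus_var r \<otimes>\<^sub>v X) (e_word r \<alpha> \<alpha>' e w) (e_word r \<alpha> \<alpha>' e w'))"


section \<open>Positivity\<close>

definition positive_comb :: "nat \<Rightarrow> ((nat \<Rightarrow> complex) \<Rightarrow> complex) \<Rightarrow> bool" where
  "positive_comb n f \<longleftrightarrow> (\<exists>F a. finite F \<and> F \<noteq> {} \<and> F \<subseteq> lattice n \<and> (\<forall>\<mu>\<in>F. (a \<mu> :: nat) > 0) \<and>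
     f = (\<lambda>x. \<Sum>\<mu>\<in>F. of_nat (a \<mu>) * chr n \<mu> x))"

definition positive_function :: "nat \<Rightarrow> ((nat \<Rightarrow> complex) \<rightharpoonup> complex) \<Rightarrow> bool" where
  "positive_function n g \<longleftrightarrow> (\<exists>f' f''. positive_comb n f' \<and> positive_comb n f'' \<and>
     rat_eq (torus_var n) g (\<lambda>x. if f'' x \<noteq> 0 then Some (f' x / f'' x) else None))"

definition positive_map :: "nat \<Rightarrow> nat \<Rightarrow> ((nat \<Rightarrow> complex) \<rightharpoonup> (nat \<Rightarrow> complex)) \<Rightarrow> bool" where
  "positive_map n m f \<longleftrightarrow> rational_map (torus_var n) (torus_var m) f \<and>
     (\<forall>\<mu>\<in>lattice m. positive_function n (\<lambda>x. map_option (chr m \<mu>) (f x)))"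

text \<open>
  \<open>\<bbbG>\<^sub>m \<times> \<bbbG>\<^sub>m\<^sup>n\<close> is identified with \<open>\<bbbG>\<^sub>m\<close> to the power n + 1, the first factor having index 0.
\<close>

definition e_theta ::
  "'x atlas \<Rightarrow> nat \<Rightarrow> ((nat \<Rightarrow> complex) \<rightharpoonup> 'x) \<Rightarrow> (complex \<times> 'x \<rightharpoonup> 'x) \<Rightarrow>
   ((nat \<Rightarrow> complex) \<rightharpoonup> (nat \<Rightarrow> complex))" where
  "e_theta X n \<theta> a = (\<lambda>z. Option.bind (\<theta> (\<lambda>k. z (Suc k)))
     (\<lambda>x. Option.bind (a (z 0, x)) (rat_inv (torus_var n) X \<theta>)))"

definition positive_structure ::
  "nat \<Rightarrow> 'i set \<Rightarrow> 'x atlas \<Rightarrow> ('x \<rightharpoonup> (nat \<Rightarrow> complex)) \<Rightarrow> ('i \<Rightarrow> complex \<times> 'x \<rightharpoonup> 'x) \<Rightarrow>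
   nat \<Rightarrow> ((nat \<Rightarrow> complex) \<rightharpoonup> 'x) \<Rightarrow> bool" where
  "positive_structure r I X \<gamma> e n \<theta> \<longleftrightarrow> birational_iso (torus_var n) X \<theta> \<and>
     positive_map n r (\<gamma> \<circ>\<^sub>m \<theta>) \<and> (\<forall>i\<in>I. positive_map (Suc n) n (e_theta X n \<theta> (e i)))"


section \<open>Tropicalization\<close>

text \<open>Formal loops with complex coefficients: the complex points of the loop space.\<close>

type_synonym loop = "nat \<Rightarrow> complex fls"

definition loops :: "nat \<Rightarrow> loop set" where
  "loops n = torus n"

definition loops0 :: "nat \<Rightarrow> loop set" where
  "loops0 n = {\<phi> \<in> loops n. \<forall>\<mu>\<in>lattice n. \<exists>g :: complex fps. g dvd 1 \<and> chr n \<mu> \<phi> = fps_to_fls g}"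

definition loop_deg :: "nat \<Rightarrow> loop \<Rightarrow> (nat \<Rightarrow> int)" where
  "loop_deg n \<phi> = (THE v. v \<in> lattice n \<and> (\<exists>\<psi>\<in>loops0 n. \<phi> = tmult (cochr n v fls_X) \<psi>))"

text \<open>
  Density for the Zariski topology of the pro-algebraic variety of loops of degree v, identified with
  \<open>loops0 n\<close>. The latter has as coordinates the coefficients of the n series and the inverses of the
  leading ones, and the inverses can be cleared from an equation.
\<close>

definition dense_in_fibre :: "nat \<Rightarrow> (nat \<Rightarrow> int) \<Rightarrow> loop set \<Rightarrow> bool" where
  "dense_in_fibre n v S \<longleftrightarrow> (\<forall>p :: (nat \<times> nat, rat) pol.
     (\<forall>\<psi>\<in>loops0 n. tmult (cochr n v fls_X) \<psi> \<in> S \<longrightarrow> qeval p (\<lambda>(j, k). fls_nth (\<psi> j) (int k)) = 0) \<longrightarrow>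
     (\<forall>\<psi>\<in>loops0 n. qeval p (\<lambda>(j, k). fls_nth (\<psi> j) (int k)) = 0))"

text \<open>
  \<open>loop_comp n m f \<phi> \<psi>\<close>: the composition of f and \<open>\<phi>\<close> is defined and equal to \<open>\<psi>\<close>. Each component of
  f is a quotient of polynomials, into which the Laurent series of \<open>\<phi>\<close> are substituted.
\<close>

definition represents ::
  "nat \<Rightarrow> ((nat \<Rightarrow> complex) \<rightharpoonup> (nat \<Rightarrow> complex)) \<Rightarrow> nat \<Rightarrow> (nat, rat) pol \<Rightarrow> (nat, rat) pol \<Rightarrow> bool" where
  "represents n f j p q \<longleftrightarrow> rat_eq (torus_var n) (\<lambda>x. map_option (\<lambda>y. y j) (f x))
     (\<lambda>x. if qeval q x \<noteq> 0 then Some (qeval p x / qeval q x) else None)"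

definition loop_comp ::
  "nat \<Rightarrow> nat \<Rightarrow> ((nat \<Rightarrow> complex) \<rightharpoonup> (nat \<Rightarrow> complex)) \<Rightarrow> loop \<Rightarrow> loop \<Rightarrow> bool" where
  "loop_comp n m f \<phi> \<psi> \<longleftrightarrow> \<psi> \<in> loops m \<and>
     (\<forall>j<m. \<exists>p q. represents n f j p q \<and> qeval q \<phi> \<noteq> 0 \<and> \<psi> j = qeval p \<phi> / qeval q \<phi>)"

definition trop ::
  "nat \<Rightarrow> nat \<Rightarrow> ((nat \<Rightarrow> complex) \<rightharpoonup> (nat \<Rightarrow> complex)) \<Rightarrow> (nat \<Rightarrow> int) \<Rightarrow> (nat \<Rightarrow> int)" where
  "trop n m f v = (THE u. u \<in> lattice m \<and>
     dense_in_fibre n v {\<phi> \<in> loops n. loop_deg n \<phi> = v \<and> (\<exists>\<psi>. loop_comp n m f \<phi> \<psi> \<and> loop_deg m \<psi> = u)})"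


section \<open>Free combinatorial crystals\<close>

definition free_precrystal ::
  "nat \<Rightarrow> 'i set \<Rightarrow> ('i \<Rightarrow> nat \<Rightarrow> int) \<Rightarrow> 'b set \<Rightarrow> ('b \<Rightarrow> nat \<Rightarrow> int) \<Rightarrow> ('i \<Rightarrow> 'b \<Rightarrow> 'b) \<Rightarrow> bool" where
  "free_precrystal r I \<alpha>' B g f \<longleftrightarrow> g ` B \<subseteq> lattice r \<and>
     (\<forall>i\<in>I. bij_betw (f i) B B \<and> (\<forall>b\<in>B. g (f i b) = (\<lambda>k. g b k + \<alpha>' i k)))"

definition iter_int :: "'b set \<Rightarrow> ('b \<Rightarrow> 'b) \<Rightarrow> int \<Rightarrow> 'b \<Rightarrow> 'b" where
  "iter_int B f k = (if k \<ge> 0 then f ^^ nat k else inv_into B f ^^ nat (- k))"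

definition crystal_refl ::
  "nat \<Rightarrow> ('i \<Rightarrow> nat \<Rightarrow> int) \<Rightarrow> 'b set \<Rightarrow> ('b \<Rightarrow> nat \<Rightarrow> int) \<Rightarrow> ('i \<Rightarrow> 'b \<Rightarrow> 'b) \<Rightarrow> 'i \<Rightarrow> 'b \<Rightarrow> 'b" where
  "crystal_refl r \<alpha> B g f i b = iter_int B (f i) (- pairing r (g b) (\<alpha> i)) b"

primrec alternating :: "('b \<Rightarrow> 'b) \<Rightarrow> ('b \<Rightarrow> 'b) \<Rightarrow> nat \<Rightarrow> 'b \<Rightarrow> 'b" where
  "alternating s t 0 = id"
| "alternating s t (Suc m) = s \<circ> alternating t s m"

definition free_W_crystal ::
  "nat \<Rightarrow> 'i set \<Rightarrow> ('i \<Rightarrow> nat \<Rightarrow> int) \<Rightarrow> ('i \<Rightarrow> nat \<Rightarrow> int) \<Rightarrow> 'b set \<Rightarrow> ('b \<Rightarrow> nat \<Rightarrow> int) \<Rightarrow>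
   ('i \<Rightarrow> 'b \<Rightarrow> 'b) \<Rightarrow> bool" where
  "free_W_crystal r I \<alpha> \<alpha>' B g f \<longleftrightarrow> free_precrystal r I \<alpha>' B g f \<and>
     (\<forall>i\<in>I. \<forall>j\<in>I. \<forall>m. i \<noteq> j \<and> is_order r \<alpha> \<alpha>' i j m \<longrightarrow>
        (\<forall>b\<in>B. alternating (crystal_refl r \<alpha> B g f i) (crystal_refl r \<alpha> B g f j) m b =
               alternating (crystal_refl r \<alpha> B g f j) (crystal_refl r \<alpha> B g f i) m b))"

end

theory Submission
  imports Defs
begin

text \<open>
  Positive rational maps are defined at all points with positive real coordinates and preserve them.
  These points are Zariski dense, so an identity of rational maps, which a priori holds only where all
  composites are defined, holds at every positive point once it holds generically. In this way
  unitality, the action property, the equivariance of \<open>\<gamma>\<close> and the equalities \<open>e\<^bsub>i\<^esub> = e\<^bsub>i'\<^esub>\<close> become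
  identities of maps between sets of positive points. The tropicalization of a positive map is the
  min-plus form of the map; it describes how the map acts on curves of positive points
  \<open>x\<^sub>j(y) \<approx> exp (- v\<^sub>j y)\<close> as \<open>y \<rightarrow> \<infinity>\<close>. Therefore every identity on positive points tropicalizes.

  A product of the reflections \<open>s\<^sub>i\<close> along a word, applied to v, is the tropicalized action of the word
  with the parameter \<open>- \<gamma>(v)\<close>. The braid relations thus follow from the geometric ones, provided that the
  two alternating words whose length is the order of \<open>s\<^sub>i s\<^sub>j\<close> are reduced among all words. This holds
  because each of them makes that many rays of positive roots negative, while a letter flips one ray.
\<close>

section \<open>Evaluation of polynomials\<close>

text \<open>The obstacle is definedness. A rational map comes as a partial function whose domain is
  just some dense open set, and a composite may be nowhere defined unless the inner map meets the
  outer domain. Unitality removes this: the parameter 1 acts as the identity, so each action map has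
  every positive point in its image, and generic conditions can be pulled back along it. For words
  this also requires each character occurring as a parameter to be nonzero, so that parameter and
  point can be prescribed independently; this is where roots being nonzero enters. Functoriality of
  the tropicalization is never proved for formal loops. Loops serve only to identify
  \<open>trop\<close> with an explicit min-plus expression; compositions are handled by real curves,
  where they are plain compositions of functions, and a curve determines its limiting cocharacter
  uniquely. Positivity is used in both places for the same reason: sums of positive leading terms
  cannot cancel.\<close>

definition monom_val :: "('v \<Rightarrow> 'k::field) \<Rightarrow> ('v \<Rightarrow>\<^sub>0 nat) \<Rightarrow> 'k" where
  "monom_val x m = (\<Prod>v\<in>Poly_Mapping.keys m. x v ^ Poly_Mapping.lookup m v)"

lemma monom_val_superset:
  assumes "finite S" "Poly_Mapping.keys m \<subseteq> S"
  shows "monom_val x m = (\<Prod>v\<in>S. x v ^ Poly_Mapping.lookup m v)"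
  unfolding monom_val_def
  by (rule prod.mono_neutral_left) (use assms in \<open>auto simp: in_keys_iff\<close>)

lemma monom_val_add: "monom_val x (m + m') = monom_val x m * monom_val x m'"
proof -
  let ?S = "Poly_Mapping.keys m \<union> Poly_Mapping.keys m'"
  have "monom_val x (m + m') = (\<Prod>v\<in>?S. x v ^ Poly_Mapping.lookup (m + m') v)"
    using Poly_Mapping.keys_add[of m m'] by (intro monom_val_superset) auto
  also have "\<dots> = (\<Prod>v\<in>?S. x v ^ Poly_Mapping.lookup m v) * (\<Prod>v\<in>?S. x v ^ Poly_Mapping.lookup m' v)"
    by (simp add: lookup_add power_add prod.distrib)
  also have "\<dots> = monom_val x m * monom_val x m'"
    by (simp add: monom_val_superset[of ?S])
  finally show ?thesis .
qed

lemma poly_mapping_sum_single: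
  "p = (\<Sum>m\<in>Poly_Mapping.keys p. Poly_Mapping.single m (Poly_Mapping.lookup p m))"
proof (rule poly_mapping_eqI)
  fix k
  have "(\<Sum>m\<in>Poly_Mapping.keys p. Poly_Mapping.lookup (Poly_Mapping.single m (Poly_Mapping.lookup p m)) k)
     = (\<Sum>m\<in>Poly_Mapping.keys p. if m = k then Poly_Mapping.lookup p m else 0)"
    by (rule sum.cong) (auto simp: lookup_single when_def)
  then show "Poly_Mapping.lookup p k = Poly_Mapping.lookup
      (\<Sum>m\<in>Poly_Mapping.keys p. Poly_Mapping.single m (Poly_Mapping.lookup p m)) k"
    by (simp add: lookup_sum in_keys_iff)
qed

definition pvar :: "'v \<Rightarrow> ('v, 'c::comm_ring_1) pol" where
  "pvar v = Poly_Mapping.single (Poly_Mapping.single v 1) 1"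

definition pconst :: "'c::comm_ring_1 \<Rightarrow> ('v, 'c) pol" where
  "pconst c = Poly_Mapping.single 0 c"

text \<open>One argument covers the two coefficient maps: \<open>of_rat\<close>, into complex
  numbers or Laurent series, and \<open>id\<close>, for the complex equations in
  \<open>lie_algebra\<close>.\<close>

locale coeff_hom =
  fixes h :: "'c::comm_ring_1 \<Rightarrow> 'k::field"
  assumes h_0: "h 0 = 0" and h_1: "h 1 = 1"
    and h_add: "h (a + b) = h a + h b" and h_mult: "h (a * b) = h a * h b"
begin

lemma peval_superset:
  assumes "finite S" "Poly_Mapping.keys p \<subseteq> S"
  shows "peval h p x = (\<Sum>m\<in>S. h (Poly_Mapping.lookup p m) * monom_val x m)"
  unfolding peval_def monom_val_def[symmetric]
  by (rule sum.mono_neutral_left) (use assms in \<open>auto simp: in_keys_iff h_0\<close>)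

lemma peval_0: "peval h 0 x = 0"
  by (simp add: peval_def)

lemma peval_add: "peval h (p + q) x = peval h p x + peval h q x"
proof -
  let ?S = "Poly_Mapping.keys p \<union> Poly_Mapping.keys q"
  have "peval h (p + q) x = (\<Sum>m\<in>?S. h (Poly_Mapping.lookup (p + q) m) * monom_val x m)"
    using Poly_Mapping.keys_add[of p q] by (intro peval_superset) auto
  then show ?thesis
    by (simp add: peval_superset[of ?S] lookup_add h_add ring_distribs sum.distrib)
qed

lemma peval_sum: "peval h (\<Sum>a\<in>A. p a) x = (\<Sum>a\<in>A. peval h (p a) x)"
  by (induction A rule: infinite_finite_induct) (auto simp: peval_0 peval_add)

lemma peval_single: "peval h (Poly_Mapping.single m c) x = h c * monom_val x m"
  by (cases "c = 0") (simp_all add: peval_def monom_val_def h_0)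

lemma peval_pvar: "peval h (pvar v) x = x v"
  by (simp add: pvar_def peval_single monom_val_def h_1)

lemma peval_pconst: "peval h (pconst c) x = h c"
  by (simp add: pconst_def peval_single monom_val_def)

lemma peval_1: "peval h 1 x = 1"
  using peval_pconst[of 1 x] by (simp add: pconst_def h_1)

lemma peval_mult: "peval h (p * q) x = peval h p x * peval h q x"
proof -
  let ?l = Poly_Mapping.lookup and ?s = Poly_Mapping.single and ?k = Poly_Mapping.keys
  have "p * q = (\<Sum>m\<in>?k p. \<Sum>m'\<in>?k q. ?s m (?l p m) * ?s m' (?l q m'))"
    unfolding sum_product[symmetric]
    by (rule arg_cong2[where f = "(*)"]) (rule poly_mapping_sum_single)+
  then have "peval h (p * q) x =
      (\<Sum>m\<in>?k p. \<Sum>m'\<in>?k q. (h (?l p m) * monom_val x m) * (h (?l q m') * monom_val x m'))"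
    by (simp add: peval_sum mult_single peval_single h_mult monom_val_add mult_ac)
  also have "\<dots> = peval h p x * peval h q x"
    by (simp add: peval_def monom_val_def[symmetric] sum_product)
  finally show ?thesis .
qed

lemma peval_diff: "peval h (p - q) x = peval h p x - peval h q x"
  using peval_add[of "p - q" q x] by simp

lemma peval_prod: "peval h (\<Prod>a\<in>A. p a) x = (\<Prod>a\<in>A. peval h (p a) x)"
  by (induction A rule: infinite_finite_induct) (auto simp: peval_1 peval_mult)

lemma peval_power: "peval h (p ^ k) x = peval h p x ^ k"
  by (induction k) (auto simp: peval_1 peval_mult)

end

lemmas (in coeff_hom) peval_simps =
  peval_0 peval_1 peval_add peval_diff peval_sum peval_mult peval_prod peval_power peval_pvar
  peval_pconst

interpretation qh: coeff_hom "of_rat :: rat \<Rightarrow> 'k::field_char_0"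
  by unfold_locales (simp_all add: of_rat_add of_rat_mult)

interpretation idh: coeff_hom "id :: 'k \<Rightarrow> 'k::field"
  by unfold_locales simp_all

lemma peval_cong:
  "(\<And>v. v \<in> (\<Union>m\<in>Poly_Mapping.keys p. Poly_Mapping.keys m) \<Longrightarrow> x v = y v) \<Longrightarrow>
   peval h p x = peval h p y"
  unfolding peval_def by (intro sum.cong prod.cong refl arg_cong2[where f = "(*)"]) (metis UN_I)

text \<open>An induction principle over the values of a polynomial: a class of functions closed
  under the ring operations and containing coefficients and coordinates contains them all.
  Substitution, restriction to curves and regularity of germs are instances.\<close>

lemma peval_closure:
  fixes Q :: "('a \<Rightarrow> 'k::field) \<Rightarrow> bool" and p :: "('v, 'c::zero) pol"
  assumes add: "\<And>f g. Q f \<Longrightarrow> Q g \<Longrightarrow> Q (\<lambda>x. f x + g x)"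
    and mult: "\<And>f g. Q f \<Longrightarrow> Q g \<Longrightarrow> Q (\<lambda>x. f x * g x)"
    and const: "\<And>c. Q (\<lambda>x. h c)" and zero: "Q (\<lambda>x. 0)" and one: "Q (\<lambda>x. 1)"
    and coord: "\<And>v. Q (\<lambda>x. g x v)"
  shows "Q (\<lambda>x. peval h p (g x))"
proof -
  have sum: "Q (\<lambda>x. \<Sum>a\<in>A. f a x)" if "\<And>a. a \<in> A \<Longrightarrow> Q (f a)" for A :: "('v \<Rightarrow>\<^sub>0 nat) set" and f
    using that by (induction A rule: infinite_finite_induct) (auto intro: zero add)
  have pow: "Q (\<lambda>x. f x ^ k)" if "Q f" for f k
    using that by (induction k) (auto intro: one mult)
  have prod: "Q (\<lambda>x. \<Prod>a\<in>A. f a x)" if "\<And>a. a \<in> A \<Longrightarrow> Q (f a)" for A :: "'v set" and f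
    using that by (induction A rule: infinite_finite_induct) (auto intro: one mult)
  show ?thesis
    unfolding peval_def by (intro sum mult const prod pow coord)
qed

lemma (in coeff_hom) peval_subst: "\<exists>p'. \<forall>x. peval h p (\<lambda>v. peval h (s v) x) = peval h p' (x :: 'w \<Rightarrow> 'k)"
proof (rule peval_closure[where Q = "\<lambda>f. \<exists>p'. \<forall>x. f x = peval h p' x"])
  show "\<exists>p'. \<forall>x. f x + g x = peval h p' (x :: 'w \<Rightarrow> 'k)"
    if fg: "\<exists>p'. \<forall>x. f x = peval h p' x" "\<exists>p'. \<forall>x. g x = peval h p' x" for f g
  proof -
    obtain p q where "\<forall>x. f x = peval h p x" "\<forall>x. g x = peval h q x" using fg by blast
    then show ?thesis by (intro exI[of _ "p + q"]) (simp add: peval_add)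
  qed
  show "\<exists>p'. \<forall>x. f x * g x = peval h p' (x :: 'w \<Rightarrow> 'k)"
    if fg: "\<exists>p'. \<forall>x. f x = peval h p' x" "\<exists>p'. \<forall>x. g x = peval h p' x" for f g
  proof -
    obtain p q where "\<forall>x. f x = peval h p x" "\<forall>x. g x = peval h q x" using fg by blast
    then show ?thesis by (intro exI[of _ "p * q"]) (simp add: peval_mult)
  qed
  show "\<exists>p'. \<forall>x. h c = peval h p' (x :: 'w \<Rightarrow> 'k)" for c
    by (rule exI[of _ "pconst c"]) (simp add: peval_pconst)
  show "\<exists>p'. \<forall>x. 0 = peval h p' (x :: 'w \<Rightarrow> 'k)"
    by (rule exI[of _ 0]) (simp add: peval_0)
  show "\<exists>p'. \<forall>x. 1 = peval h p' (x :: 'w \<Rightarrow> 'k)"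
    by (rule exI[of _ 1]) (simp add: peval_1)
  show "\<exists>p'. \<forall>x. peval h (s v) x = peval h p' (x :: 'w \<Rightarrow> 'k)" for v
    by blast
qed

lemma peval_curve:
  fixes g :: "'k::field \<Rightarrow> 'v \<Rightarrow> 'k"
  assumes "\<And>v. \<exists>u. \<forall>t. g t v = poly u t"
  shows "\<exists>u. \<forall>t. peval h p (g t) = poly u t"
proof (rule peval_closure[where Q = "\<lambda>f. \<exists>u. \<forall>t. f t = poly u t"])
  show "\<exists>u. \<forall>t. f t + g t = poly u t" if fg: "\<exists>u. \<forall>t. f t = poly u t" "\<exists>u. \<forall>t. g t = poly u t"
    for f g :: "'k \<Rightarrow> 'k"
  proof -
    obtain u w where "\<forall>t. f t = poly u t" "\<forall>t. g t = poly w t" using fg by blast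
    then show ?thesis by (intro exI[of _ "u + w"]) simp
  qed
  show "\<exists>u. \<forall>t. f t * g t = poly u t" if fg: "\<exists>u. \<forall>t. f t = poly u t" "\<exists>u. \<forall>t. g t = poly u t"
    for f g :: "'k \<Rightarrow> 'k"
  proof -
    obtain u w where "\<forall>t. f t = poly u t" "\<forall>t. g t = poly w t" using fg by blast
    then show ?thesis by (intro exI[of _ "u * w"]) simp
  qed
  have const: "\<exists>u. \<forall>t. a = poly u t" for a :: 'k
    by (rule exI[of _ "[:a:]"]) simp
  show "\<exists>u. \<forall>t::'k. h c = poly u t" for c by (rule const)
  show "\<exists>u. \<forall>t::'k. (0::'k) = poly u t" by (rule const)
  show "\<exists>u. \<forall>t::'k. (1::'k) = poly u t" by (rule const)
  show "\<exists>u. \<forall>t. g t v = poly u t" for v by (rule assms)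
qed

lemma peval_univariate: "\<exists>u. \<forall>t. peval h p (x(v := t)) = poly u t"
proof (rule peval_curve)
  fix w
  show "\<exists>u. \<forall>t. (x(v := t)) w = poly u t"
  proof (cases "w = v")
    case True
    then show ?thesis by (intro exI[of _ "[:0, 1:]"]) auto
  next
    case False
    then show ?thesis by (intro exI[of _ "[:x w:]"]) auto
  qed
qed

definition pos_nat_points :: "'v set \<Rightarrow> ('v \<Rightarrow> nat) set" where
  "pos_nat_points S = {k. (\<forall>v\<in>S. k v > 0) \<and> (\<forall>v. v \<notin> S \<longrightarrow> k v = 0)}"

text \<open>Fixing all variables but one leaves a polynomial in one variable with infinitely many
  zeros, so it vanishes identically; positive integers are thus replaced by arbitrary values one
  variable at a time.\<close>

lemma peval_eq_0_if_pos_nat: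
  fixes h :: "'c::zero \<Rightarrow> 'k::field_char_0"
  assumes "\<And>k. k \<in> pos_nat_points S \<Longrightarrow> peval h p (\<lambda>v. of_nat (k v)) = 0"
    and "\<And>v. v \<notin> S \<Longrightarrow> x v = 0"
  shows "peval h p x = 0"
proof -
  have main: "peval h p (\<lambda>v. if v \<in> F then x v else of_nat (k v)) = 0"
    if "finite F" "F \<subseteq> S" "k \<in> pos_nat_points S" for F k
    using that
  proof (induction F arbitrary: k rule: finite_induct)
    case empty
    then show ?case using assms(1) by simp
  next
    case (insert w F)
    let ?y = "\<lambda>v. if v \<in> F then x v else of_nat (k v)"
    obtain u where u: "\<And>t. peval h p (?y(w := t)) = poly u t"
      using peval_univariate by metis
    have "poly u (of_nat (Suc j)) = 0" for j
    proof -
      have "k(w := Suc j) \<in> pos_nat_points S"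
        using insert.prems by (auto simp: pos_nat_points_def)
      from insert.IH[OF _ this] insert.prems
      have "peval h p (\<lambda>v. if v \<in> F then x v else of_nat ((k(w := Suc j)) v)) = 0" by simp
      moreover have "(\<lambda>v. if v \<in> F then x v else of_nat ((k(w := Suc j)) v)) = ?y(w := of_nat (Suc j))"
        using insert.hyps by (auto simp: fun_eq_iff)
      ultimately show ?thesis using u by metis
    qed
    then have "range (\<lambda>j. of_nat (Suc j) :: 'k) \<subseteq> {t. poly u t = 0}" by auto
    moreover have "infinite (range (\<lambda>j. of_nat (Suc j) :: 'k))"
      by (rule range_inj_infinite) (auto simp: inj_on_def simp del: of_nat_Suc)
    ultimately have "u = 0"
      using poly_roots_finite finite_subset by blast
    then have "peval h p (?y(w := x w)) = 0" by (simp add: u)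
    moreover have "(\<lambda>v. if v \<in> insert w F then x v else of_nat (k v)) = ?y(w := x w)"
      by (auto simp: fun_eq_iff)
    ultimately show ?case by simp
  qed
  let ?V = "\<Union>m\<in>Poly_Mapping.keys p. Poly_Mapping.keys m"
  let ?k = "\<lambda>v. if v \<in> S then 1 else 0 :: nat"
  \<comment> \<open>Only the finitely many variables occurring in \<open>p\<close> have to be
    replaced, so \<open>S\<close> may be infinite, as it is for the coefficients of loops.\<close>
  have "peval h p x = peval h p (\<lambda>v. if v \<in> ?V \<inter> S then x v else of_nat (?k v))"
    by (rule peval_cong) (use assms(2) in auto)
  also have "\<dots> = 0"
    by (rule main) (auto simp: pos_nat_points_def)
  finally show ?thesis .
qed

lemma of_rat_peval_of_nat:
  "qeval p (\<lambda>v. of_nat (k v)) = (of_rat (peval id p (\<lambda>v. of_nat (k v))) :: 'k::field_char_0)"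
  by (simp add: peval_def of_rat_sum of_rat_mult of_rat_prod of_rat_power)

text \<open>At integer points the value is the image of one rational number, so vanishing there does
  not depend on the field. This carries identities from complex points to Laurent series.\<close>

lemma qeval_eq_0_transfer:
  fixes x :: "'v \<Rightarrow> 'k::field_char_0"
  assumes "\<And>k. k \<in> pos_nat_points S \<Longrightarrow> qeval p (\<lambda>v. of_nat (k v)) = (0::'l::field_char_0)"
    and "\<And>v. v \<notin> S \<Longrightarrow> x v = 0"
  shows "qeval p x = 0"
  using assms(2)
proof (rule peval_eq_0_if_pos_nat[rotated])
  show "qeval p (\<lambda>v. of_nat (k v)) = (0::'k)" if "k \<in> pos_nat_points S" for k
    using assms(1)[OF that] unfolding of_rat_peval_of_nat by simp
qed

section \<open>Generic properties on a torus\<close>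

text \<open>Neighbourhoods of \<open>x0\<close> and, in \<open>generic\<close>, nonempty open sets
  for the Zariski topology of the torus over the rationals, as filters, so that finitely many open
  conditions can be imposed at once. Polynomials suffice to cut out the basic open sets, since the
  denominators of Laurent polynomials are units on the torus.\<close>

definition near :: "nat \<Rightarrow> (nat \<Rightarrow> complex) \<Rightarrow> (nat \<Rightarrow> complex) filter" where
  "near N x0 = Abs_filter (\<lambda>P. \<exists>q. qeval q x0 \<noteq> 0 \<and> (\<forall>x\<in>torus N. qeval q x \<noteq> 0 \<longrightarrow> P x))"

definition generic :: "nat \<Rightarrow> (nat \<Rightarrow> complex) filter" where
  "generic N = Abs_filter (\<lambda>P. \<exists>q. (\<exists>x\<in>torus N. qeval q x \<noteq> (0::complex)) \<and> (\<forall>x\<in>torus N. qeval q x \<noteq> 0 \<longrightarrow> P x))"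

definition pos_points :: "nat \<Rightarrow> (nat \<Rightarrow> complex) set" where
  "pos_points N = {x. (\<forall>i<N. \<exists>a>0. x i = complex_of_real a) \<and> (\<forall>i\<ge>N. x i = 0)}"

lemma pos_points_torus: "x \<in> pos_points N \<Longrightarrow> x \<in> torus N"
  by (force simp: pos_points_def torus_def)

lemma eventually_near:
  "eventually P (near N x0) \<longleftrightarrow> (\<exists>q. qeval q x0 \<noteq> 0 \<and> (\<forall>x\<in>torus N. qeval q x \<noteq> 0 \<longrightarrow> P x))"
  unfolding near_def
proof (rule eventually_Abs_filter, rule is_filter.intro)
  show "\<exists>q. qeval q x0 \<noteq> 0 \<and> (\<forall>x\<in>torus N. qeval q (x :: nat \<Rightarrow> complex) \<noteq> 0 \<longrightarrow> True)"
    by (rule exI[of _ 1]) (simp add: qh.peval_1)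
next
  fix P Q :: "(nat \<Rightarrow> complex) \<Rightarrow> bool"
  assume "\<exists>q. qeval q x0 \<noteq> 0 \<and> (\<forall>x\<in>torus N. qeval q x \<noteq> 0 \<longrightarrow> P x)"
    and "\<exists>q. qeval q x0 \<noteq> 0 \<and> (\<forall>x\<in>torus N. qeval q x \<noteq> 0 \<longrightarrow> Q x)"
  then obtain p q where "qeval p x0 \<noteq> 0" "\<forall>x\<in>torus N. qeval p x \<noteq> 0 \<longrightarrow> P x"
      "qeval q x0 \<noteq> 0" "\<forall>x\<in>torus N. qeval q x \<noteq> 0 \<longrightarrow> Q x" by blast
  then show "\<exists>q. qeval q x0 \<noteq> 0 \<and> (\<forall>x\<in>torus N. qeval q x \<noteq> 0 \<longrightarrow> P x \<and> Q x)"
    by (intro exI[of _ "p * q"]) (auto simp: qh.peval_mult)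
next
  fix P Q :: "(nat \<Rightarrow> complex) \<Rightarrow> bool"
  assume imp: "\<forall>x. P x \<longrightarrow> Q x"
    and "\<exists>q. qeval q x0 \<noteq> 0 \<and> (\<forall>x\<in>torus N. qeval q x \<noteq> 0 \<longrightarrow> P x)"
  then obtain q where "qeval q x0 \<noteq> 0" "\<forall>x\<in>torus N. qeval q x \<noteq> 0 \<longrightarrow> P x" by blast
  then show "\<exists>q. qeval q x0 \<noteq> 0 \<and> (\<forall>x\<in>torus N. qeval q x \<noteq> 0 \<longrightarrow> Q x)"
    using imp by (intro exI[of _ q]) auto
qed

lemma nonzero_at_pos_point:
  assumes "x \<in> torus N" "qeval q x \<noteq> (0::complex)"
  obtains k where "k \<in> pos_nat_points {..<N}" "qeval q (\<lambda>v. of_nat (k v)) \<noteq> (0::complex)"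
proof -
  have "\<exists>k\<in>pos_nat_points {..<N}. qeval q (\<lambda>v. of_nat (k v)) \<noteq> (0::complex)"
  proof (rule ccontr)
    assume "\<not> ?thesis"
    then have zero: "qeval q (\<lambda>v. of_nat (k v)) = (0::complex)" if "k \<in> pos_nat_points {..<N}" for k
      using that by blast
    have "qeval q x = 0"
    proof (rule qeval_eq_0_transfer[OF zero])
      show "x v = 0" if "v \<notin> {..<N}" for v
        using assms(1) that by (auto simp: torus_def)
    qed
    then show False using assms(2) by simp
  qed
  then show thesis using that by blast
qed

lemma pos_nat_points_pos_points:
  "k \<in> pos_nat_points {..<N} \<Longrightarrow> (\<lambda>v. of_nat (k v)) \<in> pos_points N"
proof -
  assume k: "k \<in> pos_nat_points {..<N}"
  have "\<exists>a>0. (of_nat (k i) :: complex) = of_real a" if "i < N" for i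
    using k that by (intro exI[of _ "real (k i)"]) (simp add: pos_nat_points_def)
  then show ?thesis using k by (simp add: pos_points_def pos_nat_points_def)
qed

lemma nonzero_mult_on_torus:
  assumes "x \<in> torus N" "qeval p x \<noteq> (0::complex)" "y \<in> torus N" "qeval q y \<noteq> (0::complex)"
  shows "\<exists>z\<in>torus N. qeval (p * q) z \<noteq> (0::complex)"
proof -
  obtain k where k: "k \<in> pos_nat_points {..<N}" "qeval p (\<lambda>v. of_nat (k v)) \<noteq> (0::complex)"
    using nonzero_at_pos_point[OF assms(1,2)] .
  obtain l where l: "l \<in> pos_nat_points {..<N}" "qeval q (\<lambda>v. of_nat (l v)) \<noteq> (0::complex)"
    using nonzero_at_pos_point[OF assms(3,4)] .
  text \<open>Restriction to the line through the two points reduces this to polynomials in one variable.\<close>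
  let ?L = "\<lambda>t v. of_nat (k v) + t * (of_nat (l v) - of_nat (k v)) :: complex"
  have line: "\<exists>u. \<forall>t. qeval s (?L t) = poly u t" for s
  proof (rule peval_curve)
    show "\<exists>u. \<forall>t. ?L t v = poly u t" for v
      by (rule exI[of _ "[:of_nat (k v), of_nat (l v) - of_nat (k v):]"]) simp
  qed
  obtain u where u: "\<And>t. qeval p (?L t) = poly u t" using line[of p] by metis
  obtain w where w: "\<And>t. qeval q (?L t) = poly w t" using line[of q] by metis
  have "poly u 0 \<noteq> 0" using u[of 0] k by simp
  moreover have "poly w 1 \<noteq> 0" using w[of 1] l by simp
  ultimately have "u * w \<noteq> 0" by auto
  then have "finite {t. poly (u * w) t = 0}" by (rule poly_roots_finite)
  moreover have "infinite (of_real ` {0<..<1::real} :: complex set)"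
    by (subst finite_image_iff) (auto simp: inj_on_def infinite_Ioo)
  ultimately have "\<not> of_real ` {0<..<1::real} \<subseteq> {t. poly (u * w) t = 0}"
    using finite_subset by blast
  then obtain t :: real where "t \<in> {0<..<1}" and t3: "poly (u * w) (of_real t) \<noteq> 0"
    by blast
  then have t: "0 < t" "t < 1" by simp_all
  \<comment> \<open>For a real parameter between 0 and 1 the point is a convex combination of two
    positive points and so stays on the torus.\<close>
  have "?L (of_real t) v \<noteq> 0" if "v < N" for v
  proof -
    have "?L (of_real t) v = of_real ((1 - t) * real (k v) + t * real (l v))"
      by (simp add: algebra_simps)
    moreover have "(1 - t) * real (k v) + t * real (l v) > 0"
      using k(1) l(1) t that by (intro add_pos_pos mult_pos_pos) (auto simp: pos_nat_points_def)
    ultimately show ?thesis by (metis less_irrefl of_real_eq_0_iff)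
  qed
  then have "?L (of_real t) \<in> torus N"
    using k(1) l(1) by (auto simp: torus_def pos_nat_points_def)
  then show ?thesis using t3 by (intro bexI[of _ "?L (of_real t)"]) (simp add: qh.peval_mult u w)
qed

text \<open>That two generic properties hold jointly is the irreducibility of the torus, in the form
  of \<open>nonzero_mult_on_torus\<close>.\<close>

lemma eventually_generic:
  "eventually P (generic N) \<longleftrightarrow>
     (\<exists>q. (\<exists>x\<in>torus N. qeval q x \<noteq> (0::complex)) \<and> (\<forall>x\<in>torus N. qeval q x \<noteq> 0 \<longrightarrow> P x))"
  unfolding generic_def
proof (rule eventually_Abs_filter, rule is_filter.intro)
  have "(\<lambda>i. if i < N then 1 else 0) \<in> torus N" by (auto simp: torus_def)
  then show "\<exists>q. (\<exists>x\<in>torus N. qeval q x \<noteq> (0::complex)) \<and> (\<forall>x\<in>torus N. qeval q (x :: nat \<Rightarrow> complex) \<noteq> 0 \<longrightarrow> True)"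
    by (intro exI[of _ 1]) (auto simp: qh.peval_1)
next
  fix P Q :: "(nat \<Rightarrow> complex) \<Rightarrow> bool"
  assume "\<exists>q. (\<exists>x\<in>torus N. qeval q x \<noteq> (0::complex)) \<and> (\<forall>x\<in>torus N. qeval q x \<noteq> 0 \<longrightarrow> P x)"
    and "\<exists>q. (\<exists>x\<in>torus N. qeval q x \<noteq> (0::complex)) \<and> (\<forall>x\<in>torus N. qeval q x \<noteq> 0 \<longrightarrow> Q x)"
  then obtain p q x y where
      "x \<in> torus N" "qeval p x \<noteq> (0::complex)" "\<forall>x\<in>torus N. qeval p x \<noteq> 0 \<longrightarrow> P x"
      "y \<in> torus N" "qeval q y \<noteq> (0::complex)" "\<forall>x\<in>torus N. qeval q x \<noteq> 0 \<longrightarrow> Q x" by blast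
  then show "\<exists>q. (\<exists>x\<in>torus N. qeval q x \<noteq> (0::complex)) \<and> (\<forall>x\<in>torus N. qeval q x \<noteq> 0 \<longrightarrow> P x \<and> Q x)"
    by (intro exI[of _ "p * q"] conjI nonzero_mult_on_torus) (auto simp: qh.peval_mult)
next
  fix P Q :: "(nat \<Rightarrow> complex) \<Rightarrow> bool"
  assume imp: "\<forall>x. P x \<longrightarrow> Q x"
    and "\<exists>q. (\<exists>x\<in>torus N. qeval q x \<noteq> (0::complex)) \<and> (\<forall>x\<in>torus N. qeval q x \<noteq> 0 \<longrightarrow> P x)"
  then obtain q where "\<exists>x\<in>torus N. qeval q x \<noteq> (0::complex)" "\<forall>x\<in>torus N. qeval q x \<noteq> 0 \<longrightarrow> P x"
    by blast
  then show "\<exists>q. (\<exists>x\<in>torus N. qeval q x \<noteq> (0::complex)) \<and> (\<forall>x\<in>torus N. qeval q x \<noteq> 0 \<longrightarrow> Q x)"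
    using imp by (intro exI[of _ q]) auto
qed

lemma generic_if_near:
  "x0 \<in> torus N \<Longrightarrow> eventually P (near N x0) \<Longrightarrow> eventually P (generic N)"
  unfolding eventually_near eventually_generic by blast

lemma eventually_near_torus: "eventually (\<lambda>x. x \<in> torus N) (near N x0)"
  unfolding eventually_near by (rule exI[of _ 1]) (simp add: qh.peval_1)

lemma eventually_generic_torus: "eventually (\<lambda>x. x \<in> torus N) (generic N)"
proof -
  have "(\<lambda>i. if i < N then 1 else 0) \<in> torus N" by (simp add: torus_def)
  then show ?thesis unfolding eventually_generic by (intro exI[of _ 1]) (simp add: qh.peval_1, blast)
qed

lemma generic_pos_point:
  assumes "eventually P (generic N)"
  obtains x where "x \<in> pos_points N" "P x"
proof -
  obtain q x where q: "x \<in> torus N" "qeval q x \<noteq> (0::complex)" "\<forall>x\<in>torus N. qeval q x \<noteq> 0 \<longrightarrow> P x"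
    using assms unfolding eventually_generic by blast
  obtain k where "k \<in> pos_nat_points {..<N}" "qeval q (\<lambda>v. of_nat (k v)) \<noteq> (0::complex)"
    using nonzero_at_pos_point[OF q(1,2)] .
  then show thesis using that q(3) pos_nat_points_pos_points pos_points_torus by blast
qed

lemma generic_near_ex:
  assumes "x0 \<in> torus N" "eventually P (near N x0)" "eventually Q (generic N)"
  obtains x where "x \<in> pos_points N" "P x" "Q x"
  using generic_pos_point[OF eventually_conj[OF generic_if_near[OF assms(1,2)] assms(3)]] by blast

subsection \<open>Locally rational functions\<close>

text \<open>Regular germs at \<open>x0\<close>: the fraction represents \<open>f\<close> at every
  torus point where its denominator is nonzero, in particular at \<open>x0\<close> itself when
  \<open>x0\<close> lies on the torus.\<close>

definition lrat :: "nat \<Rightarrow> (nat \<Rightarrow> complex) \<Rightarrow> ((nat \<Rightarrow> complex) \<Rightarrow> complex) \<Rightarrow> bool" where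
  "lrat N x0 f \<longleftrightarrow> (\<exists>p q. qeval q x0 \<noteq> 0 \<and> (\<forall>x\<in>torus N. qeval q x \<noteq> 0 \<longrightarrow> f x = qeval p x / qeval q x))"

lemma lrat_iff:
  "lrat N x0 f \<longleftrightarrow> (\<exists>p q. qeval q x0 \<noteq> 0 \<and> eventually (\<lambda>x. f x = qeval p x / qeval q x) (near N x0))"
proof
  assume "\<exists>p q. qeval q x0 \<noteq> 0 \<and> eventually (\<lambda>x. f x = qeval p x / qeval q x) (near N x0)"
  then obtain p q s where "qeval q x0 \<noteq> 0" "qeval s x0 \<noteq> 0"
    "\<forall>x\<in>torus N. qeval s x \<noteq> 0 \<longrightarrow> f x = qeval p x / qeval q x" unfolding eventually_near by blast
  then show "lrat N x0 f"
    unfolding lrat_def by (intro exI[of _ "p * s"] exI[of _ "q * s"]) (auto simp: qh.peval_mult)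
next
  show "\<exists>p q. qeval q x0 \<noteq> 0 \<and> eventually (\<lambda>x. f x = qeval p x / qeval q x) (near N x0)" if "lrat N x0 f"
    using that unfolding lrat_def eventually_near by blast
qed

lemma lrat_cong:
  assumes "lrat N x0 f" "eventually (\<lambda>x. f x = g x) (near N x0)"
  shows "lrat N x0 g"
proof -
  obtain p q where pq: "qeval q x0 \<noteq> 0" "eventually (\<lambda>x. f x = qeval p x / qeval q x) (near N x0)"
    using assms(1) unfolding lrat_iff by blast
  have "eventually (\<lambda>x. g x = qeval p x / qeval q x) (near N x0)"
    using pq(2) assms(2) by eventually_elim simp
  then show ?thesis unfolding lrat_iff using pq(1) by blast
qed

lemma lrat_const_rat: "lrat N x0 (\<lambda>x. of_rat c)"
  unfolding lrat_def by (rule exI[of _ "pconst c"], rule exI[of _ 1]) (simp add: qh.peval_simps)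

lemma lrat_0: "lrat N x0 (\<lambda>x. 0)" and lrat_1: "lrat N x0 (\<lambda>x. 1)"
  using lrat_const_rat[of N x0 0] lrat_const_rat[of N x0 1] by simp_all

lemma lrat_coord: "lrat N x0 (\<lambda>x. x v)"
  unfolding lrat_def by (rule exI[of _ "pvar v"], rule exI[of _ 1]) (simp add: qh.peval_simps)

lemma lrat_add:
  assumes "lrat N x0 f" "lrat N x0 g"
  shows "lrat N x0 (\<lambda>x. f x + g x)"
proof -
  obtain p q where pq: "qeval q x0 \<noteq> 0" "\<forall>x\<in>torus N. qeval q x \<noteq> 0 \<longrightarrow> f x = qeval p x / qeval q x"
    using assms(1) unfolding lrat_def by blast
  obtain p' q' where pq': "qeval q' x0 \<noteq> 0" "\<forall>x\<in>torus N. qeval q' x \<noteq> 0 \<longrightarrow> g x = qeval p' x / qeval q' x"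
    using assms(2) unfolding lrat_def by blast
  show ?thesis unfolding lrat_def
    by (rule exI[of _ "p * q' + p' * q"], rule exI[of _ "q * q'"])
       (use pq pq' in \<open>auto simp: qh.peval_simps add_frac_eq\<close>)
qed

lemma lrat_mult:
  assumes "lrat N x0 f" "lrat N x0 g"
  shows "lrat N x0 (\<lambda>x. f x * g x)"
proof -
  obtain p q where pq: "qeval q x0 \<noteq> 0" "\<forall>x\<in>torus N. qeval q x \<noteq> 0 \<longrightarrow> f x = qeval p x / qeval q x"
    using assms(1) unfolding lrat_def by blast
  obtain p' q' where pq': "qeval q' x0 \<noteq> 0" "\<forall>x\<in>torus N. qeval q' x \<noteq> 0 \<longrightarrow> g x = qeval p' x / qeval q' x"
    using assms(2) unfolding lrat_def by blast
  show ?thesis unfolding lrat_def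
    by (rule exI[of _ "p * p'"], rule exI[of _ "q * q'"])
       (use pq pq' in \<open>auto simp: qh.peval_simps\<close>)
qed

lemma lrat_prod: "(\<And>a. a \<in> A \<Longrightarrow> lrat N x0 (f a)) \<Longrightarrow> lrat N x0 (\<lambda>x. \<Prod>a\<in>A. f a x)"
  by (induction A rule: infinite_finite_induct) (auto intro: lrat_1 lrat_mult)

lemma lrat_power: "lrat N x0 f \<Longrightarrow> lrat N x0 (\<lambda>x. f x ^ k)"
  by (induction k) (auto intro: lrat_1 lrat_mult)

text \<open>Off the torus the value of f at the base point is not controlled by \<open>lrat\<close>.\<close>

lemma lrat_nonzero:
  assumes "lrat N x0 f" "x0 \<in> torus N" "f x0 \<noteq> 0"
  shows "eventually (\<lambda>x. f x \<noteq> 0) (near N x0)"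
proof -
  obtain p q where pq: "qeval q x0 \<noteq> 0" "\<forall>x\<in>torus N. qeval q x \<noteq> 0 \<longrightarrow> f x = qeval p x / qeval q x"
    using assms(1) unfolding lrat_def by blast
  then have "qeval p x0 \<noteq> 0" using assms by auto
  with pq show ?thesis unfolding eventually_near
    by (intro exI[of _ "p * q"]) (auto simp: qh.peval_mult)
qed

lemma lrat_inverse:
  assumes "lrat N x0 f" "x0 \<in> torus N" "f x0 \<noteq> 0"
  shows "lrat N x0 (\<lambda>x. inverse (f x))"
proof -
  obtain p q where pq: "qeval q x0 \<noteq> 0" "\<forall>x\<in>torus N. qeval q x \<noteq> 0 \<longrightarrow> f x = qeval p x / qeval q x"
    using assms(1) unfolding lrat_def by blast
  then have "qeval p x0 \<noteq> 0" using assms by auto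
  with pq show ?thesis unfolding lrat_def
    by (intro exI[of _ "q * q"] exI[of _ "p * q"]) (auto simp: qh.peval_mult)
qed

lemma lrat_divide:
  "lrat N x0 f \<Longrightarrow> lrat N x0 g \<Longrightarrow> x0 \<in> torus N \<Longrightarrow> g x0 \<noteq> 0 \<Longrightarrow> lrat N x0 (\<lambda>x. f x / g x)"
  unfolding divide_inverse by (intro lrat_mult lrat_inverse)

lemma lrat_powi:
  assumes "lrat N x0 f" "x0 \<in> torus N" "f x0 \<noteq> 0"
  shows "lrat N x0 (\<lambda>x. f x powi k)"
  using assms by (cases "0 \<le> k") (auto simp: power_int_def intro!: lrat_power lrat_inverse)

lemma lrat_peval: "(\<And>v. lrat N x0 (\<lambda>x. g x v)) \<Longrightarrow> lrat N x0 (\<lambda>x. qeval p (g x))"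
  by (rule peval_closure[where Q = "lrat N x0"]) (auto intro: lrat_add lrat_mult lrat_0 lrat_1 lrat_const_rat)

lemma lrat_chr: "x0 \<in> torus N \<Longrightarrow> n \<le> N \<Longrightarrow> lrat N x0 (chr n \<mu>)"
  unfolding chr_def by (intro lrat_prod lrat_powi lrat_coord) (auto simp: torus_def)

text \<open>Otherwise the difference would be nonzero on a neighbourhood of \<open>x0\<close>, and
  that open set contains a positive point where both functions are known to agree.\<close>

lemma lrat_eq:
  assumes "lrat N x0 f" "lrat N x0 g" "x0 \<in> torus N"
    and "eventually (\<lambda>x. x \<in> pos_points N \<longrightarrow> f x = g x) (generic N)"
  shows "f x0 = g x0"
proof (rule ccontr)
  assume "f x0 \<noteq> g x0"
  have "lrat N x0 (\<lambda>x. f x + of_rat (-1) * g x)"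
    by (intro lrat_add lrat_mult assms lrat_const_rat)
  from lrat_nonzero[OF this assms(3)] \<open>f x0 \<noteq> g x0\<close>
  have "eventually (\<lambda>x. f x - g x \<noteq> 0) (near N x0)" by simp
  from generic_near_ex[OF assms(3) this assms(4)] show False by auto
qed

section \<open>Local morphisms from a torus to a variety\<close>

text \<open>Charts are only asked to have regular coordinates below \<open>n\<close>, whereas chart
  polynomials may mention every index. Vanishing of the others closes the gap.\<close>

definition coords_vanish :: "'a atlas \<Rightarrow> bool" where
  "coords_vanish Z \<longleftrightarrow> (\<forall>(D, n, \<phi>)\<in>Z. \<forall>x\<in>D. \<forall>k\<ge>n. \<phi> x k = 0)"

lemma coords_vanishD:
  "coords_vanish Z \<Longrightarrow> (D, n, \<phi>) \<in> Z \<Longrightarrow> x \<in> D \<Longrightarrow> n \<le> k \<Longrightarrow> \<phi> x k = 0"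
  unfolding coords_vanish_def by fast

lemma coords_vanish_variety: "variety X \<Longrightarrow> coords_vanish X"
  unfolding variety_def coords_vanish_def affine_chart_def affine_space_def by fast

lemma coords_vanish_torus: "coords_vanish (torus_var n)"
  by (simp add: coords_vanish_def torus_var_def torus_coords_def)

lemma coords_vanish_Gm: "coords_vanish Gm_var"
  by (simp add: coords_vanish_def Gm_var_def)

lemma coords_vanish_prod:
  assumes "coords_vanish X" "coords_vanish Y"
  shows "coords_vanish (X \<otimes>\<^sub>v Y)"
  unfolding coords_vanish_def
proof (rule ballI)
  fix c assume "c \<in> X \<otimes>\<^sub>v Y"
  then obtain D n \<phi> E m \<psi> where X: "(D, n, \<phi>) \<in> X" and Y: "(E, m, \<psi>) \<in> Y"
    and c: "c = (D \<times> E, n + m, \<lambda>(x, y) i. if i < n then \<phi> x i else \<psi> y (i - n))"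
    unfolding prod_atlas_def by auto
  show "case c of (D, n, \<phi>) \<Rightarrow> \<forall>x\<in>D. \<forall>k\<ge>n. \<phi> x k = 0"
    unfolding c using coords_vanishD[OF assms(2) Y] by auto
qed

lemma points_torus: "points (torus_var n) = torus n"
  by (simp add: points_def torus_var_def)

lemma points_Gm: "points Gm_var = {c. c \<noteq> 0}"
  by (simp add: points_def Gm_var_def)

lemma pointsE:
  assumes "x \<in> points Z"
  obtains D n \<phi> where "(D, n, \<phi>) \<in> Z" "x \<in> D"
  using assms unfolding points_def by blast

lemma points_prod: "points (X \<otimes>\<^sub>v Y) = points X \<times> points Y"
  unfolding points_def prod_atlas_def by fastforce

lemma zopen_points: "zopen X (points X)"
  unfolding zopen_def
proof (intro conjI subset_refl, clarify)
  fix D n \<phi> assume "(D, n, \<phi>) \<in> X"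
  then have "D \<subseteq> points X" unfolding points_def by blast
  then show "\<exists>P. points X \<inter> D = {x \<in> D. \<exists>p\<in>P. qeval p (\<phi> x) \<noteq> 0}"
    by (intro exI[of _ "{1}"]) (auto simp: qh.peval_1)
qed

lemma zopenE:
  assumes "zopen X U" "(D, n, \<phi>) \<in> X"
  obtains P where "U \<inter> D = {x \<in> D. \<exists>p\<in>P. qeval p (\<phi> x) \<noteq> 0}"
  using assms unfolding zopen_def by blast

lemma zopen_prod:
  assumes "zopen Y V"
  shows "zopen (X \<otimes>\<^sub>v Y) (points X \<times> V)"
  unfolding zopen_def
proof (intro conjI ballI)
  have "V \<subseteq> points Y" using assms by (simp add: zopen_def)
  then show "points X \<times> V \<subseteq> points (X \<otimes>\<^sub>v Y)" by (auto simp: points_prod)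
next
  fix c assume "c \<in> X \<otimes>\<^sub>v Y"
  then obtain D n \<phi> E m \<psi> where X: "(D, n, \<phi>) \<in> X" and Y: "(E, m, \<psi>) \<in> Y"
    and c: "c = (D \<times> E, n + m, \<lambda>(x, y) i. if i < n then \<phi> x i else \<psi> y (i - n))"
    unfolding prod_atlas_def by auto
  obtain P where P: "V \<inter> E = {y \<in> E. \<exists>p\<in>P. qeval p (\<psi> y) \<noteq> 0}"
    using zopenE[OF assms Y] .
  have D: "D \<subseteq> points X" using X unfolding points_def by blast
  \<comment> \<open>In a product chart the coordinates of the second factor are moved up by
    \<open>n\<close>, so its equations are rewritten in shifted variables.\<close>
  have "\<forall>p. \<exists>p'. \<forall>x. qeval p (\<lambda>v. x (v + n)) = qeval p' (x :: nat \<Rightarrow> complex)"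
    by (intro allI) (rule qh.peval_subst[of _ "\<lambda>v. pvar (v + n)", unfolded qh.peval_pvar])
  then obtain s where s: "\<And>p x. qeval p (\<lambda>v. x (v + n)) = qeval (s p) (x :: nat \<Rightarrow> complex)"
    by metis
  have "(points X \<times> V) \<inter> (D \<times> E) = {z \<in> D \<times> E. \<exists>p\<in>s ` P.
      qeval p ((\<lambda>(x, y) i. if i < n then \<phi> x i else \<psi> y (i - n)) z) \<noteq> 0}" (is "?L = ?R")
  proof (rule set_eqI, clarify)
    fix x y
    have "qeval (s p) (\<lambda>i. if i < n then \<phi> x i else \<psi> y (i - n)) = qeval p (\<psi> y)" for p
      unfolding s[symmetric] by simp
    then show "(x, y) \<in> ?L \<longleftrightarrow> (x, y) \<in> ?R" using P D by auto
  qed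
  then show "case c of (D, n, \<phi>) \<Rightarrow> \<exists>P. (points X \<times> V) \<inter> D = {x \<in> D. \<exists>p\<in>P. qeval p (\<phi> x) \<noteq> 0}"
    unfolding c prod.case by (rule exI)
qed

text \<open>Germs at \<open>x0\<close> of morphisms from the torus. \<open>F\<close> is total and
  its values far from \<open>x0\<close> are arbitrary, so composites of partial maps can be written
  with \<open>the\<close>, and definedness has to be checked only at the base point.\<close>

definition lmor :: "nat \<Rightarrow> 'z atlas \<Rightarrow> ((nat \<Rightarrow> complex) \<Rightarrow> 'z) \<Rightarrow> (nat \<Rightarrow> complex) \<Rightarrow> bool" where
  "lmor N Z F x0 \<longleftrightarrow> x0 \<in> torus N \<and> F x0 \<in> points Z \<and>
     (\<forall>(D, n, \<phi>)\<in>Z. F x0 \<in> D \<longrightarrow> eventually (\<lambda>x. F x \<in> D) (near N x0) \<and>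
        (\<forall>k<n. lrat N x0 (\<lambda>x. \<phi> (F x) k)))"

lemma lmor_torus: "lmor N Z F x0 \<Longrightarrow> x0 \<in> torus N"
  by (simp add: lmor_def)

lemma lmor_chart:
  assumes "lmor N Z F x0" "(D, n, \<phi>) \<in> Z" "F x0 \<in> D"
  shows "eventually (\<lambda>x. F x \<in> D) (near N x0)"
  using assms unfolding lmor_def by fast

lemma lmor_lrat:
  assumes "lmor N Z F x0" "(D, n, \<phi>) \<in> Z" "F x0 \<in> D" "k < n"
  shows "lrat N x0 (\<lambda>x. \<phi> (F x) k)"
  using assms unfolding lmor_def by fast

lemma lmor_coord:
  assumes "lmor N Z F x0" "coords_vanish Z" "(D, n, \<phi>) \<in> Z" "F x0 \<in> D"
  shows "lrat N x0 (\<lambda>x. \<phi> (F x) k)"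
proof (cases "k < n")
  case True
  then show ?thesis by (rule lmor_lrat[OF assms(1,3,4)])
next
  case False
  have "eventually (\<lambda>x. 0 = \<phi> (F x) k) (near N x0)"
    using lmor_chart[OF assms(1,3,4)]
    by eventually_elim (use False coords_vanishD[OF assms(2,3)] in auto)
  then show ?thesis by (rule lrat_cong[OF lrat_0])
qed

lemma lmor_open:
  assumes "lmor N Z F x0" "coords_vanish Z" "zopen Z U" "F x0 \<in> U"
  shows "eventually (\<lambda>x. F x \<in> U) (near N x0)"
proof -
  have "F x0 \<in> points Z" using assms(1) by (simp add: lmor_def)
  then obtain D n \<phi> where D: "(D, n, \<phi>) \<in> Z" "F x0 \<in> D" by (rule pointsE)
  obtain P where P: "U \<inter> D = {x \<in> D. \<exists>p\<in>P. qeval p (\<phi> x) \<noteq> 0}"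
    using zopenE[OF assms(3) D(1)] .
  then obtain p where p: "p \<in> P" "qeval p (\<phi> (F x0)) \<noteq> 0" using assms(4) D(2) by blast
  have "lrat N x0 (\<lambda>x. qeval p (\<phi> (F x)))"
    by (rule lrat_peval) (rule lmor_coord[OF assms(1,2) D])
  from lrat_nonzero[OF this lmor_torus[OF assms(1)] p(2)] lmor_chart[OF assms(1) D]
  show ?thesis by eventually_elim (use P p(1) in blast)
qed

lemma regular_onE:
  assumes "regular_on X U g" "(D, n, \<phi>) \<in> X" "x \<in> U" "x \<in> D"
  obtains p q V where "zopen X V" "x \<in> V"
    "\<And>y. y \<in> V \<Longrightarrow> y \<in> D \<Longrightarrow> qeval q (\<phi> y) \<noteq> 0 \<and> g y = qeval p (\<phi> y) / qeval q (\<phi> y)"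
  using assms unfolding regular_on_def by fast

lemma lmor_regular:
  assumes "lmor N Z F x0" "coords_vanish Z" "regular_on Z U g" "F x0 \<in> U"
  shows "lrat N x0 (\<lambda>x. g (F x))"
proof -
  have "F x0 \<in> points Z" using assms(1) by (simp add: lmor_def)
  then obtain D n \<phi> where D: "(D, n, \<phi>) \<in> Z" "F x0 \<in> D" by (rule pointsE)
  obtain p q V where V: "zopen Z V" "F x0 \<in> V"
    and pq: "\<And>y. y \<in> V \<Longrightarrow> y \<in> D \<Longrightarrow> qeval q (\<phi> y) \<noteq> 0 \<and> g y = qeval p (\<phi> y) / qeval q (\<phi> y)"
    by (rule regular_onE[OF assms(3) D(1) assms(4) D(2)]) (rule that)
  have "lrat N x0 (\<lambda>x. qeval p (\<phi> (F x)) / qeval q (\<phi> (F x)))"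
    by (intro lrat_divide lrat_peval lmor_coord[OF assms(1,2) D])
       (use lmor_torus[OF assms(1)] pq V(2) D(2) in auto)
  moreover have "eventually (\<lambda>x. qeval p (\<phi> (F x)) / qeval q (\<phi> (F x)) = g (F x)) (near N x0)"
    using lmor_open[OF assms(1,2) V] lmor_chart[OF assms(1) D]
    by eventually_elim (use pq in auto)
  ultimately show ?thesis by (rule lrat_cong)
qed

lemma rational_mapD:
  assumes "rational_map X Y f"
  shows "zopen X (dom f)" "zdense X (dom f)" "ran f \<subseteq> points Y"
    and "(E, m, \<psi>) \<in> Y \<Longrightarrow> zopen X {x \<in> dom f. the (f x) \<in> E}"
    and "(E, m, \<psi>) \<in> Y \<Longrightarrow> k < m \<Longrightarrow> regular_on X {x \<in> dom f. the (f x) \<in> E} (\<lambda>x. \<psi> (the (f x)) k)"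
  using assms unfolding rational_map_def by fast+

lemma lmor_rational_map:
  assumes "lmor N Z F x0" "coords_vanish Z" "rational_map Z Y g" "F x0 \<in> dom g"
  shows "lmor N Y (\<lambda>x. the (g (F x))) x0"
  unfolding lmor_def
proof (intro conjI ballI)
  show "x0 \<in> torus N" by (rule lmor_torus[OF assms(1)])
  show "the (g (F x0)) \<in> points Y"
    using assms(4) rational_mapD(3)[OF assms(3)] by (auto simp: ran_def)
next
  fix c assume c: "c \<in> Y"
  obtain E m \<psi> where [simp]: "c = (E, m, \<psi>)" by (cases c)
  note E = c[simplified]
  show "case c of (E, m, \<psi>) \<Rightarrow> the (g (F x0)) \<in> E \<longrightarrow>
      eventually (\<lambda>x. the (g (F x)) \<in> E) (near N x0) \<and> (\<forall>k<m. lrat N x0 (\<lambda>x. \<psi> (the (g (F x))) k))"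
  proof (simp, intro impI conjI allI)
    assume "the (g (F x0)) \<in> E"
    then have in_dom: "F x0 \<in> {x \<in> dom g. the (g x) \<in> E}" using assms(4) by simp
    from lmor_open[OF assms(1,2) rational_mapD(4)[OF assms(3) E] in_dom]
    show "eventually (\<lambda>x. the (g (F x)) \<in> E) (near N x0)" by eventually_elim simp
    show "lrat N x0 (\<lambda>x. \<psi> (the (g (F x))) k)" if "k < m" for k
      by (rule lmor_regular[OF assms(1,2) rational_mapD(5)[OF assms(3) E that] in_dom])
  qed
qed

lemma lmor_prod:
  assumes "lmor N Z F x0" "lmor N Y G x0"
  shows "lmor N (Z \<otimes>\<^sub>v Y) (\<lambda>x. (F x, G x)) x0"
  unfolding lmor_def
proof (intro conjI ballI)
  show "x0 \<in> torus N" by (rule lmor_torus[OF assms(1)])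
  show "(F x0, G x0) \<in> points (Z \<otimes>\<^sub>v Y)"
    using assms by (simp add: points_prod lmor_def)
next
  fix c assume "c \<in> Z \<otimes>\<^sub>v Y"
  then obtain D n \<phi> E m \<psi> where X: "(D, n, \<phi>) \<in> Z" and Y: "(E, m, \<psi>) \<in> Y"
    and c: "c = (D \<times> E, n + m, \<lambda>(x, y) i. if i < n then \<phi> x i else \<psi> y (i - n))"
    unfolding prod_atlas_def by auto
  show "case c of (D, n, \<phi>) \<Rightarrow> (F x0, G x0) \<in> D \<longrightarrow>
      eventually (\<lambda>x. (F x, G x) \<in> D) (near N x0) \<and> (\<forall>k<n. lrat N x0 (\<lambda>x. \<phi> (F x, G x) k))"
    unfolding c
  proof (simp, intro impI conjI allI, goal_cases)
    case 1
    then have "eventually (\<lambda>x. F x \<in> D) (near N x0)" "eventually (\<lambda>x. G x \<in> E) (near N x0)"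
      using lmor_chart[OF assms(1) X] lmor_chart[OF assms(2) Y] by blast+
    then show ?case by eventually_elim simp
  next
    case (2 k)
    then show ?case
      using lmor_lrat[OF assms(1) X, of k] lmor_lrat[OF assms(2) Y, of "k - n"]
      by (cases "k < n") auto
  qed
qed

text \<open>Regular coordinates suffice: the inverses in the second half of
  \<open>torus_coords\<close> are regular because the coordinates do not vanish at
  \<open>x0\<close>.\<close>

lemma lmor_to_torus:
  assumes "x0 \<in> torus N" "\<And>v. v < M \<Longrightarrow> lrat N x0 (\<lambda>x. \<Phi> x v)" "\<Phi> x0 \<in> torus M"
    and "eventually (\<lambda>x. \<forall>v\<ge>M. \<Phi> x v = 0) (near N x0)"
  shows "lmor N (torus_var M) \<Phi> x0"
proof -
  have ne: "\<Phi> x0 v \<noteq> 0" if "v < M" for v using assms(3) that by (simp add: torus_def)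
  have "eventually (\<lambda>x. \<forall>v\<in>{..<M}. \<Phi> x v \<noteq> 0) (near N x0)"
    by (rule eventually_ball_finite) (use lrat_nonzero[OF assms(2,1)] ne in auto)
  with assms(4) have "eventually (\<lambda>x. \<Phi> x \<in> torus M) (near N x0)"
    by eventually_elim (simp add: torus_def)
  moreover have "lrat N x0 (\<lambda>x. torus_coords M (\<Phi> x) k)" if "k < 2 * M" for k
    using that assms(2)[of k] lrat_inverse[OF assms(2)[of "k - M"] assms(1) ne[of "k - M"]]
    by (cases "k < M") (auto simp: torus_coords_def)
  ultimately show ?thesis
    using assms(1,3) by (simp add: lmor_def torus_var_def points_def)
qed

lemma lmor_torus_coord:
  assumes "lmor N (torus_var M) \<Phi> x0"
  shows "lrat N x0 (\<lambda>x. \<Phi> x v)"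
proof (cases "v < M")
  case True
  have "\<Phi> x0 \<in> torus M" using assms by (simp add: lmor_def points_torus)
  then have "lrat N x0 (\<lambda>x. torus_coords M (\<Phi> x) v)"
    using lmor_coord[OF assms coords_vanish_torus, of "torus M" "2 * M" "torus_coords M" v]
    by (simp add: torus_var_def)
  then show ?thesis using True by (simp add: torus_coords_def)
next
  case False
  have "\<Phi> x0 \<in> torus M" using assms by (simp add: lmor_def points_torus)
  then have "eventually (\<lambda>x. \<Phi> x \<in> torus M) (near N x0)"
    using lmor_chart[OF assms, of "torus M" "2 * M" "torus_coords M"] by (simp add: torus_var_def)
  then have "eventually (\<lambda>x. 0 = \<Phi> x v) (near N x0)"
    by eventually_elim (use False in \<open>simp add: torus_def\<close>)
  then show ?thesis by (rule lrat_cong[OF lrat_0])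
qed

lemma lmor_Gm:
  assumes "x0 \<in> torus N" "lrat N x0 c" "c x0 \<noteq> 0"
  shows "lmor N Gm_var c x0"
  using assms lrat_nonzero[OF assms(2,1,3)] lrat_inverse[OF assms(2,1,3)]
  by (simp add: lmor_def Gm_var_def points_def less_2_cases_iff)

lemma lmor_id: "x0 \<in> torus N \<Longrightarrow> lmor N (torus_var N) (\<lambda>x. x) x0"
  using eventually_near_torus[of N x0]
  by (intro lmor_to_torus lrat_coord) (auto elim!: eventually_mono simp: torus_def)

lemma near_lmor:
  assumes "lmor N (torus_var M) \<Phi> x0" "eventually P (near M (\<Phi> x0))"
  shows "eventually (\<lambda>x. P (\<Phi> x)) (near N x0)"
proof -
  obtain q where q: "qeval q (\<Phi> x0) \<noteq> 0" "\<And>x. x \<in> torus M \<Longrightarrow> qeval q x \<noteq> 0 \<Longrightarrow> P x"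
    using assms(2) unfolding eventually_near by blast
  have "lrat N x0 (\<lambda>x. qeval q (\<Phi> x))"
    by (intro lrat_peval lmor_torus_coord[OF assms(1)])
  from lrat_nonzero[OF this lmor_torus[OF assms(1)] q(1)]
  have "eventually (\<lambda>x. qeval q (\<Phi> x) \<noteq> 0) (near N x0)" .
  moreover have "eventually (\<lambda>x. \<Phi> x \<in> torus M) (near N x0)"
    using assms(1) by (simp add: lmor_def torus_var_def points_def)
  ultimately show ?thesis by eventually_elim (rule q(2))
qed

text \<open>A property of generic points can be pulled back along a map whose image contains the positive
  points, since these are Zariski dense.\<close>

lemma generic_pullback:
  assumes "eventually P (generic M)"
    and "\<And>y. y \<in> pos_points M \<Longrightarrow> \<exists>x. lmor N (torus_var M) \<Phi> x \<and> \<Phi> x = y"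
  shows "eventually (\<lambda>x. P (\<Phi> x)) (generic N)"
proof -
  obtain q y where q: "y \<in> torus M" "qeval q y \<noteq> (0::complex)" "\<forall>x\<in>torus M. qeval q x \<noteq> 0 \<longrightarrow> P x"
    using assms(1) unfolding eventually_generic by blast
  obtain k where k: "k \<in> pos_nat_points {..<M}" "qeval q (\<lambda>v. of_nat (k v)) \<noteq> (0::complex)"
    using nonzero_at_pos_point[OF q(1,2)] .
  obtain x where x: "lmor N (torus_var M) \<Phi> x" "\<Phi> x = (\<lambda>v. of_nat (k v))"
    using assms(2)[OF pos_nat_points_pos_points[OF k(1)]] by blast
  have "eventually P (near M (\<Phi> x))"
    unfolding eventually_near using q(3) k(2) x(2) by auto
  from generic_if_near[OF lmor_torus[OF x(1)] near_lmor[OF x(1) this]] show ?thesis .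
qed

lemma zdense_ne:
  assumes "zdense X U" "points X \<noteq> {}"
  obtains x where "x \<in> U"
  using assms zopen_points[of X] unfolding zdense_def by blast

lemma torus_nonempty: "torus n \<noteq> ({} :: (nat \<Rightarrow> complex) set)"
proof -
  have "(\<lambda>i. if i < n then 1 else 0 :: complex) \<in> torus n" by (simp add: torus_def)
  then show ?thesis by blast
qed

lemma generic_zopen:
  assumes "zopen (torus_var N) V" "V \<noteq> {}"
  shows "eventually (\<lambda>x. x \<in> V) (generic N)"
proof -
  obtain x0 where x0: "x0 \<in> V" using assms(2) by blast
  then have t: "x0 \<in> torus N" using assms(1) by (auto simp: zopen_def points_torus)
  show ?thesis
    by (rule generic_if_near[OF t lmor_open[OF lmor_id[OF t] coords_vanish_torus assms(1) x0]])
qed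

lemma generic_zdense:
  assumes "zopen (torus_var N) V" "zdense (torus_var N) V"
  shows "eventually (\<lambda>x. x \<in> V) (generic N)"
proof -
  have "V \<noteq> {}"
    using zdense_ne[OF assms(2)] torus_nonempty[of N] by (auto simp: points_torus)
  then show ?thesis by (rule generic_zopen[OF assms(1)])
qed

lemma generic_rat_eq:
  assumes "rat_eq (torus_var N) f g"
  shows "eventually (\<lambda>x. x \<in> dom f \<and> f x = g x) (generic N)"
proof -
  obtain V where V: "zopen (torus_var N) V" "zdense (torus_var N) V" "V \<subseteq> dom f \<inter> dom g"
    "\<forall>x\<in>V. f x = g x" using assms unfolding rat_eq_def by blast
  show ?thesis using generic_zdense[OF V(1,2)] by eventually_elim (use V(3,4) in auto)
qed

lemma rat_eq_if_generic:
  assumes "eventually (\<lambda>x. x \<in> dom f \<and> f x = g x) (generic N)"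
  shows "rat_eq (torus_var N) f g"
proof -
  obtain q where q: "\<exists>x\<in>torus N. qeval q x \<noteq> (0::complex)"
      "\<And>x. x \<in> torus N \<Longrightarrow> qeval q x \<noteq> 0 \<Longrightarrow> x \<in> dom f \<and> f x = g x"
    using assms unfolding eventually_generic by blast
  define V where "V = {x \<in> torus N. qeval q x \<noteq> (0::complex)}"
  \<comment> \<open>In the torus chart the indices from \<open>N\<close> to \<open>2 * N - 1\<close>
    hold inverses, so these variables are set to zero before the polynomial is read in chart
    coordinates.\<close>
  have "\<exists>q'. \<forall>y. qeval q (\<lambda>v. qeval (if v < N then pvar v else 0) y) = qeval q' (y :: nat \<Rightarrow> complex)"
    by (rule qh.peval_subst)
  then obtain q' where q': "\<And>y. qeval q (\<lambda>v. qeval (if v < N then pvar v else 0) y) = qeval q' (y :: nat \<Rightarrow> complex)"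
    by blast
  have "qeval q' (torus_coords N x) = qeval q x" if "x \<in> torus N" for x :: "nat \<Rightarrow> complex"
  proof -
    have "(\<lambda>v. qeval (if v < N then pvar v else 0) (torus_coords N x)) = x"
      using that by (auto simp: fun_eq_iff qh.peval_pvar qh.peval_0 torus_coords_def torus_def)
    then show ?thesis using q'[of "torus_coords N x"] by simp
  qed
  then have eq: "V \<inter> torus N = {x \<in> torus N. \<exists>p\<in>{q'}. qeval p (torus_coords N x) \<noteq> 0}"
    by (auto simp: V_def)
  have V: "zopen (torus_var N) V"
    unfolding zopen_def points_torus
  proof
    show "V \<subseteq> torus N" by (auto simp: V_def)
    show "\<forall>(D, n, \<phi>)\<in>torus_var N. \<exists>P. V \<inter> D = {x \<in> D. \<exists>p\<in>P. qeval p (\<phi> x) \<noteq> 0}"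
      by (simp add: torus_var_def) (rule exI, rule eq)
  qed
  have V_gen: "eventually (\<lambda>x. x \<in> V) (generic N)"
    unfolding eventually_generic V_def using q(1) by blast
  have "zdense (torus_var N) V"
    unfolding zdense_def
  proof (intro allI impI, elim conjE)
    fix W assume "zopen (torus_var N) W" "W \<noteq> {}"
    from generic_pos_point[OF eventually_conj[OF V_gen generic_zopen[OF this]]]
    show "V \<inter> W \<noteq> {}" by blast
  qed
  moreover have fg: "\<forall>x\<in>V. f x = g x" and dom: "V \<subseteq> dom f"
    using q(2) by (auto simp: V_def)
  moreover have "V \<subseteq> dom g"
  proof
    fix x assume "x \<in> V"
    then have "x \<in> dom f" "f x = g x" using fg dom by auto
    then show "x \<in> dom g" by (auto simp: dom_def)
  qed
  ultimately show ?thesis unfolding rat_eq_def using V by blast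
qed

text \<open>Density yields a point of \<open>U\<close> over \<open>V\<close>, a part of
  \<open>X\<close> that the parametrization reaches; it lifts to a torus point, and the open
  condition spreads to a neighbourhood there.\<close>

lemma generic_prod:
  assumes "zopen (A \<otimes>\<^sub>v X) U" "zdense (A \<otimes>\<^sub>v X) U" "coords_vanish A" "coords_vanish X"
    and "zopen X V" "V \<noteq> {}" "points A \<noteq> {}"
    and lift: "\<forall>a\<in>points A. \<forall>x\<in>V.
      \<exists>z. lmor N A F z \<and> lmor N X G z \<and> F z = a \<and> G z = x"
  shows "eventually (\<lambda>z. (F z, G z) \<in> U) (generic N)"
proof -
  have "points A \<times> V \<noteq> {}" using assms by blast
  then obtain a x where ax: "(a, x) \<in> U" "a \<in> points A" "x \<in> V"
    using assms(2) zopen_prod[OF assms(5), of A] unfolding zdense_def by blast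
  then obtain z where z: "lmor N A F z" "lmor N X G z" "F z = a" "G z = x" using lift by blast
  have "eventually (\<lambda>z. (F z, G z) \<in> U) (near N z)"
    by (rule lmor_open[OF lmor_prod[OF z(1,2)] coords_vanish_prod[OF assms(3,4)] assms(1)])
       (simp add: z ax)
  then show ?thesis by (rule generic_if_near[OF lmor_torus[OF z(1)]])
qed

lemma generic_rat_eq_prod:
  assumes "rat_eq (A \<otimes>\<^sub>v X) f g" "coords_vanish A" "coords_vanish X"
    and "zopen X V" "V \<noteq> {}" "points A \<noteq> {}"
    and "\<forall>a\<in>points A. \<forall>x\<in>V.
      \<exists>z. lmor N A F z \<and> lmor N X G z \<and> F z = a \<and> G z = x"
  shows "eventually (\<lambda>z. (F z, G z) \<in> dom f \<and> f (F z, G z) = g (F z, G z)) (generic N)"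
proof -
  obtain U where U: "zopen (A \<otimes>\<^sub>v X) U" "zdense (A \<otimes>\<^sub>v X) U" "U \<subseteq> dom f \<inter> dom g"
    "\<forall>x\<in>U. f x = g x" using assms(1) unfolding rat_eq_def by blast
  have "eventually (\<lambda>z. (F z, G z) \<in> U) (generic N)"
    by (rule generic_prod[OF U(1,2) assms(2-7)])
  then show ?thesis by eventually_elim (use U(3,4) in auto)
qed

section \<open>Positive polynomials and positive maps\<close>

text \<open>Coefficients with natural exponents, to be evaluated in any field. Repeated exponents
  are harmless: positive coefficients cannot cancel, and minima over the exponents ignore
  multiplicity.\<close>

type_synonym pospol = "(nat \<times> (nat \<Rightarrow> nat)) list"

definition pos_terms :: "pospol \<Rightarrow> bool" where
  "pos_terms L \<longleftrightarrow> L \<noteq> [] \<and> (\<forall>(a, \<mu>)\<in>set L. a > 0)"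

definition pval :: "nat \<Rightarrow> pospol \<Rightarrow> (nat \<Rightarrow> 'k::field) \<Rightarrow> 'k" where
  "pval n L x = (\<Sum>(a, \<mu>)\<leftarrow>L. of_nat a * (\<Prod>i<n. x i ^ \<mu> i))"

lemma pval_Nil: "pval n [] x = 0"
  by (simp add: pval_def)

lemma pval_Cons: "pval n ((a, \<mu>) # L) x = of_nat a * (\<Prod>i<n. x i ^ \<mu> i) + pval n L x"
  by (simp add: pval_def)

lemma pos_terms_induct [consumes 1, case_names single cons]:
  assumes "pos_terms L"
    and "\<And>a \<mu>. a > 0 \<Longrightarrow> Q [(a, \<mu>)]"
    and "\<And>a \<mu> L. a > 0 \<Longrightarrow> pos_terms L \<Longrightarrow> Q L \<Longrightarrow> Q ((a, \<mu>) # L)"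
  shows "Q L"
  using assms(1)
proof (induction L)
  case Nil
  then show ?case by (simp add: pos_terms_def)
next
  case (Cons c L)
  obtain a \<mu> where [simp]: "c = (a, \<mu>)" by (cases c)
  show ?case
  proof (cases "L = []")
    case True
    then show ?thesis using Cons.prems assms(2) by (simp add: pos_terms_def)
  next
    case False
    then have "pos_terms L" "a > 0" using Cons.prems by (auto simp: pos_terms_def)
    then show ?thesis using Cons.IH assms(3) by simp
  qed
qed

definition pos_poly :: "nat \<Rightarrow> pospol \<Rightarrow> (nat, rat) pol" where
  "pos_poly n L = (\<Sum>(a, \<mu>)\<leftarrow>L. pconst (of_nat a) * (\<Prod>i<n. pvar i ^ \<mu> i))"

lemma qeval_pos_poly: "qeval (pos_poly n L) x = pval n L x"
  by (induction L) (auto simp: pos_poly_def pval_def qh.peval_simps)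

lemma lrat_pval: "(\<And>v. lrat N x0 (\<lambda>x. g x v)) \<Longrightarrow> lrat N x0 (\<lambda>x. pval n L (g x))"
  unfolding qeval_pos_poly[symmetric] by (rule lrat_peval)

lemma pos_monomial:
  assumes "x \<in> pos_points n"
  shows "\<exists>c>0. (\<Prod>i<n. x i ^ \<mu> i) = complex_of_real c"
proof -
  obtain a where a: "\<And>i. i < n \<Longrightarrow> a i > 0 \<and> x i = complex_of_real (a i)"
    using assms unfolding pos_points_def mem_Collect_eq by metis
  then have "(\<Prod>i<n. x i ^ \<mu> i) = complex_of_real (\<Prod>i<n. a i ^ \<mu> i)" by simp
  moreover have "(\<Prod>i<n. a i ^ \<mu> i) > 0" using a by (intro prod_pos) auto
  ultimately show ?thesis by blast
qed

lemma pval_pos: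
  assumes "pos_terms L" "x \<in> pos_points n"
  shows "\<exists>c>0. pval n L x = complex_of_real c"
  using assms(1)
proof (induction rule: pos_terms_induct)
  case (single a \<mu>)
  obtain c where "c > 0" "(\<Prod>i<n. x i ^ \<mu> i) = complex_of_real c"
    using pos_monomial[OF assms(2)] by blast
  then show ?case using single by (intro exI[of _ "real a * c"]) (simp add: pval_Cons pval_Nil)
next
  case (cons a \<mu> L)
  obtain c where "c > 0" "(\<Prod>i<n. x i ^ \<mu> i) = complex_of_real c"
    using pos_monomial[OF assms(2)] by blast
  moreover obtain d where "d > 0" "pval n L x = complex_of_real d" using cons by blast
  ultimately show ?case using cons(1)
    by (intro exI[of _ "real a * c + d"]) (simp add: pval_Cons add_pos_pos)
qed

lemma pval_nonzero: "pos_terms L \<Longrightarrow> x \<in> pos_points n \<Longrightarrow> pval n L x \<noteq> 0"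
  using pval_pos[of L x n] by (metis less_irrefl of_real_eq_0_iff)

lemma ex_bounded_lattice:
  fixes F :: "(nat \<Rightarrow> int) set"
  assumes "finite F"
  shows "\<exists>K. \<forall>\<mu>\<in>F. \<forall>i<n. - int K \<le> \<mu> i"
proof (rule exI, intro ballI allI impI)
  fix \<mu> i assume "\<mu> \<in> F" "i < n"
  then have "nat \<bar>\<mu> i\<bar> \<le> (\<Sum>i<n. nat \<bar>\<mu> i\<bar>)" "(\<Sum>i<n. nat \<bar>\<mu> i\<bar>) \<le> (\<Sum>\<mu>\<in>F. \<Sum>i<n. nat \<bar>\<mu> i\<bar>)"
    using assms by (auto intro!: member_le_sum)
  then show "- int (\<Sum>\<mu>\<in>F. \<Sum>i<n. nat \<bar>\<mu> i\<bar>) \<le> \<mu> i" by linarith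
qed

text \<open>Multiplying by a high power of all coordinates makes the exponents nonnegative. Every
  power from \<open>K0\<close> on is offered, so that numerator and denominator of a positive
  function can be cleared by the same factor.\<close>

lemma positive_comb_clear:
  assumes "positive_comb n f"
  shows "\<exists>K0. \<forall>K\<ge>K0. \<exists>L. pos_terms L \<and> (\<forall>x\<in>torus n. f x * (\<Prod>i<n. x i ^ K) = pval n L x)"
proof -
  obtain F and a :: "(nat \<Rightarrow> int) \<Rightarrow> nat" where F: "finite F" "F \<noteq> {}" "\<And>\<mu>. \<mu> \<in> F \<Longrightarrow> a \<mu> > 0"
    and f: "f = (\<lambda>x. \<Sum>\<mu>\<in>F. of_nat (a \<mu>) * chr n \<mu> x)"
    using assms unfolding positive_comb_def by blast
  obtain K0 where K0: "\<And>\<mu> i. \<mu> \<in> F \<Longrightarrow> i < n \<Longrightarrow> - int K0 \<le> \<mu> i"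
    using ex_bounded_lattice[OF F(1)] by blast
  obtain xs where xs: "set xs = F" "distinct xs" using finite_distinct_list[OF F(1)] by blast
  have "\<exists>L. pos_terms L \<and> (\<forall>x\<in>torus n. f x * (\<Prod>i<n. x i ^ K) = pval n L x)" if K: "K \<ge> K0" for K
  proof (intro exI conjI ballI)
    let ?L = "map (\<lambda>\<mu>. (a \<mu>, \<lambda>i. nat (\<mu> i + int K))) xs"
    show "pos_terms ?L" using xs F by (auto simp: pos_terms_def)
    fix x :: "nat \<Rightarrow> complex" assume x: "x \<in> torus n"
    have mon: "chr n \<mu> x * (\<Prod>i<n. x i ^ K) = (\<Prod>i<n. x i ^ nat (\<mu> i + int K))" if "\<mu> \<in> F" for \<mu>
      unfolding chr_def prod.distrib[symmetric]
    proof (rule prod.cong[OF refl])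
      fix i assume "i \<in> {..<n}"
      then have i: "x i \<noteq> 0" "0 \<le> \<mu> i + int K" using x K0[OF that] K by (force simp: torus_def)+
      then have "x i ^ nat (\<mu> i + int K) = x i powi (\<mu> i + int K)" by (simp add: power_int_def)
      also have "\<dots> = x i powi \<mu> i * x i ^ K" using i by (simp add: power_int_add)
      finally show "x i powi \<mu> i * x i ^ K = x i ^ nat (\<mu> i + int K)" by simp
    qed
    have "f x * (\<Prod>i<n. x i ^ K) = (\<Sum>\<mu>\<in>F. of_nat (a \<mu>) * (\<Prod>i<n. x i ^ nat (\<mu> i + int K)))"
      unfolding f sum_distrib_right by (rule sum.cong) (simp_all add: mon mult.assoc)
    also have "\<dots> = pval n ?L x"
      by (simp add: pval_def o_def sum.distinct_set_conv_list[OF xs(2)] flip: xs(1))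
    finally show "f x * (\<Prod>i<n. x i ^ K) = pval n ?L x" .
  qed
  then show ?thesis by blast
qed

lemma positive_function_quotient:
  assumes "positive_function n g"
  shows "\<exists>L M. pos_terms L \<and> pos_terms M \<and>
    eventually (\<lambda>x. pval n M x \<noteq> 0 \<and> g x = Some (pval n L x / pval n M x)) (generic n)"
proof -
  obtain f' f'' where f: "positive_comb n f'" "positive_comb n f''"
    and eq: "rat_eq (torus_var n) g (\<lambda>x. if f'' x \<noteq> 0 then Some (f' x / f'' x) else None)"
    using assms unfolding positive_function_def by blast
  obtain K1 where K1: "\<And>K. K \<ge> K1 \<Longrightarrow>
      \<exists>L. pos_terms L \<and> (\<forall>x\<in>torus n. f' x * (\<Prod>i<n. x i ^ K) = pval n L x)"
    using positive_comb_clear[OF f(1)] by blast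
  obtain K2 where K2: "\<And>K. K \<ge> K2 \<Longrightarrow>
      \<exists>L. pos_terms L \<and> (\<forall>x\<in>torus n. f'' x * (\<Prod>i<n. x i ^ K) = pval n L x)"
    using positive_comb_clear[OF f(2)] by blast
  let ?K = "max K1 K2"
  obtain L where L: "pos_terms L" "\<And>x. x \<in> torus n \<Longrightarrow> f' x * (\<Prod>i<n. x i ^ ?K) = pval n L x"
    using K1[of ?K] by auto
  obtain M where M: "pos_terms M" "\<And>x. x \<in> torus n \<Longrightarrow> f'' x * (\<Prod>i<n. x i ^ ?K) = pval n M x"
    using K2[of ?K] by auto
  have "eventually (\<lambda>x. pval n M x \<noteq> 0 \<and> g x = Some (pval n L x / pval n M x)) (generic n)"
    using generic_rat_eq[OF eq] eventually_generic_torus[of n]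
  proof eventually_elim
    case (elim x)
    then obtain y where "g x = Some y" by blast
    then have "f'' x \<noteq> 0" "g x = Some (f' x / f'' x)"
      using elim by (auto split: if_splits)
    moreover have "(\<Prod>i<n. x i ^ ?K) \<noteq> 0" using elim by (auto simp: torus_def)
    ultimately show ?case using L(2) M(2) elim by (simp flip: L(2) M(2))
  qed
  then show ?thesis using L(1) M(1) by blast
qed

definition quot_map :: "nat \<Rightarrow> nat \<Rightarrow> (nat \<Rightarrow> pospol) \<Rightarrow> (nat \<Rightarrow> pospol) \<Rightarrow> (nat \<Rightarrow> complex) \<Rightarrow> nat \<Rightarrow> complex" where
  "quot_map n m A B x = (\<lambda>j. if j < m then pval n (A j) x / pval n (B j) x else 0)"

text \<open>The given representative \<open>f\<close> may be undefined at a particular positive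
  point; \<open>quot_map\<close> agrees with it generically and has nonzero denominators at every
  positive point.\<close>

definition pos_rep :: "nat \<Rightarrow> nat \<Rightarrow> ((nat \<Rightarrow> complex) \<rightharpoonup> (nat \<Rightarrow> complex)) \<Rightarrow>
    (nat \<Rightarrow> pospol) \<Rightarrow> (nat \<Rightarrow> pospol) \<Rightarrow> bool" where
  "pos_rep n m f A B \<longleftrightarrow> (\<forall>j<m. pos_terms (A j) \<and> pos_terms (B j)) \<and>
     eventually (\<lambda>x. f x = Some (quot_map n m A B x) \<and> (\<forall>j<m. pval n (B j) x \<noteq> 0)) (generic n)"

lemma chr_unit:
  assumes "i < n"
  shows "chr n (\<lambda>k. if k = i then 1 else 0) y = y i"
proof -
  have "chr n (\<lambda>k. if k = i then 1 else 0) y = (\<Prod>k<n. if k = i then y i else 1)"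
    unfolding chr_def by (rule prod.cong) auto
  then show ?thesis using assms by simp
qed

lemma pos_rep_exists:
  assumes "positive_map n m f"
  shows "\<exists>A B. pos_rep n m f A B"
proof -
  have f: "rational_map (torus_var n) (torus_var m) f"
    and pos: "\<And>\<mu>. \<mu> \<in> lattice m \<Longrightarrow> positive_function n (\<lambda>x. map_option (chr m \<mu>) (f x))"
    using assms unfolding positive_map_def by blast+
  \<comment> \<open>The coordinate characters of the target already determine all
    components.\<close>
  let ?u = "\<lambda>j i. if i = j then 1 else 0 :: int"
  define R where "R j L M \<longleftrightarrow> pos_terms L \<and> pos_terms M \<and> eventually (\<lambda>x. pval n M x \<noteq> 0 \<and>
      map_option (\<lambda>y. y j) (f x) = Some (pval n L x / pval n M x)) (generic n)" for j L M
  have "\<exists>L M. R j L M" if "j < m" for j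
  proof -
    have "?u j \<in> lattice m" using that by (simp add: lattice_def)
    from positive_function_quotient[OF pos[OF this]] show ?thesis
      unfolding R_def by (simp add: chr_unit[OF that])
  qed
  then obtain A B where "\<And>j. j < m \<Longrightarrow> R j (A j) (B j)" by metis
  then have AB: "\<And>j. j < m \<Longrightarrow> pos_terms (A j) \<and> pos_terms (B j) \<and>
      eventually (\<lambda>x. pval n (B j) x \<noteq> 0 \<and>
        map_option (\<lambda>y. y j) (f x) = Some (pval n (A j) x / pval n (B j) x)) (generic n)"
    unfolding R_def .
  have "eventually (\<lambda>x. \<forall>j\<in>{..<m}. pval n (B j) x \<noteq> 0 \<and>
      map_option (\<lambda>y. y j) (f x) = Some (pval n (A j) x / pval n (B j) x)) (generic n)"
    by (rule eventually_ball_finite) (use AB in auto)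
  moreover have "eventually (\<lambda>x. x \<in> dom f) (generic n)"
    using rational_mapD(1,2)[OF f] by (rule generic_zdense)
  ultimately have "eventually (\<lambda>x. f x = Some (quot_map n m A B x) \<and> (\<forall>j<m. pval n (B j) x \<noteq> 0)) (generic n)"
  proof eventually_elim
    case (elim x)
    then obtain y where y: "f x = Some y" by blast
    have "y \<in> torus m" using rational_mapD(3)[OF f] y by (auto simp: ran_def points_torus)
    then have "y = quot_map n m A B x"
      using elim y by (auto simp: fun_eq_iff quot_map_def torus_def)
    then show ?case using y elim by simp
  qed
  then show ?thesis unfolding pos_rep_def using AB by blast
qed

lemma quot_map_pos:
  assumes "pos_rep n m f A B" "x \<in> pos_points n"
  shows "quot_map n m A B x \<in> pos_points m"
proof -
  have "\<exists>c>0. quot_map n m A B x i = complex_of_real c" if "i < m" for i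
  proof -
    have AB: "pos_terms (A i)" "pos_terms (B i)" using assms(1) that by (simp_all add: pos_rep_def)
    obtain a where "a > 0" "pval n (A i) x = complex_of_real a"
      using pval_pos[OF AB(1) assms(2)] by blast
    moreover obtain b where "b > 0" "pval n (B i) x = complex_of_real b"
      using pval_pos[OF AB(2) assms(2)] by blast
    ultimately show ?thesis using that by (intro exI[of _ "a / b"]) (simp add: quot_map_def)
  qed
  then show ?thesis by (simp add: pos_points_def quot_map_def)
qed

lemma lmor_quot_map:
  assumes "pos_rep n m f A B" "lmor N (torus_var n) F x0" "F x0 \<in> pos_points n"
  shows "lmor N (torus_var m) (\<lambda>x. quot_map n m A B (F x)) x0"
proof (rule lmor_to_torus)
  show x0: "x0 \<in> torus N" by (rule lmor_torus[OF assms(2)])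
  show "lrat N x0 (\<lambda>x. quot_map n m A B (F x) v)" if "v < m" for v
  proof -
    have "pos_terms (B v)" using assms(1) that by (simp add: pos_rep_def)
    then have "pval n (B v) (F x0) \<noteq> 0" by (rule pval_nonzero[OF _ assms(3)])
    then have "lrat N x0 (\<lambda>x. pval n (A v) (F x) / pval n (B v) (F x))"
      by (intro lrat_divide lrat_pval lmor_torus_coord[OF assms(2)] x0)
    then show ?thesis using that by (simp add: quot_map_def)
  qed
  show "quot_map n m A B (F x0) \<in> torus m"
    by (rule pos_points_torus[OF quot_map_pos[OF assms(1,3)]])
qed (simp add: quot_map_def)

lemma lmor_eq_pos:
  assumes "lmor N (torus_var m) F x0" "lmor N (torus_var m) G x0"
    and "eventually (\<lambda>x. x \<in> pos_points N \<longrightarrow> F x = G x) (generic N)"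
  shows "F x0 = G x0"
proof
  fix v
  have "eventually (\<lambda>x. x \<in> pos_points N \<longrightarrow> F x v = G x v) (generic N)"
    using assms(3) by eventually_elim auto
  then show "F x0 v = G x0 v"
    by (intro lrat_eq[OF lmor_torus_coord[OF assms(1)] lmor_torus_coord[OF assms(2)] lmor_torus[OF assms(1)]])
qed

section \<open>Tropicalization\<close>

definition dot :: "nat \<Rightarrow> (nat \<Rightarrow> int) \<Rightarrow> (nat \<Rightarrow> nat) \<Rightarrow> int" where
  "dot n v \<mu> = (\<Sum>i<n. v i * int (\<mu> i))"

definition tval :: "nat \<Rightarrow> pospol \<Rightarrow> (nat \<Rightarrow> int) \<Rightarrow> int" where
  "tval n L v = Min ((\<lambda>(a, \<mu>). dot n v \<mu>) ` set L)"

definition tquot :: "nat \<Rightarrow> nat \<Rightarrow> (nat \<Rightarrow> pospol) \<Rightarrow> (nat \<Rightarrow> pospol) \<Rightarrow> (nat \<Rightarrow> int) \<Rightarrow> (nat \<Rightarrow> int)" where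
  "tquot n m A B v = (\<lambda>j. if j < m then tval n (A j) v - tval n (B j) v else 0)"

lemma tquot_lattice: "tquot n m A B v \<in> lattice m"
  by (simp add: tquot_def lattice_def)

subsection \<open>Exponential rates of decay\<close>

text \<open>\<open>g y\<close> behaves like \<open>exp (- l * y)\<close>, so
  \<open>exp (- y)\<close> plays the part of the loop parameter and \<open>l\<close> that of the
  degree: rates add under products, and the minimum is taken under sums.\<close>

definition decay :: "(real \<Rightarrow> real) \<Rightarrow> real \<Rightarrow> bool" where
  "decay g l \<longleftrightarrow> (\<forall>y. g y > 0) \<and> ((\<lambda>y. - ln (g y) / y) \<longlongrightarrow> l) at_top"

lemma decay_mult: "decay g l \<Longrightarrow> decay h l' \<Longrightarrow> decay (\<lambda>y. g y * h y) (l + l')"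
proof -
  assume gh: "decay g l" "decay h l'"
  then have "(\<lambda>y. - ln (g y * h y) / y) = (\<lambda>y. - ln (g y) / y + - ln (h y) / y)"
    by (simp add: decay_def ln_mult_pos add_divide_distrib diff_divide_distrib fun_eq_iff)
  moreover have "((\<lambda>y. - ln (g y) / y + - ln (h y) / y) \<longlongrightarrow> l + l') at_top"
    using gh by (intro tendsto_add) (simp_all add: decay_def)
  ultimately show ?thesis using gh by (simp add: decay_def)
qed

lemma decay_inverse: "decay g l \<Longrightarrow> decay (\<lambda>y. inverse (g y)) (- l)"
proof -
  assume g: "decay g l"
  then have "(\<lambda>y. - ln (inverse (g y)) / y) = (\<lambda>y. - (- ln (g y) / y))"
    by (simp add: decay_def ln_inverse fun_eq_iff)
  moreover have "((\<lambda>y. - (- ln (g y) / y)) \<longlongrightarrow> - l) at_top"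
    using g by (intro tendsto_minus) (simp add: decay_def)
  ultimately show ?thesis using g by (simp add: decay_def)
qed

lemma decay_divide: "decay g l \<Longrightarrow> decay h l' \<Longrightarrow> decay (\<lambda>y. g y / h y) (l - l')"
  unfolding divide_inverse diff_conv_add_uminus by (intro decay_mult decay_inverse)

lemma tendsto_const_div_at_top: "((\<lambda>y. c / y) \<longlongrightarrow> 0) (at_top :: real filter)"
  by (intro tendsto_divide_0[OF tendsto_const] filterlim_at_top_imp_at_infinity filterlim_ident)

lemma decay_const: "c > 0 \<Longrightarrow> decay (\<lambda>y. c) 0"
  unfolding decay_def using tendsto_const_div_at_top[of "- ln c"] by simp

lemma decay_power: "decay g l \<Longrightarrow> decay (\<lambda>y. g y ^ k) (real k * l)"
proof (induction k)
  case 0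
  then show ?case using decay_const[of 1] by simp
next
  case (Suc k)
  then have "decay (\<lambda>y. g y * g y ^ k) (l + real k * l)" by (intro decay_mult) auto
  then show ?case by (simp add: algebra_simps)
qed

lemma decay_prod:
  assumes "finite A" "\<And>a. a \<in> A \<Longrightarrow> decay (g a) (l a)"
  shows "decay (\<lambda>y. \<Prod>a\<in>A. g a y) (\<Sum>a\<in>A. l a)"
  using assms
proof (induction A rule: finite_induct)
  case empty
  then show ?case using decay_const[of 1] by simp
next
  case (insert a A)
  then show ?case using decay_mult[of "g a" "l a"] by simp
qed

lemma decay_powi: "decay g l \<Longrightarrow> decay (\<lambda>y. g y powi k) (of_int k * l)"
  using decay_power[of g l "nat k"] decay_power[OF decay_inverse, of g l "nat (- k)"]
  by (cases "k \<ge> 0") (simp_all add: power_int_def)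

text \<open>The sum of two positive numbers lies between their maximum and twice the maximum.\<close>

lemma decay_add:
  assumes "decay g l" "decay h l'"
  shows "decay (\<lambda>y. g y + h y) (min l l')"
proof -
  have pos: "g y > 0" "h y > 0" for y using assms by (simp_all add: decay_def)
  let ?m = "\<lambda>y. min (- ln (g y) / y) (- ln (h y) / y)"
  have lim: "(?m \<longlongrightarrow> min l l') at_top"
    using assms by (intro tendsto_min) (simp_all add: decay_def)
  have lim': "((\<lambda>y. ?m y - ln 2 / y) \<longlongrightarrow> min l l') at_top"
    using tendsto_diff[OF lim tendsto_const_div_at_top[of "ln 2"]] by simp
  have upper: "- ln (g y + h y) / y \<le> ?m y" if "y > 0" for y
  proof -
    have "ln (g y) \<le> ln (g y + h y)" "ln (h y) \<le> ln (g y + h y)"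
      using pos[of y] by simp_all
    then show ?thesis using that by (simp add: divide_right_mono)
  qed
  have lower: "?m y - ln 2 / y \<le> - ln (g y + h y) / y" if "y > 0" for y
  proof (cases "g y \<le> h y")
    case True
    then have "ln (g y + h y) \<le> ln (2 * h y)" using pos[of y] by simp
    also have "\<dots> = ln 2 + ln (h y)" using pos[of y] by (simp add: ln_mult_pos)
    finally have "- ln (h y) / y - ln 2 / y \<le> - ln (g y + h y) / y"
      unfolding diff_divide_distrib[symmetric] using that by (intro divide_right_mono) simp_all
    then show ?thesis by linarith
  next
    case False
    then have "ln (g y + h y) \<le> ln (2 * g y)" using pos[of y] by simp
    also have "\<dots> = ln 2 + ln (g y)" using pos[of y] by (simp add: ln_mult_pos)
    finally have "- ln (g y) / y - ln 2 / y \<le> - ln (g y + h y) / y"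
      unfolding diff_divide_distrib[symmetric] using that by (intro divide_right_mono) simp_all
    then show ?thesis by linarith
  qed
  have "((\<lambda>y. - ln (g y + h y) / y) \<longlongrightarrow> min l l') at_top"
  proof (rule tendsto_sandwich[OF _ _ lim' lim])
    show "eventually (\<lambda>y. ?m y - ln 2 / y \<le> - ln (g y + h y) / y) at_top"
      using eventually_gt_at_top[of 0] by eventually_elim (rule lower)
    show "eventually (\<lambda>y. - ln (g y + h y) / y \<le> ?m y) at_top"
      using eventually_gt_at_top[of 0] by eventually_elim (rule upper)
  qed
  then show ?thesis using pos by (simp add: decay_def add_pos_pos)
qed

text \<open>A curve of positive real points on a torus that leaves with velocity \<open>- v\<close> on the logarithmic
  scale; positive maps then act on such curves through their tropicalizations.\<close>

definition tends_to_cochar :: "nat \<Rightarrow> (real \<Rightarrow> nat \<Rightarrow> complex) \<Rightarrow> (nat \<Rightarrow> int) \<Rightarrow> bool" where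
  "tends_to_cochar n x v \<longleftrightarrow> v \<in> lattice n \<and> (\<forall>y. x y \<in> pos_points n) \<and>
     (\<forall>i<n. decay (\<lambda>y. cmod (x y i)) (of_int (v i)))"

lemma tends_to_cochar_exists:
  assumes "v \<in> lattice n"
  shows "\<exists>x. tends_to_cochar n x v"
proof
  let ?x = "\<lambda>y i. if i < n then complex_of_real (exp (- (of_int (v i) * y))) else 0"
  have pos: "?x y \<in> pos_points n" for y
    unfolding pos_points_def by (auto intro!: exI[of _ "exp (- (of_int (v _) * y))"])
  have "decay (\<lambda>y. cmod (?x y i)) (of_int (v i))" if "i < n" for i
  proof -
    have "eventually (\<lambda>y. of_int (v i) = - ln (cmod (?x y i)) / y) (at_top :: real filter)"
      using eventually_gt_at_top[of 0] by eventually_elim (use that in simp)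
    then show ?thesis
      unfolding decay_def using that by (auto intro: Lim_transform_eventually)
  qed
  then show "tends_to_cochar n ?x v"
    using assms pos by (simp add: tends_to_cochar_def)
qed

text \<open>Uniqueness of limits lets an identity between curves of points be read as an identity
  between cocharacters.\<close>

lemma tends_to_cochar_unique:
  assumes "tends_to_cochar n x v" "tends_to_cochar n x v'"
  shows "v = v'"
proof
  fix i
  show "v i = v' i"
  proof (cases "i < n")
    case True
    then have "(of_int (v i) :: real) = of_int (v' i)"
      using assms unfolding tends_to_cochar_def decay_def
      by (intro tendsto_unique[of "at_top :: real filter" "\<lambda>y. - ln (cmod (x y i)) / y"]) auto
    then show ?thesis by simp
  next
    case False
    then show ?thesis using assms by (simp add: tends_to_cochar_def lattice_def)
  qed
qed

lemma decay_pval: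
  assumes "pos_terms L" "tends_to_cochar n x v"
  shows "decay (\<lambda>y. cmod (pval n L (x y))) (of_int (tval n L v))"
  using assms(1)
proof (induction rule: pos_terms_induct)
  have mono: "decay (\<lambda>y. cmod (of_nat a * (\<Prod>i<n. x y i ^ \<mu> i))) (of_int (dot n v \<mu>))"
    if "a > 0" for a :: nat and \<mu>
  proof -
    have "decay (\<lambda>y. \<Prod>i<n. cmod (x y i) ^ \<mu> i) (\<Sum>i<n. real (\<mu> i) * of_int (v i))"
      using assms(2) by (intro decay_prod decay_power) (auto simp: tends_to_cochar_def)
    with decay_const[of "real a"] that
    have "decay (\<lambda>y. real a * (\<Prod>i<n. cmod (x y i) ^ \<mu> i)) (0 + (\<Sum>i<n. real (\<mu> i) * of_int (v i)))"
      by (intro decay_mult) auto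
    then show ?thesis by (simp add: norm_mult prod_norm[symmetric] norm_power dot_def mult.commute)
  qed
  {
    case (single a \<mu>)
    then show ?case using mono by (simp add: pval_Cons pval_Nil tval_def)
  next
    case (cons a \<mu> L)
    \<comment> \<open>All values are positive reals, so the modulus of the sum is the sum of the
      moduli.\<close>
    have "cmod (of_nat a * (\<Prod>i<n. x y i ^ \<mu> i) + pval n L (x y)) =
        cmod (of_nat a * (\<Prod>i<n. x y i ^ \<mu> i)) + cmod (pval n L (x y))" for y
    proof -
      have xy: "x y \<in> pos_points n" using assms(2) by (simp add: tends_to_cochar_def)
      obtain c where c: "c > 0" "(\<Prod>i<n. x y i ^ \<mu> i) = complex_of_real c"
        using pos_monomial[OF xy] by blast
      obtain d where d: "d > 0" "pval n L (x y) = complex_of_real d"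
        using pval_pos[OF cons(2) xy] by blast
      have "of_nat a * complex_of_real c + complex_of_real d = complex_of_real (real a * c + d)" by simp
      then have "cmod (of_nat a * complex_of_real c + complex_of_real d) = \<bar>real a * c + d\<bar>"
        by (metis norm_of_real)
      then show ?thesis using c d by (simp add: norm_mult)
    qed
    moreover have "tval n ((a, \<mu>) # L) v = min (dot n v \<mu>) (tval n L v)"
      using cons(2) by (simp add: tval_def pos_terms_def)
    ultimately show ?case
      using decay_add[OF mono[OF cons(1), of \<mu>] cons(3)] by (simp add: pval_Cons of_int_min)
  }
qed

lemma tends_to_cochar_quot_map:
  assumes "pos_rep n m f A B" "tends_to_cochar n x v"
  shows "tends_to_cochar m (\<lambda>y. quot_map n m A B (x y)) (tquot n m A B v)"
  unfolding tends_to_cochar_def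
proof (intro conjI allI impI tquot_lattice)
  show "quot_map n m A B (x y) \<in> pos_points m" for y
    using assms(2) by (intro quot_map_pos[OF assms(1)]) (simp add: tends_to_cochar_def)
  fix j assume j: "j < m"
  then have "pos_terms (A j)" "pos_terms (B j)" using assms(1) by (simp_all add: pos_rep_def)
  then have "decay (\<lambda>y. cmod (pval n (A j) (x y)) / cmod (pval n (B j) (x y)))
      (of_int (tval n (A j) v) - of_int (tval n (B j) v))"
    by (intro decay_divide decay_pval[OF _ assms(2)])
  then show "decay (\<lambda>y. cmod (quot_map n m A B (x y) j)) (of_int (tquot n m A B v j))"
    using j by (simp add: quot_map_def tquot_def norm_divide)
qed

subsection \<open>Formal loops\<close>

notation fls_nth (infixl \<open>$$\<close> 75)

text \<open>An invertible Taylor series is a Laurent series of subdegree 0, and subdegrees add up in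
  a character, so the coordinates decide.\<close>

lemma loops0_iff: "\<psi> \<in> loops0 n \<longleftrightarrow> \<psi> \<in> torus n \<and> (\<forall>i<n. fls_subdegree (\<psi> i) = 0)"
proof
  assume \<psi>: "\<psi> \<in> loops0 n"
  then have "\<psi> \<in> torus n" by (simp add: loops0_def loops_def)
  moreover have "fls_subdegree (\<psi> i) = 0" if i: "i < n" for i
  proof -
    have "(\<lambda>k. if k = i then 1 else 0) \<in> lattice n" using i by (simp add: lattice_def)
    with \<psi> have "\<exists>g :: complex fps. g dvd 1 \<and> chr n (\<lambda>k. if k = i then 1 else 0) \<psi> = fps_to_fls g"
      unfolding loops0_def by blast
    then obtain g :: "complex fps" where "g dvd 1" "\<psi> i = fps_to_fls g"
      unfolding chr_unit[OF i] by blast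
    then show ?thesis by (simp add: fls_subdegree_fls_to_fps)
  qed
  ultimately show "\<psi> \<in> torus n \<and> (\<forall>i<n. fls_subdegree (\<psi> i) = 0)" by blast
next
  assume \<psi>: "\<psi> \<in> torus n \<and> (\<forall>i<n. fls_subdegree (\<psi> i) = 0)"
  have "\<exists>g :: complex fps. g dvd 1 \<and> chr n \<mu> \<psi> = fps_to_fls g" for \<mu>
  proof -
    have ne: "\<psi> i powi \<mu> i \<noteq> 0" if "i < n" for i using \<psi> that by (simp add: torus_def)
    then have nz: "chr n \<mu> \<psi> \<noteq> 0" by (simp add: chr_def)
    have "fls_subdegree (chr n \<mu> \<psi>) = (\<Sum>i<n. fls_subdegree (\<psi> i powi \<mu> i))"
      unfolding chr_def by (rule fls_subdegree_prod) (use ne in simp)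
    then have s: "fls_subdegree (chr n \<mu> \<psi>) = 0" using \<psi> by simp
    then have "fps_nth (fls_regpart (chr n \<mu> \<psi>)) 0 \<noteq> 0"
      using nth_fls_subdegree_nonzero[OF nz] by simp
    then show ?thesis using s by (intro exI[of _ "fls_regpart (chr n \<mu> \<psi>)"]) simp
  qed
  then show "\<psi> \<in> loops0 n" using \<psi> by (simp add: loops0_def loops_def)
qed

lemma tmult_X_torus:
  assumes "\<psi> \<in> torus n"
  shows "tmult (cochr n v fls_X) \<psi> \<in> loops n"
  using assms by (simp add: loops_def torus_def tmult_def cochr_def del: fls_X_power_int)

lemma subdegree_tmult_X:
  assumes "\<psi> \<in> loops0 n" "i < n"
  shows "fls_subdegree (tmult (cochr n v fls_X) \<psi> i) = v i"
proof -
  have "\<psi> i \<noteq> 0" "fls_subdegree (\<psi> i) = 0" using assms by (simp_all add: loops0_iff torus_def)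
  then show ?thesis using assms(2)
    by (simp add: tmult_def cochr_def del: fls_X_power_int)
qed

lemma loop_deg_tmult_X:
  assumes "\<psi> \<in> loops0 n" "v \<in> lattice n"
  shows "loop_deg n (tmult (cochr n v fls_X) \<psi>) = v"
  unfolding loop_deg_def
proof (rule the_equality)
  show "v \<in> lattice n \<and> (\<exists>\<psi>'\<in>loops0 n. tmult (cochr n v fls_X) \<psi> = tmult (cochr n v fls_X) \<psi>')"
    using assms by blast
next
  fix u assume u: "u \<in> lattice n \<and> (\<exists>\<psi>'\<in>loops0 n. tmult (cochr n v fls_X) \<psi> = tmult (cochr n u fls_X) \<psi>')"
  then obtain \<psi>' where \<psi>': "\<psi>' \<in> loops0 n" "tmult (cochr n v fls_X) \<psi> = tmult (cochr n u fls_X) \<psi>'"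
    by blast
  show "u = v"
  proof
    fix i show "u i = v i"
    proof (cases "i < n")
      case True
      then show ?thesis
        using subdegree_tmult_X[OF assms(1) True, of v] subdegree_tmult_X[OF \<psi>'(1) True, of u] \<psi>'(2)
        by simp
    next
      case False
      then show ?thesis using u assms(2) by (simp add: lattice_def)
    qed
  qed
qed

lemma loopsE:
  assumes "\<phi> \<in> loops n"
  obtains \<psi> where "\<psi> \<in> loops0 n" "\<phi> = tmult (cochr n (\<lambda>i. if i < n then fls_subdegree (\<phi> i) else 0) fls_X) \<psi>"
proof
  let ?v = "\<lambda>i. if i < n then fls_subdegree (\<phi> i) else 0"
  let ?\<psi> = "\<lambda>i. if i < n then fls_X powi (- fls_subdegree (\<phi> i)) * \<phi> i else 0"
  have ne: "\<phi> i \<noteq> 0" if "i < n" for i using assms that by (simp add: loops_def torus_def)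
  show "?\<psi> \<in> loops0 n"
    unfolding loops0_iff using ne by (simp add: torus_def del: fls_X_power_int)
  show "\<phi> = tmult (cochr n ?v fls_X) ?\<psi>"
  proof
    fix i show "\<phi> i = tmult (cochr n ?v fls_X) ?\<psi> i"
    proof (cases "i < n")
      case True
      have "fls_X powi fls_subdegree (\<phi> i) * fls_X powi (- fls_subdegree (\<phi> i)) = (1 :: complex fls)"
        by (subst power_int_add[symmetric]) (simp_all del: fls_X_power_int)
      then show ?thesis using True
        by (simp add: tmult_def cochr_def mult.assoc[symmetric] del: fls_X_power_int)
    next
      case False
      then show ?thesis using assms by (simp add: tmult_def cochr_def loops_def torus_def)
    qed
  qed
qed

lemma loop_deg_eq:
  assumes "\<phi> \<in> loops n"
  shows "loop_deg n \<phi> = (\<lambda>i. if i < n then fls_subdegree (\<phi> i) else 0)"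
proof -
  obtain \<psi> where \<psi>: "\<psi> \<in> loops0 n" "\<phi> = tmult (cochr n (\<lambda>i. if i < n then fls_subdegree (\<phi> i) else 0) fls_X) \<psi>"
    using loopsE[OF assms] .
  have "(\<lambda>i. if i < n then fls_subdegree (\<phi> i) else 0) \<in> lattice n" by (simp add: lattice_def)
  from loop_deg_tmult_X[OF \<psi>(1) this] show ?thesis using \<psi>(2) by simp
qed

text \<open>For the least weight \<open>k\<close> this is the lowest-order part of \<open>L\<close>:
  evaluated at the constant terms of \<open>\<psi>\<close> it gives the coefficient of order
  \<open>k\<close> along the loop of degree \<open>v\<close> with unit part
  \<open>\<psi>\<close>.\<close>

definition initial_form :: "nat \<Rightarrow> (nat \<Rightarrow> int) \<Rightarrow> int \<Rightarrow> pospol \<Rightarrow> pospol" where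
  "initial_form n v k L = filter (\<lambda>(a, \<mu>). dot n v \<mu> = k) L"

lemma fls_prod_subdegree_0:
  fixes f :: "'a \<Rightarrow> complex fls"
  assumes "finite A" "\<And>a. a \<in> A \<Longrightarrow> f a \<noteq> 0 \<and> fls_subdegree (f a) = 0"
  shows "(\<Prod>a\<in>A. f a) \<noteq> 0 \<and> fls_subdegree (\<Prod>a\<in>A. f a) = 0 \<and> (\<Prod>a\<in>A. f a) $$ 0 = (\<Prod>a\<in>A. f a $$ 0)"
  using assms
proof (induction A rule: finite_induct)
  case (insert a A)
  then have IH: "(\<Prod>a\<in>A. f a) \<noteq> 0" "fls_subdegree (\<Prod>a\<in>A. f a) = 0"
      "(\<Prod>a\<in>A. f a) $$ 0 = (\<Prod>a\<in>A. f a $$ 0)" and a: "f a \<noteq> 0" "fls_subdegree (f a) = 0"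
    by auto
  have "(f a * (\<Prod>a\<in>A. f a)) $$ 0 = f a $$ 0 * (\<Prod>a\<in>A. f a) $$ 0"
    using fls_times_base[of "f a" "\<Prod>a\<in>A. f a"] IH a by simp
  then show ?case using insert.hyps IH a by simp
qed simp

text \<open>Along the loop the monomial is the power \<open>dot n v \<mu>\<close> of the loop
  variable times a series of subdegree 0.\<close>

lemma monomial_loop_nth:
  assumes "\<psi> \<in> loops0 n" "k \<le> dot n v \<mu>"
  shows "(\<Prod>i<n. tmult (cochr n v fls_X) \<psi> i ^ \<mu> i) $$ k =
    (if dot n v \<mu> = k then \<Prod>i<n. (\<psi> i $$ 0) ^ \<mu> i else 0)"
proof -
  have ne: "\<psi> i \<noteq> 0" "fls_subdegree (\<psi> i) = 0" if "i < n" for i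
    using assms that by (simp_all add: loops0_iff torus_def)
  have pow: "(\<psi> i ^ \<mu> i) $$ 0 = (\<psi> i $$ 0) ^ \<mu> i" if "i < n" for i
    using fls_prod_subdegree_0[of "{..<\<mu> i}" "\<lambda>_. \<psi> i"] ne[OF that] by simp
  let ?g = "\<Prod>i<n. \<psi> i ^ \<mu> i"
  have "?g \<noteq> 0 \<and> fls_subdegree ?g = 0 \<and> ?g $$ 0 = (\<Prod>i<n. (\<psi> i ^ \<mu> i) $$ 0)"
    by (rule fls_prod_subdegree_0) (use ne in \<open>auto simp: fls_subdegree_pow\<close>)
  then have g: "fls_subdegree ?g = 0" "?g $$ 0 = (\<Prod>i<n. (\<psi> i $$ 0) ^ \<mu> i)"
    using pow by simp_all
  have "(\<Prod>i<n. tmult (cochr n v fls_X) \<psi> i ^ \<mu> i) = (\<Prod>i<n. fls_X powi (v i * int (\<mu> i)) * \<psi> i ^ \<mu> i)"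
    by (rule prod.cong)
       (simp_all add: tmult_def cochr_def power_mult_distrib power_int_mult del: fls_X_power_int)
  also have "\<dots> = fls_X powi (dot n v \<mu>) * ?g"
  proof -
    have "fls_X powi (\<Sum>i\<in>S. v i * int (\<mu> i)) = (\<Prod>i\<in>S. fls_X powi (v i * int (\<mu> i)) :: complex fls)"
      if "finite S" for S
      using that by (induction S rule: finite_induct) (simp_all add: power_int_add del: fls_X_power_int)
    then show ?thesis by (simp add: prod.distrib dot_def del: fls_X_power_int)
  qed
  also have "\<dots> $$ k = ?g $$ (k - dot n v \<mu>)"
    by (simp add: fls_X_intpow_times_conv_shift)
  finally show ?thesis using assms(2) g by simp
qed

lemma pval_loop_nth:
  assumes "\<psi> \<in> loops0 n" "\<forall>(a, \<mu>)\<in>set L. k \<le> dot n v \<mu>"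
  shows "pval n L (tmult (cochr n v fls_X) \<psi>) $$ k = pval n (initial_form n v k L) (\<lambda>i. \<psi> i $$ 0)"
  using assms(2)
proof (induction L)
  case (Cons c L)
  obtain a \<mu> where c [simp]: "c = (a, \<mu>)" by (cases c)
  have k: "k \<le> dot n v \<mu>" and "\<forall>(a, \<mu>)\<in>set L. k \<le> dot n v \<mu>" using Cons.prems by auto
  note IH = Cons.IH[OF this(2)]
  have "(of_nat a * (\<Prod>i<n. tmult (cochr n v fls_X) \<psi> i ^ \<mu> i)) $$ k =
      of_nat a * (\<Prod>i<n. tmult (cochr n v fls_X) \<psi> i ^ \<mu> i) $$ k"
    by (simp add: fls_of_nat)
  then show ?case
    using IH monomial_loop_nth[OF assms(1) k] by (simp add: pval_Cons initial_form_def)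
qed (simp add: pval_Nil initial_form_def)

lemma initial_form_pos_terms:
  assumes "pos_terms L"
  shows "pos_terms (initial_form n v (tval n L v) L)"
proof -
  have "tval n L v \<in> (\<lambda>(a, \<mu>). dot n v \<mu>) ` set L"
    unfolding tval_def using assms by (intro Min_in) (auto simp: pos_terms_def)
  then obtain a \<mu> where "(a, \<mu>) \<in> set L" "tval n L v = dot n v \<mu>" by auto
  then have "(a, \<mu>) \<in> set (initial_form n v (tval n L v) L)" by (simp add: initial_form_def)
  then have "initial_form n v (tval n L v) L \<noteq> []" by (metis empty_iff list.set(1))
  then show ?thesis using assms by (auto simp: pos_terms_def initial_form_def)
qed

text \<open>The hypothesis excludes cancellation in the lowest order, which is the only way the
  order along the loop could exceed \<open>tval\<close>.\<close>

lemma pval_loop_subdegree: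
  assumes "\<psi> \<in> loops0 n" "pval n (initial_form n v (tval n L v) L) (\<lambda>i. \<psi> i $$ 0) \<noteq> 0"
  shows "pval n L (tmult (cochr n v fls_X) \<psi>) \<noteq> 0"
    and "fls_subdegree (pval n L (tmult (cochr n v fls_X) \<psi>)) = tval n L v"
proof -
  have le: "tval n L v \<le> dot n v \<mu>" if "(a, \<mu>) \<in> set L" for a \<mu>
    unfolding tval_def using that by (intro Min_le) force+
  let ?p = "pval n L (tmult (cochr n v fls_X) \<psi>)"
  have "\<forall>(a, \<mu>)\<in>set L. tval n L v \<le> dot n v \<mu>" using le by fast
  from pval_loop_nth[OF assms(1) this] have nz: "?p $$ tval n L v \<noteq> 0" using assms(2) by simp
  then show "?p \<noteq> 0" by auto
  have "?p $$ k = 0" if "k < tval n L v" for k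
  proof -
    have "initial_form n v k L = []"
      unfolding initial_form_def filter_empty_conv using le that by fastforce
    moreover have "\<forall>(a, \<mu>)\<in>set L. k \<le> dot n v \<mu>" using le that by fastforce
    ultimately show ?thesis using pval_loop_nth[OF assms(1), of L k v] by (simp add: pval_Nil)
  qed
  then show "fls_subdegree ?p = tval n L v" using nz by (rule fls_subdegree_eqI[rotated])
qed

lemma represents_pos_rep:
  assumes "pos_rep n m f A B" "j < m"
  shows "represents n f j (pos_poly n (A j)) (pos_poly n (B j))"
  unfolding represents_def qeval_pos_poly
proof (rule rat_eq_if_generic)
  have "eventually (\<lambda>x. f x = Some (quot_map n m A B x) \<and> (\<forall>j<m. pval n (B j) x \<noteq> 0)) (generic n)"
    using assms(1) by (simp add: pos_rep_def)
  then show "eventually (\<lambda>x. x \<in> dom (\<lambda>x. map_option (\<lambda>y. y j) (f x)) \<and> map_option (\<lambda>y. y j) (f x) =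
      (if pval n (B j) x \<noteq> 0 then Some (pval n (A j) x / pval n (B j) x) else None)) (generic n)"
    by eventually_elim (use assms(2) in \<open>simp add: dom_def quot_map_def\<close>)
qed

lemma generic_zero_loop:
  assumes "eventually (\<lambda>x. qeval d x = (0::complex)) (generic n)" "\<phi> \<in> loops n"
  shows "qeval d \<phi> = 0"
proof (rule qeval_eq_0_transfer[where 'l = complex and S = "{..<n}"])
  fix k assume k: "k \<in> pos_nat_points {..<n}"
  show "qeval d (\<lambda>v. of_nat (k v)) = (0::complex)"
  proof (rule ccontr)
    assume ne: "qeval d (\<lambda>v. of_nat (k v)) \<noteq> (0::complex)"
    have "(\<lambda>v. of_nat (k v) :: complex) \<in> torus n"
      by (rule pos_points_torus[OF pos_nat_points_pos_points[OF k]])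
    then have "eventually (\<lambda>x. qeval d x \<noteq> (0::complex)) (generic n)"
      unfolding eventually_generic using ne by blast
    from generic_pos_point[OF eventually_conj[OF this assms(1)]] show False by blast
  qed
next
  show "\<phi> v = 0" if "v \<notin> {..<n}" for v
    using assms(2) that by (simp add: loops_def torus_def)
qed

text \<open>\<open>loop_comp\<close> accepts any fraction that represents a component. For two of
  them the cross difference vanishes at generic complex points, hence on loops, so the composite is
  well defined.\<close>

lemma represents_unique:
  assumes "represents n f j p q" "represents n f j p' q'" "\<phi> \<in> loops n" "qeval q \<phi> \<noteq> 0" "qeval q' \<phi> \<noteq> 0"
  shows "qeval p \<phi> / qeval q \<phi> = qeval p' \<phi> / qeval q' \<phi>"
proof -
  have "eventually (\<lambda>x. qeval (p * q' - p' * q) x = (0::complex)) (generic n)"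
    using generic_rat_eq[OF assms(1)[unfolded represents_def]]
      generic_rat_eq[OF assms(2)[unfolded represents_def]]
  proof eventually_elim
    case (elim x)
    then obtain y where "map_option (\<lambda>y. y j) (f x) = Some y" by blast
    then have "qeval q x \<noteq> 0" "qeval q' x \<noteq> 0" "qeval p x / qeval q x = qeval p' x / qeval q' x"
      using elim by (auto split: if_splits)
    then show ?case by (simp add: qh.peval_simps field_simps)
  qed
  from generic_zero_loop[OF this assms(3)] show ?thesis
    using assms(4,5) by (simp add: qh.peval_simps field_simps)
qed

lemma loop_comp_unique:
  assumes "loop_comp n m f \<phi> \<psi>" "loop_comp n m f \<phi> \<psi>'" "\<phi> \<in> loops n"
  shows "\<psi> = \<psi>'"
proof
  fix j show "\<psi> j = \<psi>' j"
  proof (cases "j < m")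
    case True
    obtain p q where pq: "represents n f j p q" "qeval q \<phi> \<noteq> 0" "\<psi> j = qeval p \<phi> / qeval q \<phi>"
      using assms(1) True unfolding loop_comp_def by blast
    obtain p' q' where pq': "represents n f j p' q'" "qeval q' \<phi> \<noteq> 0" "\<psi>' j = qeval p' \<phi> / qeval q' \<phi>"
      using assms(2) True unfolding loop_comp_def by blast
    show ?thesis unfolding pq(3) pq'(3) by (rule represents_unique[OF pq(1) pq'(1) assms(3) pq(2) pq'(2)])
  next
    case False
    then show ?thesis using assms(1,2) by (simp add: loop_comp_def loops_def torus_def)
  qed
qed

lemma loop_comp_pos_rep:
  assumes "pos_rep n m f A B" "\<psi> \<in> loops0 n"
    and init: "\<And>j. j < m \<Longrightarrow> pval n (initial_form n v (tval n (A j) v) (A j)) (\<lambda>i. \<psi> i $$ 0) \<noteq> 0"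
      "\<And>j. j < m \<Longrightarrow> pval n (initial_form n v (tval n (B j) v) (B j)) (\<lambda>i. \<psi> i $$ 0) \<noteq> 0"
  shows "\<exists>\<xi>. loop_comp n m f (tmult (cochr n v fls_X) \<psi>) \<xi> \<and> loop_deg m \<xi> = tquot n m A B v"
proof -
  let ?\<phi> = "tmult (cochr n v fls_X) \<psi>"
  let ?\<xi> = "\<lambda>j. if j < m then pval n (A j) ?\<phi> / pval n (B j) ?\<phi> else 0"
  have A: "pval n (A j) ?\<phi> \<noteq> 0" "fls_subdegree (pval n (A j) ?\<phi>) = tval n (A j) v" if "j < m" for j
    using pval_loop_subdegree[OF assms(2) init(1)[OF that]] by blast+
  have B: "pval n (B j) ?\<phi> \<noteq> 0" "fls_subdegree (pval n (B j) ?\<phi>) = tval n (B j) v" if "j < m" for j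
    using pval_loop_subdegree[OF assms(2) init(2)[OF that]] by blast+
  have \<xi>: "?\<xi> \<in> loops m" using A B by (simp add: loops_def torus_def)
  moreover have "\<exists>p q. represents n f j p q \<and> qeval q ?\<phi> \<noteq> 0 \<and> ?\<xi> j = qeval p ?\<phi> / qeval q ?\<phi>"
    if "j < m" for j
    using represents_pos_rep[OF assms(1) that] B(1)[OF that] that
    by (intro exI[of _ "pos_poly n (A j)"] exI[of _ "pos_poly n (B j)"]) (simp add: qeval_pos_poly)
  ultimately have "loop_comp n m f ?\<phi> ?\<xi>" unfolding loop_comp_def by blast
  moreover have "loop_deg m ?\<xi> = tquot n m A B v"
    unfolding loop_deg_eq[OF \<xi>] tquot_def using A B by (auto simp: fun_eq_iff fls_divide_subdegree)
  ultimately show ?thesis by blast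
qed

text \<open>Loops whose coefficients are positive integers are dense, and they all have the degree that is
  read off from the exponents, because no cancellation occurs in the initial forms.\<close>

lemma dense_in_fibre_tquot:
  assumes "pos_rep n m f A B" "v \<in> lattice n"
  shows "dense_in_fibre n v {\<phi> \<in> loops n. loop_deg n \<phi> = v \<and>
    (\<exists>\<xi>. loop_comp n m f \<phi> \<xi> \<and> loop_deg m \<xi> = tquot n m A B v)}" (is "dense_in_fibre n v ?S")
  unfolding dense_in_fibre_def
proof (intro allI impI ballI)
  fix p :: "(nat \<times> nat, rat) pol" and \<psi>
  assume zero: "\<forall>\<psi>\<in>loops0 n. tmult (cochr n v fls_X) \<psi> \<in> ?S \<longrightarrow>
      qeval p (\<lambda>(j, k). fls_nth (\<psi> j) (int k)) = 0"
    and \<psi>: "\<psi> \<in> loops0 n"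
  show "qeval p (\<lambda>(j, k). fls_nth (\<psi> j) (int k)) = 0"
  proof (rule peval_eq_0_if_pos_nat[where S = "{..<n} \<times> UNIV"])
    show "(case w of (j, k) \<Rightarrow> fls_nth (\<psi> j) (int k)) = 0" if "w \<notin> {..<n} \<times> UNIV" for w
      using that \<psi> by (cases w) (auto simp: loops0_iff torus_def)
  next
    fix c :: "nat \<times> nat \<Rightarrow> nat" assume c: "c \<in> pos_nat_points ({..<n} \<times> UNIV)"
    define \<xi> where "\<xi> = (\<lambda>j. if j < n then fps_to_fls (Abs_fps (\<lambda>k. of_nat (c (j, k)) :: complex)) else 0)"
    have c_pos: "c (j, k) > 0" if "j < n" for j k using c that by (simp add: pos_nat_points_def)
    have nth: "\<xi> j $$ int k = of_nat (c (j, k))" for j k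
      using c by (auto simp: \<xi>_def pos_nat_points_def)
    have "\<xi> j $$ 0 \<noteq> 0" if "j < n" for j using nth[of j 0] c_pos[OF that, of 0] by simp
    moreover have "\<xi> j $$ k = 0" if "k < 0" for j k using that by (simp add: \<xi>_def)
    ultimately have sub: "\<xi> j \<noteq> 0 \<and> fls_subdegree (\<xi> j) = 0" if "j < n" for j
      using that fls_subdegree_eqI[of "\<xi> j" 0] by force
    then have \<xi>: "\<xi> \<in> loops0 n" unfolding loops0_iff torus_def by (simp add: \<xi>_def)
    have "(\<lambda>i. \<xi> i $$ 0) \<in> pos_points n"
    proof -
      have "(\<lambda>i. \<xi> i $$ 0) = (\<lambda>i. of_nat (c (i, 0)))" using nth[of _ 0] by simp
      moreover have "(\<lambda>i. c (i, 0)) \<in> pos_nat_points {..<n}"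
        using c by (simp add: pos_nat_points_def)
      ultimately show ?thesis using pos_nat_points_pos_points by metis
    qed
    then have init: "pval n (initial_form n v (tval n L v) L) (\<lambda>i. \<xi> i $$ 0) \<noteq> 0" if "pos_terms L" for L
      using pval_nonzero[OF initial_form_pos_terms[OF that]] by blast
    have "\<exists>\<xi>'. loop_comp n m f (tmult (cochr n v fls_X) \<xi>) \<xi>' \<and> loop_deg m \<xi>' = tquot n m A B v"
      by (rule loop_comp_pos_rep[OF assms(1) \<xi>]) (use init assms(1) in \<open>simp_all add: pos_rep_def\<close>)
    moreover have "tmult (cochr n v fls_X) \<xi> \<in> loops n"
      using \<xi> by (intro tmult_X_torus) (simp add: loops0_iff)
    ultimately have "tmult (cochr n v fls_X) \<xi> \<in> ?S"
      using loop_deg_tmult_X[OF \<xi> assms(2)] by blast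
    with zero \<xi> have "qeval p (\<lambda>(j, k). fls_nth (\<xi> j) (int k)) = 0" by blast
    moreover have "(\<lambda>(j, k). fls_nth (\<xi> j) (int k)) = (\<lambda>w. of_nat (c w))"
      by (auto simp: fun_eq_iff nth)
    ultimately show "qeval p (\<lambda>w. of_nat (c w)) = (0::complex)" by simp
  qed
qed

text \<open>If another degree were also attained densely, the product of all initial forms, as a
  polynomial in the constant terms, would vanish on a dense set and hence everywhere; at the
  constant loop 1 positivity of the coefficients forbids this.\<close>

lemma trop_pos_rep:
  assumes "pos_rep n m f A B" "v \<in> lattice n"
  shows "trop n m f v = tquot n m A B v"
  unfolding trop_def
proof (rule the_equality)
  show "tquot n m A B v \<in> lattice m \<and> dense_in_fibre n v {\<phi> \<in> loops n. loop_deg n \<phi> = v \<and>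
      (\<exists>\<psi>. loop_comp n m f \<phi> \<psi> \<and> loop_deg m \<psi> = tquot n m A B v)}"
    using tquot_lattice dense_in_fibre_tquot[OF assms] by blast
next
  fix u
  assume u: "u \<in> lattice m \<and> dense_in_fibre n v {\<phi> \<in> loops n. loop_deg n \<phi> = v \<and>
      (\<exists>\<psi>. loop_comp n m f \<phi> \<psi> \<and> loop_deg m \<psi> = u)}" (is "_ \<and> dense_in_fibre n v ?S")
  show "u = tquot n m A B v"
  proof (rule ccontr)
    assume ne: "u \<noteq> tquot n m A B v"
    let ?i = "\<lambda>L. initial_form n v (tval n L v) L"
    \<comment> \<open>The variable \<open>(i, 0)\<close> stands for the constant term of the series
      with index \<open>i\<close>.\<close>
    have "\<exists>p'. \<forall>x. qeval (\<Prod>j<m. pos_poly n (?i (A j)) * pos_poly n (?i (B j)))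
        (\<lambda>i. qeval (pvar (i, 0)) x) = qeval p' (x :: nat \<times> nat \<Rightarrow> complex)"
      by (rule qh.peval_subst)
    then obtain p :: "(nat \<times> nat, rat) pol" where p: "\<And>x :: nat \<times> nat \<Rightarrow> complex. qeval p x =
        (\<Prod>j<m. pval n (?i (A j)) (\<lambda>i. x (i, 0)) * pval n (?i (B j)) (\<lambda>i. x (i, 0)))"
      by (auto simp: qh.peval_prod qh.peval_mult qeval_pos_poly qh.peval_pvar)
    have "qeval p (\<lambda>(j, k). fls_nth (\<psi> j) (int k)) = 0"
      if \<psi>: "\<psi> \<in> loops0 n" "tmult (cochr n v fls_X) \<psi> \<in> ?S" for \<psi>
    proof (rule ccontr)
      assume "qeval p (\<lambda>(j, k). fls_nth (\<psi> j) (int k)) \<noteq> 0"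
      then have "\<exists>\<xi>. loop_comp n m f (tmult (cochr n v fls_X) \<psi>) \<xi> \<and> loop_deg m \<xi> = tquot n m A B v"
        by (intro loop_comp_pos_rep[OF assms(1) \<psi>(1)]) (auto simp: p)
      then obtain \<xi> where \<xi>: "loop_comp n m f (tmult (cochr n v fls_X) \<psi>) \<xi>"
          "loop_deg m \<xi> = tquot n m A B v" by blast
      obtain \<xi>' where \<xi>': "loop_comp n m f (tmult (cochr n v fls_X) \<psi>) \<xi>'" "loop_deg m \<xi>' = u"
          "tmult (cochr n v fls_X) \<psi> \<in> loops n"
        using \<psi>(2) by blast
      show False using loop_comp_unique[OF \<xi>(1) \<xi>'(1,3)] \<xi>(2) \<xi>'(2) ne by simp
    qed
    then have zero: "qeval p (\<lambda>(j, k). fls_nth (\<psi> j) (int k)) = 0" if "\<psi> \<in> loops0 n" for \<psi>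
      using u that unfolding dense_in_fibre_def by blast
    let ?one = "\<lambda>i. if i < n then 1 else 0 :: complex fls"
    have "?one \<in> loops0 n" unfolding loops0_iff torus_def by simp
    from zero[OF this] obtain j where j: "j < m"
      "pval n (?i (A j)) (\<lambda>i. ?one i $$ 0) = 0 \<or> pval n (?i (B j)) (\<lambda>i. ?one i $$ 0) = 0"
      by (auto simp: p)
    have "(\<lambda>i. if i < n then 1 else 0) \<in> pos_nat_points {..<n}" by (simp add: pos_nat_points_def)
    moreover have "(\<lambda>i. ?one i $$ 0) = (\<lambda>i. of_nat (if i < n then 1 else 0))" by auto
    ultimately have "(\<lambda>i. ?one i $$ 0) \<in> pos_points n" using pos_nat_points_pos_points by metis
    then have "pval n (?i L) (\<lambda>i. ?one i $$ 0) \<noteq> 0" if "pos_terms L" for L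
      by (rule pval_nonzero[OF initial_form_pos_terms[OF that]])
    moreover have "pos_terms (A j)" "pos_terms (B j)"
      using assms(1) j(1) by (simp_all add: pos_rep_def)
    ultimately show False using j(2) by blast
  qed
qed

section \<open>Identities of positive maps\<close>

text \<open>Product tori are a single torus with concatenated coordinates, parameters in front:
  \<open>shift\<close> and \<open>first\<close> are the projections and \<open>cat\<close> the
  pairing.\<close>

definition shift :: "nat \<Rightarrow> (nat \<Rightarrow> 'a) \<Rightarrow> (nat \<Rightarrow> 'a)" where
  "shift k z = (\<lambda>j. z (j + k))"

definition first :: "nat \<Rightarrow> (nat \<Rightarrow> 'a::zero) \<Rightarrow> (nat \<Rightarrow> 'a)" where
  "first k z = (\<lambda>j. if j < k then z j else 0)"

definition cat :: "nat \<Rightarrow> (nat \<Rightarrow> 'a) \<Rightarrow> (nat \<Rightarrow> 'a) \<Rightarrow> (nat \<Rightarrow> 'a)" where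
  "cat k s t = (\<lambda>j. if j < k then s j else t (j - k))"

lemma shift_cat [simp]: "shift k (cat k s t) = t"
  by (simp add: shift_def cat_def)

lemma shift_case_nat [simp]: "shift (Suc k) (case_nat c t) = shift k t"
  by (simp add: shift_def)

lemma shift_0 [simp]: "shift 0 t = t"
  by (simp add: shift_def)

lemma case_nat_shift: "case_nat (z 0) (shift (Suc 0) z) = z"
  by (auto simp: fun_eq_iff shift_def split: nat.split)

lemma first_cat: "s \<in> torus k \<Longrightarrow> first k (cat k s t) = (s :: nat \<Rightarrow> 'a::field)"
  by (auto simp: first_def cat_def torus_def)

lemma cat_torus: "s \<in> torus k \<Longrightarrow> t \<in> torus n \<Longrightarrow> cat k s t \<in> torus (k + n)"
  by (auto simp: cat_def torus_def)

lemma cat_pos: "s \<in> pos_points k \<Longrightarrow> t \<in> pos_points n \<Longrightarrow> cat k s t \<in> pos_points (k + n)"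
  by (auto simp: cat_def pos_points_def)

lemma case_nat_torus: "c \<noteq> 0 \<Longrightarrow> t \<in> torus n \<Longrightarrow> case_nat c t \<in> torus (Suc n)"
  by (auto simp: torus_def split: nat.split)

lemma case_nat_pos:
  "a > 0 \<Longrightarrow> t \<in> pos_points n \<Longrightarrow> case_nat (complex_of_real a) t \<in> pos_points (Suc n)"
  by (auto simp: pos_points_def split: nat.split)

lemma shift_pos: "z \<in> pos_points (k + n) \<Longrightarrow> shift k z \<in> pos_points n"
  by (auto simp: pos_points_def shift_def)

lemma shift_pos_Suc: "z \<in> pos_points (Suc n) \<Longrightarrow> shift (Suc 0) z \<in> pos_points n"
  using shift_pos[of z 1 n] by simp

lemma pos_point_coord:
  assumes "z \<in> pos_points N" "i < N"
  obtains a where "a > 0" "z i = complex_of_real a"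
  using assms by (auto simp: pos_points_def)

lemma chr_cat: "chr k \<mu> (cat k s t) = chr k \<mu> s"
  unfolding chr_def cat_def by (rule prod.cong) auto

lemma chr_first: "chr k \<mu> (first k z) = chr k \<mu> z"
  unfolding chr_def first_def by (rule prod.cong) auto

lemma chr_pos:
  assumes "z \<in> pos_points N" "k \<le> N"
  obtains a where "a > 0" "chr k \<mu> z = complex_of_real a"
proof -
  obtain a where a: "\<And>i. i < N \<Longrightarrow> a i > 0 \<and> z i = complex_of_real (a i)"
    using assms unfolding pos_points_def mem_Collect_eq by metis
  have "chr k \<mu> z = complex_of_real (\<Prod>i<k. a i powi \<mu> i)"
    unfolding chr_def using a assms(2) by simp
  moreover have "(\<Prod>i<k. a i powi \<mu> i) > 0"
    using a assms(2) by (intro prod_pos) auto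
  ultimately show thesis using that by blast
qed

lemma lmor_in_torus: "lmor N (torus_var M) T x0 \<Longrightarrow> eventually (\<lambda>x. T x \<in> torus M) (near N x0)"
  by (simp add: lmor_def torus_var_def points_def)

lemma lmor_at_torus: "lmor N (torus_var M) T x0 \<Longrightarrow> T x0 \<in> torus M"
  by (simp add: lmor_def points_torus)

lemma lmor_case_nat:
  assumes "lrat N x0 c" "c x0 \<noteq> 0" "lmor N (torus_var n) T x0"
  shows "lmor N (torus_var (Suc n)) (\<lambda>x. case_nat (c x) (T x)) x0"
proof (rule lmor_to_torus[OF lmor_torus[OF assms(3)]])
  show "lrat N x0 (\<lambda>x. case v of 0 \<Rightarrow> c x | Suc k \<Rightarrow> T x k)" for v
    using assms(1) lmor_torus_coord[OF assms(3)] by (cases v) simp_all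
  show "case_nat (c x0) (T x0) \<in> torus (Suc n)"
    by (rule case_nat_torus[OF assms(2) lmor_at_torus[OF assms(3)]])
  show "eventually (\<lambda>x. \<forall>v\<ge>Suc n. case_nat (c x) (T x) v = 0) (near N x0)"
    using lmor_in_torus[OF assms(3)] by eventually_elim (auto simp: torus_def split: nat.split)
qed

lemma lmor_shift:
  assumes "x0 \<in> torus (k + n)"
  shows "lmor (k + n) (torus_var n) (shift k) x0"
proof (rule lmor_to_torus[OF assms])
  show "lrat (k + n) x0 (\<lambda>x. shift k x v)" for v
    unfolding shift_def by (rule lrat_coord)
  show "shift k x0 \<in> torus n" using assms by (auto simp: torus_def shift_def)
  show "eventually (\<lambda>x. \<forall>v\<ge>n. shift k x v = 0) (near (k + n) x0)"
    using eventually_near_torus by eventually_elim (auto simp: torus_def shift_def)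
qed

lemma lmor_first:
  assumes "x0 \<in> torus (k + n)"
  shows "lmor (k + n) (torus_var k) (first k) x0"
  by (rule lmor_to_torus[OF assms])
     (use assms in \<open>auto simp: first_def torus_def intro: lrat_coord\<close>)

lemmas lmor_shift_Suc = lmor_shift[of _ 1, simplified]
lemmas lmor_shift_Suc_Suc = lmor_shift[of _ 2, simplified]

text \<open>In the locale, A and B represent the actions in the coordinates of the torus by quotients of
  positive polynomials, C and D represent the morphism to the maximal torus.\<close>

locale positive_crystal =
  fixes r n :: nat and I :: "'i set" and \<alpha> \<alpha>' :: "'i \<Rightarrow> nat \<Rightarrow> int"
    and X :: "'x atlas" and \<gamma> :: "'x \<rightharpoonup> (nat \<Rightarrow> complex)"
    and e :: "'i \<Rightarrow> complex \<times> 'x \<rightharpoonup> 'x" and \<theta> :: "(nat \<Rightarrow> complex) \<rightharpoonup> 'x"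
    and A B :: "'i \<Rightarrow> nat \<Rightarrow> pospol" and C D :: "nat \<Rightarrow> pospol"
  assumes crystal: "geometric_crystal r I \<alpha> \<alpha>' X \<gamma> e"
    and birational: "birational_iso (torus_var n) X \<theta>"
    and rep_e: "i \<in> I \<Longrightarrow> pos_rep (Suc n) n (e_theta X n \<theta> (e i)) (A i) (B i)"
    and rep_\<gamma>: "pos_rep n r (\<gamma> \<circ>\<^sub>m \<theta>) C D"
    and chi_nonzero: "i \<in> I \<Longrightarrow> set w \<subseteq> I \<Longrightarrow> \<exists>j<r. fold (refl r \<alpha> \<alpha>') w (\<alpha> i) j \<noteq> 0"
begin

abbreviation "\<theta>i \<equiv> rat_inv (torus_var n) X \<theta>"

definition E :: "'i \<Rightarrow> complex \<Rightarrow> (nat \<Rightarrow> complex) \<Rightarrow> (nat \<Rightarrow> complex)" where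
  "E i c t = quot_map (Suc n) n (A i) (B i) (case_nat c t)"

definition \<Gamma> :: "(nat \<Rightarrow> complex) \<Rightarrow> (nat \<Rightarrow> complex)" where
  "\<Gamma> = quot_map n r C D"

lemma rat_inverse_\<theta>: "rat_inverse (torus_var n) X \<theta> \<theta>i"
  using birational unfolding birational_iso_def rat_inv_def by (rule someI_ex)

lemma rational_\<theta>: "rational_map (torus_var n) X \<theta>" and rational_\<theta>i: "rational_map X (torus_var n) \<theta>i"
  and \<theta>i_\<theta>: "rat_eq (torus_var n) (\<theta>i \<circ>\<^sub>m \<theta>) Some" and \<theta>_\<theta>i: "rat_eq X (\<theta> \<circ>\<^sub>m \<theta>i) Some"
  using rat_inverse_\<theta> unfolding rat_inverse_def by blast+

lemma precrystal: "geometric_precrystal r I \<alpha>' X \<gamma> e"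
  using crystal unfolding geometric_crystal_def by blast

lemma irreducible: "irreducible_variety X"
  using precrystal unfolding geometric_precrystal_def by blast

lemma coords_X: "coords_vanish X"
  using irreducible unfolding irreducible_variety_def by (intro coords_vanish_variety) blast

lemma points_X: "points X \<noteq> {}"
  using irreducible unfolding irreducible_variety_def by blast

lemma coords_GmX: "coords_vanish (Gm_var \<otimes>\<^sub>v X)"
  by (intro coords_vanish_prod coords_vanish_Gm coords_X)

text \<open>A fixed dense open part of \<open>X\<close> whose points lift to the torus through
  \<open>\<theta>i\<close>.\<close>

definition V\<theta> :: "'x set" where
  "V\<theta> = (SOME V. zopen X V \<and> zdense X V \<and> V \<subseteq> dom (\<theta> \<circ>\<^sub>m \<theta>i) \<inter> dom Some \<and>
     (\<forall>x\<in>V. (\<theta> \<circ>\<^sub>m \<theta>i) x = Some x))"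

lemma V\<theta>: "zopen X V\<theta>" "zdense X V\<theta>" "x \<in> V\<theta> \<Longrightarrow> (\<theta> \<circ>\<^sub>m \<theta>i) x = Some x"
proof -
  have "\<exists>V. zopen X V \<and> zdense X V \<and> V \<subseteq> dom (\<theta> \<circ>\<^sub>m \<theta>i) \<inter> dom Some \<and>
     (\<forall>x\<in>V. (\<theta> \<circ>\<^sub>m \<theta>i) x = Some x)"
    using \<theta>_\<theta>i unfolding rat_eq_def .
  from someI_ex[OF this]
  show "zopen X V\<theta>" "zdense X V\<theta>" "x \<in> V\<theta> \<Longrightarrow> (\<theta> \<circ>\<^sub>m \<theta>i) x = Some x"
    unfolding V\<theta>_def[symmetric] by blast+
qed

lemma V\<theta>_nonempty: "V\<theta> \<noteq> {}"
  using zdense_ne[OF V\<theta>(2) points_X] by blast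

lemma \<theta>_dom: "\<theta> t = Some x \<Longrightarrow> t \<in> torus n"
  using rational_mapD(1)[OF rational_\<theta>] unfolding zopen_def by (auto simp: points_torus)

lemma V\<theta>_lift:
  assumes "x \<in> V\<theta>"
  obtains t where "\<theta>i x = Some t" "\<theta> t = Some x" "t \<in> torus n"
proof -
  obtain t where t: "\<theta>i x = Some t" "\<theta> t = Some x"
    using V\<theta>(3)[OF assms] by (auto simp: map_comp_Some_iff)
  then show thesis using that \<theta>_dom by blast
qed

lemma lmor_\<theta>:
  assumes "lmor N (torus_var n) T z" "\<theta> (T z) = Some x"
  shows "lmor N X (\<lambda>z. the (\<theta> (T z))) z"
  by (rule lmor_rational_map[OF assms(1) coords_vanish_torus rational_\<theta>]) (use assms(2) in auto)

lemma lift_GmX: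
  "\<forall>a\<in>points Gm_var. \<forall>x\<in>V\<theta>.
     \<exists>z. lmor (Suc n) Gm_var (\<lambda>z. z 0) z \<and> lmor (Suc n) X (\<lambda>z. the (\<theta> (shift 1 z))) z \<and>
       z 0 = a \<and> the (\<theta> (shift 1 z)) = x"
proof (intro ballI)
  fix a x assume assms: "a \<in> points Gm_var" "x \<in> V\<theta>"
  obtain t where t: "\<theta> t = Some x" "t \<in> torus n" using V\<theta>_lift[OF assms(2)] by metis
  have a: "a \<noteq> 0" using assms(1) by (simp add: points_Gm)
  let ?z = "case_nat a t"
  have z: "?z \<in> torus (Suc n)" by (rule case_nat_torus[OF a t(2)])
  have "lmor (Suc n) X (\<lambda>z. the (\<theta> (shift (Suc 0) z))) ?z"
    by (rule lmor_\<theta>[OF lmor_shift_Suc[OF z], where x = x]) (simp add: t(1))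
  moreover have "lmor (Suc n) Gm_var (\<lambda>z. z 0) ?z"
    by (rule lmor_Gm[OF z lrat_coord]) (simp add: a)
  ultimately show "\<exists>z. lmor (Suc n) Gm_var (\<lambda>z. z 0) z \<and>
      lmor (Suc n) X (\<lambda>z. the (\<theta> (shift 1 z))) z \<and> z 0 = a \<and> the (\<theta> (shift 1 z)) = x"
    using t(1) by (intro exI[of _ ?z]) simp
qed

lemma points_Gm_nonempty: "points Gm_var \<noteq> {}"
  unfolding points_Gm by (auto intro: exI[of _ 1])

text \<open>Identities of rational maps on \<open>Gm_var \<otimes>\<^sub>v X\<close> are read in
  torus coordinates, with index 0 for the parameter.\<close>

lemmas generic_GmX = generic_rat_eq_prod[OF _ coords_vanish_Gm coords_X V\<theta>(1) V\<theta>_nonempty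
  points_Gm_nonempty lift_GmX]

lemma action_e: "i \<in> I \<Longrightarrow> unital_action X (e i)"
  using precrystal unfolding geometric_precrystal_def by blast

lemma generic_\<theta>: "eventually (\<lambda>t. \<exists>x. \<theta> t = Some x \<and> \<theta>i x = Some t) (generic n)"
  using generic_rat_eq[OF \<theta>i_\<theta>] by eventually_elim (auto simp: map_comp_Some_iff)

lemma unital_rep:
  assumes "i \<in> I" "\<theta> t = Some x"
  obtains b where "rational_map (Gm_var \<otimes>\<^sub>v X) X b" "rat_eq (Gm_var \<otimes>\<^sub>v X) (e i) b" "b (1, x) = Some x"
proof -
  have "x \<in> points X" using assms(2) rational_mapD(3)[OF rational_\<theta>] by (auto simp: ran_def)
  then show thesis using action_e[OF assms(1)] that unfolding unital_action_def by blast
qed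

lemma lmor_unital_rep:
  assumes "rational_map (Gm_var \<otimes>\<^sub>v X) X b" "b (1, x) = Some x" "\<theta> t = Some x"
  shows "lmor (Suc n) X (\<lambda>z. the (b (z 0, the (\<theta> (shift 1 z))))) (case_nat 1 t)"
proof (rule lmor_rational_map[OF _ coords_GmX assms(1), of _ "\<lambda>z. (z 0, the (\<theta> (shift 1 z)))"])
  have z: "case_nat 1 t \<in> torus (Suc n)" by (rule case_nat_torus[OF _ \<theta>_dom[OF assms(3)]]) simp
  have "lmor (Suc n) X (\<lambda>z. the (\<theta> (shift (Suc 0) z))) (case_nat 1 t)"
    by (rule lmor_\<theta>[OF lmor_shift_Suc[OF z], where x = x]) (simp add: assms(3))
  then show "lmor (Suc n) (Gm_var \<otimes>\<^sub>v X) (\<lambda>z. (z 0, the (\<theta> (shift 1 z)))) (case_nat 1 t)"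
    by (intro lmor_prod lmor_Gm[OF z lrat_coord]) simp_all
  show "(case_nat 1 t 0, the (\<theta> (shift 1 (case_nat 1 t)))) \<in> dom b"
    using assms(2,3) by auto
qed

text \<open>By unitality the action stays near the image of \<open>\<theta>\<close> for parameters near 1, hence generically.\<close>

lemma generic_e_V\<theta>:
  assumes "i \<in> I"
  shows "eventually (\<lambda>z. the (e i (z 0, the (\<theta> (shift 1 z)))) \<in> V\<theta>) (generic (Suc n))"
proof -
  obtain x where x: "x \<in> V\<theta>" using V\<theta>_nonempty by blast
  obtain t where t: "\<theta> t = Some x" "t \<in> torus n" using V\<theta>_lift[OF x] by metis
  obtain b where b: "rational_map (Gm_var \<otimes>\<^sub>v X) X b" "rat_eq (Gm_var \<otimes>\<^sub>v X) (e i) b" "b (1, x) = Some x"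
    using unital_rep[OF assms t(1)] .
  note m = lmor_unital_rep[OF b(1,3) t(1)]
  have "eventually (\<lambda>z. the (b (z 0, the (\<theta> (shift 1 z)))) \<in> V\<theta>) (near (Suc n) (case_nat 1 t))"
    by (rule lmor_open[OF m coords_X V\<theta>(1)]) (simp add: t(1) b(3) x)
  then have "eventually (\<lambda>z. the (b (z 0, the (\<theta> (shift 1 z)))) \<in> V\<theta>) (generic (Suc n))"
    by (rule generic_if_near[OF lmor_torus[OF m]])
  with generic_GmX[OF b(2)] show ?thesis by eventually_elim simp
qed

text \<open>Every map in the chain is defined at \<open>z\<close>, and the result returns to
  \<open>X\<close> under \<open>\<theta>\<close>. The last equation is what permits a further action
  to be applied to the result.\<close>

definition good :: "'i \<Rightarrow> (nat \<Rightarrow> complex) \<Rightarrow> bool" where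
  "good i z \<longleftrightarrow> (\<exists>x y. \<theta> (shift 1 z) = Some x \<and> e i (z 0, x) = Some y \<and>
     \<theta>i y = Some (E i (z 0) (shift 1 z)) \<and> \<theta> (E i (z 0) (shift 1 z)) = Some y)"

lemma generic_good:
  assumes "i \<in> I"
  shows "eventually (good i) (generic (Suc n))"
proof -
  have "eventually (\<lambda>z. e_theta X n \<theta> (e i) z = Some (quot_map (Suc n) n (A i) (B i) z)) (generic (Suc n))"
    using rep_e[OF assms] unfolding pos_rep_def by (auto elim: eventually_mono)
  with generic_e_V\<theta>[OF assms] show ?thesis
  proof eventually_elim
    case (elim z)
    have Ez: "E i (z 0) (shift 1 z) = quot_map (Suc n) n (A i) (B i) z"
      unfolding E_def using case_nat_shift[of z] by simp
    obtain x y where xy: "\<theta> (shift 1 z) = Some x" "e i (z 0, x) = Some y"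
        "\<theta>i y = Some (E i (z 0) (shift 1 z))"
      using elim(2) unfolding Ez e_theta_def by (auto simp: shift_def Option.bind_eq_Some_conv)
    have "y \<in> V\<theta>" using elim(1) xy by simp
    from V\<theta>(3)[OF this] xy(3) have "\<theta> (E i (z 0) (shift 1 z)) = Some y" by (simp add: map_comp_def)
    with xy show ?case unfolding good_def by blast
  qed
qed

lemma E_pos:
  assumes "i \<in> I" "a > 0" "t \<in> pos_points n"
  shows "E i (complex_of_real a) t \<in> pos_points n"
  unfolding E_def by (rule quot_map_pos[OF rep_e[OF assms(1)] case_nat_pos[OF assms(2,3)]])

lemma lmor_E:
  assumes "i \<in> I" "lrat N z c" "lmor N (torus_var n) T z" "c z = complex_of_real a" "a > 0" "T z \<in> pos_points n"
  shows "lmor N (torus_var n) (\<lambda>z. E i (c z) (T z)) z"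
  unfolding E_def
proof (rule lmor_quot_map[OF rep_e[OF assms(1)] lmor_case_nat[OF assms(2) _ assms(3)]])
  show "c z \<noteq> 0" using assms(4,5) by simp
  show "case_nat (c z) (T z) \<in> pos_points (Suc n)"
    unfolding assms(4) by (rule case_nat_pos[OF assms(5,6)])
qed

lemma pos_id:
  "t \<in> pos_points N \<Longrightarrow> lmor N (torus_var N) (\<lambda>x. x) t"
  by (rule lmor_id[OF pos_points_torus])

text \<open>The points with parameter 1 form a proper closed set, so a generic identity cannot
  simply be restricted to them. Instead unitality supplies, for each generic \<open>t\<close> with
  image \<open>x\<close>, a representative of the action defined at \<open>(1, x)\<close>;
  transported to the torus it is regular at \<open>(1, t)\<close>, as is \<open>E\<close>, and
  agrees with \<open>E\<close> generically. The identity in \<open>t\<close> then extends from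
  generic to all positive points.\<close>

lemma E_1:
  assumes i: "i \<in> I" and t: "t \<in> pos_points n"
  shows "E i 1 t = t"
proof -
  have gen: "eventually (\<lambda>t. t \<in> pos_points n \<longrightarrow> E i 1 t = t) (generic n)"
    using generic_\<theta>
  proof (eventually_elim, intro impI)
    fix t assume ex: "\<exists>x. \<theta> t = Some x \<and> \<theta>i x = Some t" and pos: "t \<in> pos_points n"
    then obtain x where x: "\<theta> t = Some x" "\<theta>i x = Some t" by blast
    obtain b where b: "rational_map (Gm_var \<otimes>\<^sub>v X) X b" "rat_eq (Gm_var \<otimes>\<^sub>v X) (e i) b" "b (1, x) = Some x"
      using unital_rep[OF i x(1)] .
    let ?F = "\<lambda>z. the (\<theta>i (the (b (z 0, the (\<theta> (shift 1 z))))))"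
    have F: "lmor (Suc n) (torus_var n) ?F (case_nat 1 t)"
      by (rule lmor_rational_map[OF lmor_unital_rep[OF b(1,3) x(1)] coords_X rational_\<theta>i])
         (use x b(3) in auto)
    have pos1: "case_nat 1 t \<in> pos_points (Suc n)" using case_nat_pos[of 1 t n] pos by simp
    have lE: "lmor (Suc n) (torus_var n) (\<lambda>z. E i (z 0) (shift 1 z)) (case_nat 1 t)"
      using lmor_E[OF i lrat_coord lmor_shift_Suc[OF pos_points_torus[OF pos1]], of 0 1] pos by simp
    have "eventually (\<lambda>z. ?F z = E i (z 0) (shift 1 z)) (generic (Suc n))"
      using generic_good[OF i] generic_GmX[OF b(2)]
      by eventually_elim (auto simp: good_def)
    then have "eventually (\<lambda>z. z \<in> pos_points (Suc n) \<longrightarrow> ?F z = E i (z 0) (shift 1 z)) (generic (Suc n))"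
      by (rule eventually_mono) simp
    from lmor_eq_pos[OF F lE this] show "E i 1 t = t"
      using x b(3) by simp
  qed
  have "lmor n (torus_var n) (\<lambda>t. E i 1 t) t"
    using lmor_E[OF i lrat_1 pos_id[OF t], of 1] t by simp
  from lmor_eq_pos[OF this pos_id[OF t] gen] show ?thesis .
qed

text \<open>By \<open>E_1\<close> the point \<open>(1, t)\<close> is mapped to \<open>t\<close>, so
  the action map reaches every positive point.\<close>

lemma generic_pull_E:
  assumes "i \<in> I" "eventually P (generic n)"
  shows "eventually (\<lambda>z. P (E i (z 0) (shift 1 z))) (generic (Suc n))"
proof (rule generic_pullback[OF assms(2)])
  fix t assume t: "t \<in> pos_points n"
  have pos1: "case_nat 1 t \<in> pos_points (Suc n)" using case_nat_pos[of 1 t n] t by simp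
  have "lmor (Suc n) (torus_var n) (\<lambda>z. E i (z 0) (shift 1 z)) (case_nat 1 t)"
    using lmor_E[OF assms(1) lrat_coord lmor_shift_Suc[OF pos_points_torus[OF pos1]], of 0 1] t by simp
  then show "\<exists>z. lmor (Suc n) (torus_var n) (\<lambda>z. E i (z 0) (shift 1 z)) z \<and> E i (z 0) (shift 1 z) = t"
    using E_1[OF assms(1) t] by (intro exI[of _ "case_nat 1 t"]) simp
qed

lemma generic_pull_shift:
  assumes "eventually P (generic n)"
  shows "eventually (\<lambda>z. P (shift k z)) (generic (k + n))"
proof (rule generic_pullback[OF assms])
  fix t assume t: "t \<in> pos_points n"
  have "cat k (\<lambda>_. 1) t \<in> torus (k + n)" using pos_points_torus[OF t] by (auto simp: torus_def cat_def)
  from lmor_shift[OF this]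
  show "\<exists>x. lmor (k + n) (torus_var n) (shift k) x \<and> shift k x = t"
    by (intro exI[of _ "cat k (\<lambda>_. 1) t"]) simp
qed

lemma lift_GmGmX:
  "\<forall>a\<in>points Gm_var. \<forall>w\<in>points Gm_var \<times> V\<theta>.
    \<exists>z. lmor (Suc (Suc n)) Gm_var (\<lambda>z. z 0) z \<and>
    lmor (Suc (Suc n)) (Gm_var \<otimes>\<^sub>v X) (\<lambda>z. (z 1, the (\<theta> (shift 2 z)))) z \<and>
    z 0 = a \<and> (z 1, the (\<theta> (shift 2 z))) = w"
proof (intro ballI)
  fix a w assume assms: "a \<in> points Gm_var" "w \<in> points Gm_var \<times> V\<theta>"
  obtain c x where w: "w = (c, x)" "c \<noteq> 0" "x \<in> V\<theta>" using assms(2) by (auto simp: points_Gm)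
  obtain t where t: "\<theta> t = Some x" "t \<in> torus n" using V\<theta>_lift[OF w(3)] by metis
  have a: "a \<noteq> 0" using assms(1) by (simp add: points_Gm)
  let ?z = "case_nat a (case_nat c t)"
  have z: "?z \<in> torus (Suc (Suc n))" by (intro case_nat_torus a w t)
  have sh: "shift 2 ?z = t" by (simp add: numeral_2_eq_2)
  have "lmor (Suc (Suc n)) X (\<lambda>z. the (\<theta> (shift 2 z))) ?z"
    by (rule lmor_\<theta>[OF lmor_shift_Suc_Suc[OF z], where x = x]) (simp add: t(1) sh)
  moreover have "lmor (Suc (Suc n)) Gm_var (\<lambda>z. z 0) ?z"
    by (rule lmor_Gm[OF z lrat_coord]) (simp add: a)
  moreover have "lmor (Suc (Suc n)) Gm_var (\<lambda>z. z 1) ?z"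
    by (rule lmor_Gm[OF z lrat_coord]) (simp add: w(2))
  ultimately show "\<exists>z. lmor (Suc (Suc n)) Gm_var (\<lambda>z. z 0) z \<and>
      lmor (Suc (Suc n)) (Gm_var \<otimes>\<^sub>v X) (\<lambda>z. (z 1, the (\<theta> (shift 2 z)))) z \<and>
      z 0 = a \<and> (z 1, the (\<theta> (shift 2 z))) = w"
    using t(1) w(1) sh by (intro exI[of _ ?z] conjI lmor_prod) simp_all
qed

text \<open>Generically the identity is the action axiom on \<open>X\<close>, provided that the
  inner action, the outer one and the one with the product parameter are all \<open>good\<close>;
  each of these conditions is pulled back along a map that reaches all positive points.\<close>

lemma E_mult_points:
  assumes i: "i \<in> I" and z: "z \<in> pos_points (Suc (Suc n))"
  shows "E i (z 0) (E i (z 1) (shift 2 z)) = E i (z 0 * z 1) (shift 2 z)"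
proof -
  let ?N = "Suc (Suc n)"
  have l1: "lmor ?N (torus_var n) (\<lambda>z. E i (z 1) (shift 2 z)) z"
    and l2: "lmor ?N (torus_var n) (\<lambda>z. E i (z 0) (E i (z 1) (shift 2 z))) z"
    and l3: "lmor ?N (torus_var n) (\<lambda>z. E i (z 0 * z 1) (shift 2 z)) z"
    if z: "z \<in> pos_points ?N" for z
  proof -
    obtain a where a: "a > 0" "z 0 = complex_of_real a" using pos_point_coord[OF z, of 0] by auto
    obtain c where c: "c > 0" "z 1 = complex_of_real c" using pos_point_coord[OF z, of 1] by auto
    have s: "shift 2 z \<in> pos_points n" using shift_pos[of z 2 n] z by simp
    note ls = lmor_shift_Suc_Suc[OF pos_points_torus[OF z]]
    show l1: "lmor ?N (torus_var n) (\<lambda>z. E i (z 1) (shift 2 z)) z"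
      by (rule lmor_E[OF i lrat_coord ls c(2,1) s])
    show "lmor ?N (torus_var n) (\<lambda>z. E i (z 0) (E i (z 1) (shift 2 z))) z"
      by (rule lmor_E[OF i lrat_coord l1 a(2,1)]) (simp only: c(2) E_pos[OF i c(1) s])
    have "z 0 * z 1 = complex_of_real (a * c)" "a * c > 0" using a c by simp_all
    then show "lmor ?N (torus_var n) (\<lambda>z. E i (z 0 * z 1) (shift 2 z)) z"
      by (intro lmor_E[OF i lrat_mult[OF lrat_coord lrat_coord] ls _ _ s])
  qed
  have lc: "lmor ?N (torus_var (Suc n)) (\<lambda>z. case_nat (c z) (T z)) z"
    if "lmor ?N (torus_var n) T z" "lrat ?N z c" "c z \<noteq> 0" for c T z
    by (rule lmor_case_nat[OF that(2,3,1)])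
  have g1: "eventually (\<lambda>z. good i (case_nat (z 1) (shift 2 z))) (generic ?N)"
  proof (rule generic_pullback[OF generic_good[OF i]])
    fix y assume y: "y \<in> pos_points (Suc n)"
    let ?z = "case_nat 1 y"
    have z: "?z \<in> pos_points ?N" using case_nat_pos[of 1 y "Suc n"] y by simp
    have "y 0 \<noteq> 0" using pos_points_torus[OF y] by (simp add: torus_def)
    then have "lmor ?N (torus_var (Suc n)) (\<lambda>z. case_nat (z 1) (shift 2 z)) ?z"
      by (intro lc lmor_shift_Suc_Suc[OF pos_points_torus[OF z]] lrat_coord) simp
    moreover have "case_nat (?z 1) (shift 2 ?z) = y"
      using case_nat_shift[of y] by (simp add: numeral_2_eq_2)
    ultimately show "\<exists>z. lmor ?N (torus_var (Suc n)) (\<lambda>z. case_nat (z 1) (shift 2 z)) z \<and>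
        case_nat (z 1) (shift 2 z) = y" by blast
  qed
  \<comment> \<open>Inner parameter 1 makes this point a preimage of \<open>y\<close> both for the
    outer action, by \<open>E_1\<close>, and for the product of the parameters.\<close>
  have lift: "case_nat (y 0) (case_nat 1 (shift 1 y)) \<in> pos_points ?N"
      "shift 2 (case_nat (y 0) (case_nat 1 (shift 1 y))) = shift 1 y"
      "shift 1 y \<in> pos_points n" "y 0 \<noteq> 0"
    if y: "y \<in> pos_points (Suc n)" for y
  proof -
    show s: "shift 1 y \<in> pos_points n" using shift_pos_Suc[OF y] by simp
    obtain a where a: "a > 0" "y 0 = complex_of_real a" using pos_point_coord[OF y, of 0] by auto
    show "case_nat (y 0) (case_nat 1 (shift 1 y)) \<in> pos_points ?N"
      unfolding a(2) using case_nat_pos[OF a(1) case_nat_pos[of 1, OF _ s]] by simp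
    show "shift 2 (case_nat (y 0) (case_nat 1 (shift 1 y))) = shift 1 y" by (simp add: numeral_2_eq_2)
    show "y 0 \<noteq> 0" using a by simp
  qed
  have g2: "eventually (\<lambda>z. good i (case_nat (z 0) (E i (z 1) (shift 2 z)))) (generic ?N)"
  proof (rule generic_pullback[OF generic_good[OF i]])
    fix y assume y: "y \<in> pos_points (Suc n)"
    let ?z = "case_nat (y 0) (case_nat 1 (shift 1 y))"
    have "lmor ?N (torus_var (Suc n)) (\<lambda>z. case_nat (z 0) (E i (z 1) (shift 2 z))) ?z"
      using lift(4)[OF y] by (intro lc l1 lift(1)[OF y] lrat_coord) simp
    moreover have "case_nat (?z 0) (E i (?z 1) (shift 2 ?z)) = y"
      using lift(2)[OF y] E_1[OF i lift(3)[OF y]] case_nat_shift[of y] by simp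
    ultimately show "\<exists>z. lmor ?N (torus_var (Suc n)) (\<lambda>z. case_nat (z 0) (E i (z 1) (shift 2 z))) z \<and>
        case_nat (z 0) (E i (z 1) (shift 2 z)) = y" by blast
  qed
  have g3: "eventually (\<lambda>z. good i (case_nat (z 0 * z 1) (shift 2 z))) (generic ?N)"
  proof (rule generic_pullback[OF generic_good[OF i]])
    fix y assume y: "y \<in> pos_points (Suc n)"
    let ?z = "case_nat (y 0) (case_nat 1 (shift 1 y))"
    have "lmor ?N (torus_var (Suc n)) (\<lambda>z. case_nat (z 0 * z 1) (shift 2 z)) ?z"
      using lift(4)[OF y]
      by (intro lc lmor_shift_Suc_Suc[OF pos_points_torus[OF lift(1)[OF y]]] lrat_mult lrat_coord) simp
    moreover have "case_nat (?z 0 * ?z 1) (shift 2 ?z) = y"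
      using lift(2)[OF y] case_nat_shift[of y] by simp
    ultimately show "\<exists>z. lmor ?N (torus_var (Suc n)) (\<lambda>z. case_nat (z 0 * z 1) (shift 2 z)) z \<and>
        case_nat (z 0 * z 1) (shift 2 z) = y" by blast
  qed
  have act: "rat_eq (Gm_var \<otimes>\<^sub>v Gm_var \<otimes>\<^sub>v X)
       (\<lambda>(c, c', x). Option.bind (e i (c', x)) (\<lambda>y. e i (c, y))) (\<lambda>(c, c', x). e i (c * c', x))"
    using action_e[OF i] unfolding unital_action_def rational_action_def by blast
  have "points Gm_var \<times> V\<theta> \<noteq> {}" using points_Gm_nonempty V\<theta>_nonempty by blast
  note g4 = generic_rat_eq_prod[OF act coords_vanish_Gm coords_GmX zopen_prod[OF V\<theta>(1)] this
      points_Gm_nonempty lift_GmGmX]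
  have "eventually (\<lambda>z. E i (z 0) (E i (z 1) (shift 2 z)) = E i (z 0 * z 1) (shift 2 z)) (generic ?N)"
    using g1 g2 g3 g4
  proof eventually_elim
    case (elim z)
    let ?t = "E i (z 1) (shift 2 z)"
    obtain x y where xy: "\<theta> (shift 2 z) = Some x" "e i (z 1, x) = Some y" "\<theta> ?t = Some y"
      using elim(1) unfolding good_def by auto
    obtain y2 where y2: "e i (z 0, y) = Some y2" "\<theta>i y2 = Some (E i (z 0) ?t)"
      using elim(2) xy(3) unfolding good_def by auto
    obtain y3 where y3: "e i (z 0 * z 1, x) = Some y3" "\<theta>i y3 = Some (E i (z 0 * z 1) (shift 2 z))"
      using elim(3) xy(1) unfolding good_def by auto
    have "y2 = y3" using elim(4) xy y2(1) y3(1) by simp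
    then show ?case using y2(2) y3(2) by simp
  qed
  then have "eventually (\<lambda>z. z \<in> pos_points ?N \<longrightarrow>
      E i (z 0) (E i (z 1) (shift 2 z)) = E i (z 0 * z 1) (shift 2 z)) (generic ?N)"
    by (rule eventually_mono) simp
  from lmor_eq_pos[OF l2[OF z] l3[OF z] this] show ?thesis .
qed

lemma E_mult:
  assumes "i \<in> I" "a > 0" "c > 0" "t \<in> pos_points n"
  shows "E i (complex_of_real a) (E i (complex_of_real c) t) = E i (complex_of_real (a * c)) t"
proof -
  have "case_nat (complex_of_real a) (case_nat (complex_of_real c) t) \<in> pos_points (Suc (Suc n))"
    by (intro case_nat_pos assms)
  from E_mult_points[OF assms(1) this] show ?thesis by (simp add: numeral_2_eq_2)
qed

lemma \<Gamma>_pos: "t \<in> pos_points n \<Longrightarrow> \<Gamma> t \<in> pos_points r"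
  unfolding \<Gamma>_def by (rule quot_map_pos[OF rep_\<gamma>])

lemma \<Gamma>_E:
  assumes i: "i \<in> I" and a: "a > 0" and t: "t \<in> pos_points n"
  shows "\<Gamma> (E i (complex_of_real a) t) = tmult (cochr r (\<alpha>' i) (complex_of_real a)) (\<Gamma> t)"
proof -
  let ?z = "case_nat (complex_of_real a) t"
  have zp: "?z \<in> pos_points (Suc n)" by (rule case_nat_pos[OF a t])
  note z = pos_points_torus[OF zp]
  have lE: "lmor (Suc n) (torus_var n) (\<lambda>z. E i (z 0) (shift 1 z)) ?z"
    using lmor_E[OF i lrat_coord lmor_shift_Suc[OF z], of 0 a] a t by simp
  have l1: "lmor (Suc n) (torus_var r) (\<lambda>z. \<Gamma> (E i (z 0) (shift 1 z))) ?z"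
    unfolding \<Gamma>_def by (rule lmor_quot_map[OF rep_\<gamma> lE]) (simp add: E_pos[OF i a t])
  have l2: "lmor (Suc n) (torus_var r) (\<lambda>z. \<Gamma> (shift 1 z)) ?z"
    unfolding \<Gamma>_def using lmor_quot_map[OF rep_\<gamma> lmor_shift_Suc[OF z]] t by simp
  have l3: "lmor (Suc n) (torus_var r) (\<lambda>z. tmult (cochr r (\<alpha>' i) (z 0)) (\<Gamma> (shift 1 z))) ?z"
  proof (rule lmor_to_torus[OF z])
    show "lrat (Suc n) ?z (\<lambda>z. tmult (cochr r (\<alpha>' i) (z 0)) (\<Gamma> (shift 1 z)) v)" if "v < r" for v
    proof -
      have "lrat (Suc n) ?z (\<lambda>z. z 0 powi \<alpha>' i v * \<Gamma> (shift 1 z) v)"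
        by (intro lrat_mult lrat_powi lrat_coord z lmor_torus_coord[OF l2]) (use a in simp)
      then show ?thesis using that by (simp add: tmult_def cochr_def)
    qed
    show "tmult (cochr r (\<alpha>' i) (?z 0)) (\<Gamma> (shift 1 ?z)) \<in> torus r"
      using pos_points_torus[OF \<Gamma>_pos[OF t]] a by (simp add: torus_def tmult_def cochr_def)
  qed (simp add: tmult_def cochr_def)
  have g\<Gamma>: "eventually (\<lambda>t. (\<gamma> \<circ>\<^sub>m \<theta>) t = Some (\<Gamma> t)) (generic n)"
    using rep_\<gamma> unfolding pos_rep_def \<Gamma>_def by (auto elim: eventually_mono)
  have eq: "rat_eq (Gm_var \<otimes>\<^sub>v X) (\<gamma> \<circ>\<^sub>m e i) (\<lambda>(c, x). map_option (tmult (cochr r (\<alpha>' i) c)) (\<gamma> x))"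
    using precrystal i unfolding geometric_precrystal_def by blast
  have "eventually (\<lambda>z. \<Gamma> (E i (z 0) (shift 1 z)) = tmult (cochr r (\<alpha>' i) (z 0)) (\<Gamma> (shift 1 z))) (generic (Suc n))"
    using generic_good[OF i] generic_GmX[OF eq] generic_pull_E[OF i g\<Gamma>] generic_pull_shift[OF g\<Gamma>, of 1, simplified]
  proof eventually_elim
    case (elim z)
    obtain x y where xy: "\<theta> (shift 1 z) = Some x" "e i (z 0, x) = Some y" "\<theta> (E i (z 0) (shift 1 z)) = Some y"
      using elim(1) unfolding good_def by auto
    have "\<gamma> y = Some (\<Gamma> (E i (z 0) (shift 1 z)))" using elim(3) xy(3) by (simp add: map_comp_def)
    moreover have "\<gamma> x = Some (\<Gamma> (shift 1 z))" using elim(4) xy(1) by (simp add: map_comp_def)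
    ultimately show ?case using elim(2) xy by (simp add: map_comp_def)
  qed
  then have "eventually (\<lambda>z. z \<in> pos_points (Suc n) \<longrightarrow>
      \<Gamma> (E i (z 0) (shift 1 z)) = tmult (cochr r (\<alpha>' i) (z 0)) (\<Gamma> (shift 1 z))) (generic (Suc n))"
    by (rule eventually_mono) simp
  from lmor_eq_pos[OF l1 l3 this] show ?thesis by simp
qed

subsection \<open>Words\<close>

text \<open>\<open>z\<close> holds the parameter in the maximal torus in its first \<open>r\<close>
  coordinates and the point after them; \<open>chr r\<close> reads only the former.\<close>

primrec EW :: "'i list \<Rightarrow> (nat \<Rightarrow> complex) \<Rightarrow> (nat \<Rightarrow> complex)" where
  "EW [] = shift r"
| "EW (i # w) = (\<lambda>z. E i (chr r (fold (refl r \<alpha> \<alpha>') w (\<alpha> i)) z) (EW w z))"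

lemma EW_pos: "set w \<subseteq> I \<Longrightarrow> z \<in> pos_points (r + n) \<Longrightarrow> EW w z \<in> pos_points n"
proof (induction w)
  case Nil
  then show ?case by (simp add: shift_pos)
next
  case (Cons i w)
  obtain a where a: "a > 0" "chr r (fold (refl r \<alpha> \<alpha>') w (\<alpha> i)) z = complex_of_real a"
    using chr_pos[OF Cons.prems(2), of r] by auto
  show ?case using Cons a(1) E_pos by (simp add: a(2))
qed

lemma lmor_EW:
  assumes "z \<in> pos_points (r + n)"
  shows "set w \<subseteq> I \<Longrightarrow> lmor (r + n) (torus_var n) (EW w) z"
proof (induction w)
  case Nil
  then show ?case by (simp add: lmor_shift[OF pos_points_torus[OF assms]])
next
  case (Cons i w)
  obtain a where a: "a > 0" "chr r (fold (refl r \<alpha> \<alpha>') w (\<alpha> i)) z = complex_of_real a"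
    using chr_pos[OF assms, of r] by auto
  have w: "set w \<subseteq> I" and i: "i \<in> I" using Cons.prems by simp_all
  show ?case
    unfolding EW.simps
    by (intro lmor_E[OF i _ _ _ a(1)] lrat_chr[OF pos_points_torus[OF assms]] Cons.IH[OF w]
        EW_pos[OF w assms] a(2)) simp
qed

text \<open>For a fixed parameter each letter acts invertibly: \<open>E i (1 / a)\<close> undoes
  \<open>E i a\<close> by \<open>E_mult\<close> and \<open>E_1\<close>.\<close>

lemma EW_surj:
  assumes "s \<in> pos_points r"
  shows "set w \<subseteq> I \<Longrightarrow> u \<in> pos_points n \<Longrightarrow> \<exists>t\<in>pos_points n. EW w (cat r s t) = u"
proof (induction w arbitrary: u)
  case Nil
  then show ?case by (intro bexI[of _ u]) simp_all
next
  case (Cons i w)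
  have i: "i \<in> I" using Cons.prems by simp
  obtain a where a: "a > 0" "chr r (fold (refl r \<alpha> \<alpha>') w (\<alpha> i)) s = complex_of_real a"
    using chr_pos[OF assms, of r] by auto
  have "E i (complex_of_real (1 / a)) u \<in> pos_points n"
    using a(1) by (intro E_pos[OF i _ Cons.prems(2)]) simp
  then obtain t where t: "t \<in> pos_points n" "EW w (cat r s t) = E i (complex_of_real (1 / a)) u"
    using Cons.IH Cons.prems(1) by (metis set_subset_Cons subset_trans)
  have "E i (complex_of_real a) (E i (complex_of_real (1 / a)) u) = E i (complex_of_real (a * (1 / a))) u"
    using a(1) by (intro E_mult[OF i _ _ Cons.prems(2)]) simp_all
  also have "\<dots> = u" using a(1) E_1[OF i Cons.prems(2)] by simp
  finally show ?case using t by (intro bexI[of _ t]) (simp_all only: EW.simps chr_cat a(2) t)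
qed

lemma chr_surj:
  assumes "j < r" "\<mu> j \<noteq> 0" "a > 0"
  shows "\<exists>s\<in>pos_points r. chr r \<mu> s = complex_of_real a"
proof
  \<comment> \<open>All coordinates but the one with index \<open>j\<close> are 1, so this one has
    to be \<open>a\<close> to the power \<open>1 / \<mu> j\<close>.\<close>
  let ?b = "exp (ln a / of_int (\<mu> j))"
  let ?s = "\<lambda>i. if i < r then if i = j then complex_of_real ?b else 1 else 0"
  have "\<exists>a>0. ?s i = complex_of_real a" if "i < r" for i
    using that by (intro exI[of _ "if i = j then ?b else 1"]) simp
  then show "?s \<in> pos_points r" by (simp add: pos_points_def)
  have "chr r \<mu> ?s = (\<Prod>i<r. if i = j then complex_of_real ?b powi \<mu> j else 1)"
    unfolding chr_def by (rule prod.cong) auto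
  also have "\<dots> = complex_of_real (?b powi \<mu> j)" using assms(1) by simp
  also have "?b powi \<mu> j = a" using assms(2,3) by (simp add: exp_power_int)
  finally show "chr r \<mu> ?s = complex_of_real a" .
qed

lemma generic_pull_EW:
  assumes "set w \<subseteq> I" "eventually P (generic n)"
  shows "eventually (\<lambda>z. P (EW w z)) (generic (r + n))"
proof (rule generic_pullback[OF assms(2)])
  fix u assume u: "u \<in> pos_points n"
  have s: "(\<lambda>i. if i < r then 1 else 0) \<in> pos_points r"
    unfolding pos_points_def by (auto intro: exI[of _ 1])
  obtain t where t: "t \<in> pos_points n" "EW w (cat r (\<lambda>i. if i < r then 1 else 0) t) = u"
    using EW_surj[OF s assms(1) u] by blast
  from lmor_EW[OF cat_pos[OF s t(1)] assms(1)] t(2)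
  show "\<exists>x. lmor (r + n) (torus_var n) (EW w) x \<and> EW w x = u" by blast
qed

text \<open>At each letter the pair of parameter and current point must avoid a proper closed set.
  Since the character is nonzero, any positive value of it is attained at some positive
  \<open>s\<close>, and for this \<open>s\<close> the point is adjusted by \<open>EW_surj\<close>;
  hence the pairs reach all positive points.\<close>

lemma generic_e_word:
  assumes "set w \<subseteq> I"
  shows "eventually (\<lambda>z. \<exists>x y. \<theta> (shift r z) = Some x \<and>
    e_word r \<alpha> \<alpha>' e w (first r z, x) = Some y \<and> \<theta> (EW w z) = Some y) (generic (r + n))"
  using assms
proof (induction w)
  case Nil
  show ?case using generic_pull_shift[OF generic_\<theta>, of r] by eventually_elim auto
next
  case (Cons i w)
  have i: "i \<in> I" and w: "set w \<subseteq> I" using Cons.prems by auto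
  let ?\<mu> = "fold (refl r \<alpha> \<alpha>') w (\<alpha> i)"
  obtain j where j: "j < r" "?\<mu> j \<noteq> 0" using chi_nonzero[OF i w] by blast
  have "eventually (\<lambda>z. good i (case_nat (chr r ?\<mu> z) (EW w z))) (generic (r + n))"
  proof (rule generic_pullback[OF generic_good[OF i]])
    fix y assume y: "y \<in> pos_points (Suc n)"
    obtain a where a: "a > 0" "y 0 = complex_of_real a" using pos_point_coord[OF y, of 0] by auto
    obtain s where s: "s \<in> pos_points r" "chr r ?\<mu> s = complex_of_real a"
      using chr_surj[of j ?\<mu>, OF j a(1)] by blast
    obtain t where t: "t \<in> pos_points n" "EW w (cat r s t) = shift (Suc 0) y"
      using EW_surj[OF s(1) w shift_pos_Suc[OF y]] by blast
    let ?z = "cat r s t"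
    note z = cat_pos[OF s(1) t(1)]
    have c: "chr r ?\<mu> ?z = y 0" by (simp add: chr_cat s a)
    have "lmor (r + n) (torus_var (Suc n)) (\<lambda>z. case_nat (chr r ?\<mu> z) (EW w z)) ?z"
      by (intro lmor_case_nat lrat_chr pos_points_torus[OF z] lmor_EW[OF z w]) (use c a in simp_all)
    moreover have "case_nat (chr r ?\<mu> ?z) (EW w ?z) = y" by (simp only: c t case_nat_shift)
    ultimately show "\<exists>z. lmor (r + n) (torus_var (Suc n)) (\<lambda>z. case_nat (chr r ?\<mu> z) (EW w z)) z \<and>
        case_nat (chr r ?\<mu> z) (EW w z) = y" by blast
  qed
  with Cons.IH[OF w] show ?case
  proof eventually_elim
    case (elim z)
    then obtain x y where xy: "\<theta> (shift r z) = Some x" "e_word r \<alpha> \<alpha>' e w (first r z, x) = Some y"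
        "\<theta> (EW w z) = Some y" by blast
    moreover obtain y' where "e i (chr r ?\<mu> z, y) = Some y'" "\<theta> (EW (i # w) z) = Some y'"
      using elim(2) xy(3) unfolding good_def by auto
    ultimately show ?case by (simp add: chr_first)
  qed
qed

lemma EW_eq:
  assumes w: "set w \<subseteq> I" and w': "set w' \<subseteq> I"
    and eq: "rat_eq (torus_var r \<otimes>\<^sub>v X) (e_word r \<alpha> \<alpha>' e w) (e_word r \<alpha> \<alpha>' e w')"
    and z: "z \<in> pos_points (r + n)"
  shows "EW w z = EW w' z"
proof -
  have lift: "\<forall>s\<in>points (torus_var r). \<forall>x\<in>V\<theta>. \<exists>z. lmor (r + n) (torus_var r) (first r) z \<and>
      lmor (r + n) X (\<lambda>z. the (\<theta> (shift r z))) z \<and> first r z = s \<and> the (\<theta> (shift r z)) = x"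
  proof (intro ballI)
    fix s x assume "s \<in> points (torus_var r)" and x: "x \<in> V\<theta>"
    then have s: "s \<in> torus r" by (simp add: points_torus)
    obtain t where t: "\<theta> t = Some x" "t \<in> torus n" using V\<theta>_lift[OF x] by metis
    note z = cat_torus[OF s t(2)]
    have "lmor (r + n) X (\<lambda>z. the (\<theta> (shift r z))) (cat r s t)"
      by (rule lmor_\<theta>[OF lmor_shift[OF z], where x = x]) (simp add: t(1))
    then show "\<exists>z. lmor (r + n) (torus_var r) (first r) z \<and>
      lmor (r + n) X (\<lambda>z. the (\<theta> (shift r z))) z \<and> first r z = s \<and> the (\<theta> (shift r z)) = x"
      using lmor_first[OF z] first_cat[OF s] t(1) by (intro exI[of _ "cat r s t"]) simp
  qed
  have "points (torus_var r) \<noteq> {}" using torus_nonempty by (simp add: points_torus)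
  note g = generic_rat_eq_prod[OF eq coords_vanish_torus coords_X V\<theta>(1) V\<theta>_nonempty this lift]
  have "eventually (\<lambda>z. EW w z = EW w' z) (generic (r + n))"
    using generic_e_word[OF w] generic_e_word[OF w'] g generic_pull_EW[OF w generic_\<theta>]
      generic_pull_EW[OF w' generic_\<theta>]
    by eventually_elim auto
  then have "eventually (\<lambda>z. z \<in> pos_points (r + n) \<longrightarrow> EW w z = EW w' z) (generic (r + n))"
    by (rule eventually_mono) simp
  from lmor_eq_pos[OF lmor_EW[OF z w] lmor_EW[OF z w'] this] show ?thesis .
qed

end

section \<open>Root data\<close>

lemma pairing_linear: "pairing r v (\<lambda>k. a * \<mu> k + b * \<nu> k) = a * pairing r v \<mu> + b * pairing r v \<nu>"
  by (simp add: pairing_def sum_distrib_left sum.distrib algebra_simps)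

section \<open>Alternating words in two letters\<close>

primrec altw :: "'i \<Rightarrow> 'i \<Rightarrow> nat \<Rightarrow> 'i list" where
  "altw a b 0 = []"
| "altw a b (Suc k) = a # altw b a k"

text \<open>The letter in position \<open>k\<close>, counted from 0, of the word alternating from
  \<open>a\<close>. The swapped \<open>letter b a k\<close> is the one after it.\<close>

definition letter :: "'i \<Rightarrow> 'i \<Rightarrow> nat \<Rightarrow> 'i" where
  "letter a b k = (if even k then a else b)"

lemma length_altw [simp]: "length (altw a b k) = k"
  by (induction k arbitrary: a b) auto

lemma letter_Suc: "letter a b (Suc k) = letter b a k"
  by (simp add: letter_def)

lemma letter_in: "letter a b k \<in> {a, b}"
  by (simp add: letter_def)

lemma set_altw: "set (altw a b k) \<subseteq> {a, b}"
  by (induction k arbitrary: a b) auto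

lemma altw_snoc: "altw a b (Suc k) = altw a b k @ [letter a b k]"
proof (induction k arbitrary: a b)
  case (Suc k)
  have "altw a b (Suc (Suc k)) = a # altw b a (Suc k)" by simp
  also have "\<dots> = a # altw b a k @ [letter b a k]" unfolding Suc.IH[of b a] ..
  finally show ?case by (simp add: letter_Suc)
qed (simp add: letter_def)

lemma altw_append: "altw a b (k + l) = altw a b k @ altw (letter a b k) (letter b a k) l"
  by (induction k arbitrary: a b) (simp_all add: letter_Suc, simp add: letter_def)

lemma rev_altw: "rev (altw a b k) = (if even k then altw b a k else altw a b k)"
proof (induction k arbitrary: a b)
  case (Suc k)
  have "rev (altw a b (Suc k)) = rev (altw b a k) @ [a]" by simp
  also have "\<dots> = (if even k then altw a b k @ [a] else altw b a k @ [a])" by (simp add: Suc.IH)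
  also have "\<dots> = (if even (Suc k) then altw b a (Suc k) else altw a b (Suc k))"
    unfolding altw_snoc[of a b k] altw_snoc[of b a k] by (simp add: letter_def)
  finally show ?case .
qed simp

text \<open>Odd alternating words are conjugates of their middle letter and hence act as
  reflections; the root is the image of the middle simple root under the first half.\<close>

lemma altw_palindrome: "altw a b k @ letter a b k # rev (altw a b k) = altw a b (2 * k + 1)"
proof (induction k arbitrary: a b)
  case (Suc k)
  have "altw a b (Suc k) @ letter a b (Suc k) # rev (altw a b (Suc k))
      = a # (altw b a k @ letter b a k # rev (altw b a k)) @ [a]" by (simp add: letter_Suc)
  also have "\<dots> = altw a b (Suc (2 * k + 1)) @ [letter a b (Suc (2 * k + 1))]"
    unfolding Suc.IH by (simp add: letter_def)
  also have "\<dots> = altw a b (2 * Suc k + 1)"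
    unfolding altw_snoc[symmetric] by simp
  finally show ?case .
qed (simp add: letter_def)

text \<open>A root system seen through a base: closure under simple reflections and the sign
  dichotomy. Proportional roots may occur in \<open>\<Phi>\<close>, which is why inversions are
  counted by rays.\<close>

locale root_data =
  fixes r :: nat and I :: "'i set" and \<alpha> \<alpha>' :: "'i \<Rightarrow> nat \<Rightarrow> int" and \<Phi> :: "(nat \<Rightarrow> int) set"
  assumes fin: "finite I" and simple: "i \<in> I \<Longrightarrow> \<alpha> i \<in> \<Phi>"
    and pairing_2: "i \<in> I \<Longrightarrow> pairing r (\<alpha>' i) (\<alpha> i) = 2"
    and refl_\<Phi>: "i \<in> I \<Longrightarrow> \<beta> \<in> \<Phi> \<Longrightarrow> refl r \<alpha> \<alpha>' i \<beta> \<in> \<Phi>"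
    and \<Phi>_lattice: "\<beta> \<in> \<Phi> \<Longrightarrow> \<beta> \<in> lattice r" and \<Phi>_nonzero: "\<beta> \<in> \<Phi> \<Longrightarrow> \<beta> \<noteq> (\<lambda>_. 0)"
    and indep: "(\<And>k. (\<Sum>i\<in>I. a i * \<alpha> i k) = 0) \<Longrightarrow> i \<in> I \<Longrightarrow> a i = (0::int)"
    and decomp: "\<beta> \<in> \<Phi> \<Longrightarrow> \<exists>a :: 'i \<Rightarrow> int. \<beta> = (\<lambda>k. \<Sum>i\<in>I. a i * \<alpha> i k) \<and>
       ((\<forall>i\<in>I. a i \<ge> 0) \<or> (\<forall>i\<in>I. a i \<le> 0))"
begin

abbreviation s :: "'i \<Rightarrow> (nat \<Rightarrow> int) \<Rightarrow> (nat \<Rightarrow> int)" where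
  "s \<equiv> refl r \<alpha> \<alpha>'"

abbreviation act :: "'i list \<Rightarrow> (nat \<Rightarrow> int) \<Rightarrow> (nat \<Rightarrow> int)" where
  "act w \<equiv> foldr s w"

lemma s_linear: "s i (\<lambda>k. a * \<mu> k + b * \<nu> k) = (\<lambda>k. a * s i \<mu> k + b * s i \<nu> k)"
  by (simp add: refl_def pairing_linear algebra_simps fun_eq_iff)

lemma s_simple: "i \<in> I \<Longrightarrow> s i (\<alpha> i) = (\<lambda>k. - \<alpha> i k)"
  by (simp add: refl_def pairing_2 fun_eq_iff)

lemma s_invol: "i \<in> I \<Longrightarrow> s i (s i \<mu>) = \<mu>"
proof -
  assume i: "i \<in> I"
  have "s i \<mu> = (\<lambda>k. 1 * \<mu> k + (- pairing r (\<alpha>' i) \<mu>) * \<alpha> i k)"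
    by (simp add: refl_def)
  then have "s i (s i \<mu>) = (\<lambda>k. s i \<mu> k - pairing r (\<alpha>' i) \<mu> * s i (\<alpha> i) k)"
    using s_linear[of i 1 \<mu> "- pairing r (\<alpha>' i) \<mu>" "\<alpha> i"] by simp
  also have "\<dots> = \<mu>" unfolding s_simple[OF i] by (simp add: refl_def)
  finally show ?thesis .
qed

lemma s_lattice: "i \<in> I \<Longrightarrow> \<mu> \<in> lattice r \<Longrightarrow> s i \<mu> \<in> lattice r"
  using \<Phi>_lattice[OF simple] by (simp add: lattice_def refl_def)

lemma act_linear: "act w (\<lambda>k. a * \<mu> k + b * \<nu> k) = (\<lambda>k. a * act w \<mu> k + b * act w \<nu> k)"
  by (induction w) (simp_all add: s_linear)

lemma act_scale: "act w (\<lambda>k. a * \<mu> k) = (\<lambda>k. a * act w \<mu> k)"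
  using act_linear[of w a \<mu> 0 \<mu>] by simp

lemma act_lattice: "set w \<subseteq> I \<Longrightarrow> \<mu> \<in> lattice r \<Longrightarrow> act w \<mu> \<in> lattice r"
  by (induction w) (simp_all add: s_lattice)

lemma act_\<Phi>: "set w \<subseteq> I \<Longrightarrow> \<beta> \<in> \<Phi> \<Longrightarrow> act w \<beta> \<in> \<Phi>"
  by (induction w) (simp_all add: refl_\<Phi>)

lemma act_rev: "set w \<subseteq> I \<Longrightarrow> act (rev w) (act w \<mu>) = \<mu>"
  by (induction w) (simp_all add: s_invol)

lemma act_rev': "set w \<subseteq> I \<Longrightarrow> act w (act (rev w) \<mu>) = \<mu>"
  using act_rev[of "rev w"] by simp

text \<open>\<open>fold\<close> applies the first letter first, \<open>foldr\<close> the last one,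
  so the characters in \<open>e_word\<close> come from the inverse element.\<close>

lemma fold_eq_act: "fold s w = act (rev w)"
  by (simp add: foldr_conv_fold)

lemma fold_simple_nonzero:
  assumes "i \<in> I" "set w \<subseteq> I"
  shows "\<exists>j<r. fold s w (\<alpha> i) j \<noteq> 0"
proof -
  have "fold s w (\<alpha> i) \<in> \<Phi>" unfolding fold_eq_act using assms by (intro act_\<Phi> simple) auto
  from \<Phi>_nonzero[OF this] \<Phi>_lattice[OF this] show ?thesis
    by (auto simp: lattice_def fun_eq_iff not_less[symmetric])
qed

definition pos :: "(nat \<Rightarrow> int) \<Rightarrow> bool" where
  "pos \<beta> \<longleftrightarrow> (\<exists>a :: 'i \<Rightarrow> int. \<beta> = (\<lambda>k. \<Sum>i\<in>I. a i * \<alpha> i k) \<and> (\<forall>i\<in>I. a i \<ge> 0))"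

definition neg :: "(nat \<Rightarrow> int) \<Rightarrow> bool" where
  "neg \<beta> \<longleftrightarrow> pos (\<lambda>k. - \<beta> k)"

lemma pos_or_neg: "\<beta> \<in> \<Phi> \<Longrightarrow> pos \<beta> \<or> neg \<beta>"
proof -
  assume "\<beta> \<in> \<Phi>"
  then obtain a :: "'i \<Rightarrow> int" where a: "\<beta> = (\<lambda>k. \<Sum>i\<in>I. a i * \<alpha> i k)"
      "(\<forall>i\<in>I. a i \<ge> 0) \<or> (\<forall>i\<in>I. a i \<le> 0)" using decomp by blast
  from a(2) show ?thesis
  proof
    assume "\<forall>i\<in>I. a i \<ge> 0"
    then show ?thesis using a(1) unfolding pos_def by blast
  next
    assume "\<forall>i\<in>I. a i \<le> 0"
    moreover have "(\<lambda>k. - \<beta> k) = (\<lambda>k. \<Sum>i\<in>I. (- a i) * \<alpha> i k)"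
      by (simp add: a(1) sum_negf)
    ultimately have "neg \<beta>" unfolding neg_def pos_def by (intro exI[of _ "\<lambda>i. - a i"]) simp
    then show ?thesis ..
  qed
qed

text \<open>The cone of positive elements contains no line: by independence of the simple roots the
  nonnegative coefficients must cancel one by one.\<close>

lemma pos_add_eq_0:
  assumes "pos \<beta>" "pos \<delta>" "p > 0" "q > 0" "\<And>k. p * \<beta> k + q * \<delta> k = 0"
  shows "\<beta> = (\<lambda>_. 0)"
proof -
  obtain a where a: "\<beta> = (\<lambda>k. \<Sum>i\<in>I. a i * \<alpha> i k)" "\<forall>i\<in>I. a i \<ge> 0" using assms(1) unfolding pos_def by blast
  obtain b where b: "\<delta> = (\<lambda>k. \<Sum>i\<in>I. b i * \<alpha> i k)" "\<forall>i\<in>I. b i \<ge> 0" using assms(2) unfolding pos_def by blast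
  have "(\<Sum>i\<in>I. (p * a i + q * b i) * \<alpha> i k) = p * \<beta> k + q * \<delta> k" for k
    by (simp add: a(1) b(1) sum_distrib_left sum.distrib algebra_simps)
  then have "p * a i + q * b i = 0" if "i \<in> I" for i using indep[of "\<lambda>i. p * a i + q * b i"] assms(5) that by simp
  then have "a i = 0" if "i \<in> I" for i
    using a(2) b(2) assms(3,4) that
    by (metis add_nonneg_eq_0_iff less_le mult_eq_0_iff mult_nonneg_nonneg order_less_imp_le)
  then show ?thesis by (simp add: a(1))
qed

lemma not_pos_neg: "\<beta> \<in> \<Phi> \<Longrightarrow> pos \<beta> \<Longrightarrow> \<not> neg \<beta>"
  using pos_add_eq_0[of \<beta> "\<lambda>k. - \<beta> k" 1 1] \<Phi>_nonzero unfolding neg_def by auto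

lemma pos_simple: "i \<in> I \<Longrightarrow> pos (\<alpha> i)"
proof -
  assume i: "i \<in> I"
  have "(\<Sum>j\<in>I. (if j = i then 1 else 0) * \<alpha> j k) = (\<Sum>j\<in>I. if j = i then \<alpha> i k else 0)" for k
    by (rule sum.cong) auto
  then have "\<alpha> i = (\<lambda>k. \<Sum>j\<in>I. (if j = i then 1 else 0) * \<alpha> j k)" using fin i by simp
  then show ?thesis unfolding pos_def by (intro exI[of _ "\<lambda>j. if j = i then 1 else 0"]) simp
qed

text \<open>A simple reflection changes only the coefficient at its own root, so all other
  coefficients of \<open>\<beta>\<close> are both nonnegative and nonpositive.\<close>

lemma flip_simple:
  assumes "\<beta> \<in> \<Phi>" "pos \<beta>" "i \<in> I" "neg (s i \<beta>)"
  shows "\<exists>c>0. \<beta> = (\<lambda>k. c * \<alpha> i k)"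
proof -
  obtain a where a: "\<beta> = (\<lambda>k. \<Sum>j\<in>I. a j * \<alpha> j k)" "\<forall>j\<in>I. a j \<ge> 0" using assms(2) unfolding pos_def by blast
  obtain b where b: "(\<lambda>k. - s i \<beta> k) = (\<lambda>k. \<Sum>j\<in>I. b j * \<alpha> j k)" "\<forall>j\<in>I. b j \<ge> 0"
    using assms(4) unfolding neg_def pos_def by blast
  let ?p = "pairing r (\<alpha>' i) \<beta>"
  have unit: "(\<Sum>j\<in>I. (if j = i then ?p else 0) * \<alpha> j k) = ?p * \<alpha> i k" for k
  proof -
    have "(\<Sum>j\<in>I. (if j = i then ?p else 0) * \<alpha> j k) = (\<Sum>j\<in>I. if j = i then ?p * \<alpha> i k else 0)"
      by (rule sum.cong) auto
    then show ?thesis using fin assms(3) by simp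
  qed
  have "(\<Sum>j\<in>I. (a j - (if j = i then ?p else 0) + b j) * \<alpha> j k) = \<beta> k - ?p * \<alpha> i k + (- s i \<beta> k)" for k
  proof -
    have "(\<Sum>j\<in>I. (a j - (if j = i then ?p else 0) + b j) * \<alpha> j k) =
        (\<Sum>j\<in>I. a j * \<alpha> j k) - (\<Sum>j\<in>I. (if j = i then ?p else 0) * \<alpha> j k) + (\<Sum>j\<in>I. b j * \<alpha> j k)"
      by (simp only: ring_distribs sum.distrib sum_subtractf)
    then show ?thesis using fun_cong[OF a(1), of k] fun_cong[OF b(1), of k] unit[of k] by simp
  qed
  then have "a j - (if j = i then ?p else 0) + b j = 0" if "j \<in> I" for j
    using indep[of "\<lambda>j. a j - (if j = i then ?p else 0) + b j"] that by (simp add: refl_def)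
  then have zero: "a j = 0" if "j \<in> I" "j \<noteq> i" for j using a(2) b(2) that by force
  have "\<beta> k = a i * \<alpha> i k" for k
  proof -
    have "\<beta> k = (\<Sum>j\<in>I. if j = i then a i * \<alpha> i k else 0)"
      unfolding a(1) by (rule sum.cong) (use zero in auto)
    then show ?thesis using fin assms(3) by simp
  qed
  then have \<beta>: "\<beta> = (\<lambda>k. a i * \<alpha> i k)" by blast
  then have "a i \<noteq> 0" using \<Phi>_nonzero[OF assms(1)] by auto
  then show ?thesis using \<beta> a(2) assms(3) by (intro exI[of _ "a i"]) auto
qed

definition proportional :: "(nat \<Rightarrow> int) \<Rightarrow> (nat \<Rightarrow> int) \<Rightarrow> bool" where
  "proportional \<beta> \<delta> \<longleftrightarrow> (\<exists>p>0. \<exists>q>0. \<forall>k. p * \<beta> k = q * \<delta> k)"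

text \<open>A word makes at most as many rays of positive roots negative as it has letters: its letters
  are applied one after the other, and each flips only the ray of its simple root.\<close>

lemma card_inversions:
  assumes "finite R" "R \<subseteq> \<Phi>" "\<And>\<beta>. \<beta> \<in> R \<Longrightarrow> pos \<beta>"
    and "\<And>\<beta> \<delta>. \<beta> \<in> R \<Longrightarrow> \<delta> \<in> R \<Longrightarrow> proportional \<beta> \<delta> \<Longrightarrow> \<beta> = \<delta>"
    and "set u \<subseteq> I" "\<And>\<beta>. \<beta> \<in> R \<Longrightarrow> neg (act u \<beta>)"
  shows "card R \<le> length u"
  using assms
proof (induction u arbitrary: R)
  case Nil
  have "\<beta> \<notin> R" for \<beta> using Nil.prems(2) Nil.prems(3,6)[of \<beta>] not_pos_neg[of \<beta>] by auto
  then have "R = {}" by blast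
  then show ?case by simp
next
  case (Cons j u)
  have j: "j \<in> I" and u: "set u \<subseteq> I" using Cons.prems(5) by auto
  \<comment> \<open>The head \<open>j\<close> of the list is applied last: a root outside
    \<open>?R\<close> is still positive after \<open>u\<close>, so it is flipped by
    \<open>s j\<close> and its image under \<open>u\<close> lies on the ray of
    \<open>\<alpha> j\<close>. At most one element of \<open>R\<close> does so.\<close>
  let ?R = "{\<beta> \<in> R. neg (act u \<beta>)}"
  have 1: "card ?R \<le> length u"
    by (rule Cons.IH) (use Cons.prems u in auto)
  have flip: "\<exists>c>0. act u \<beta> = (\<lambda>k. c * \<alpha> j k)" if "\<beta> \<in> R - ?R" for \<beta>
  proof -
    have b: "\<beta> \<in> R" "\<not> neg (act u \<beta>)" using that by auto
    have root: "act u \<beta> \<in> \<Phi>" using act_\<Phi>[OF u] b(1) Cons.prems(2) by blast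
    have "neg (s j (act u \<beta>))" using Cons.prems(6)[OF b(1)] by simp
    then show ?thesis using flip_simple[OF root _ j] pos_or_neg[OF root] b(2) by blast
  qed
  have eq: "\<beta> = \<delta>" if \<beta>: "\<beta> \<in> R - ?R" and \<delta>: "\<delta> \<in> R - ?R" for \<beta> \<delta>
  proof -
    obtain c where c: "c > 0" "act u \<beta> = (\<lambda>k. c * \<alpha> j k)" using flip[OF \<beta>] by blast
    obtain d where d: "d > 0" "act u \<delta> = (\<lambda>k. d * \<alpha> j k)" using flip[OF \<delta>] by blast
    have "act u (\<lambda>k. d * \<beta> k) = act u (\<lambda>k. c * \<delta> k)"
      unfolding act_scale c(2) d(2) by (simp add: mult.left_commute)
    then have "(\<lambda>k. d * \<beta> k) = (\<lambda>k. c * \<delta> k)" using act_rev[OF u] by metis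
    then have "\<forall>k. d * \<beta> k = c * \<delta> k" by (simp add: fun_eq_iff)
    then have "proportional \<beta> \<delta>" unfolding proportional_def using c(1) d(1) by blast
    then show ?thesis using Cons.prems(4) \<beta> \<delta> by blast
  qed
  have "card (R - ?R) \<le> 1"
    using eq Cons.prems(1) by (simp add: card_le_Suc0_iff_eq)
  moreover have "card R = card ?R + card (R - ?R)"
    using Cons.prems(1) by (subst card_Un_disjoint[symmetric]) (auto intro: arg_cong[where f = card])
  ultimately show ?case using 1 by simp
qed

section \<open>The order of a product of two simple reflections\<close>

definition trivial :: "'i \<Rightarrow> 'i \<Rightarrow> nat \<Rightarrow> bool" where
  "trivial i j k \<longleftrightarrow> (\<forall>\<mu>\<in>lattice r. ((s i \<circ> s j) ^^ k) \<mu> = \<mu>)"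

lemma act_altw_even: "act (altw i j (2 * k)) = (s i \<circ> s j) ^^ k"
  by (induction k) (simp_all add: comp_assoc)

lemma trivial_iff: "trivial i j k \<longleftrightarrow> (\<forall>\<mu>\<in>lattice r. act (altw i j (2 * k)) \<mu> = \<mu>)"
  by (simp add: trivial_def act_altw_even)

lemma trivial_sym:
  assumes "i \<in> I" "j \<in> I" "trivial i j k"
  shows "trivial j i k"
  unfolding trivial_iff
proof
  fix \<mu> assume \<mu>: "\<mu> \<in> lattice r"
  have set: "set (altw i j (2 * k)) \<subseteq> I" using set_altw[of i j "2 * k"] assms by auto
  have "act (rev (altw i j (2 * k))) (act (altw i j (2 * k)) \<mu>) = \<mu>" by (rule act_rev[OF set])
  then show "act (altw j i (2 * k)) \<mu> = \<mu>" using assms(3) \<mu> by (simp add: rev_altw trivial_iff)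
qed

lemma is_order_iff: "is_order r \<alpha> \<alpha>' i j m \<longleftrightarrow>
    0 < m \<and> trivial i j m \<and> (\<forall>k. 0 < k \<and> k < m \<longrightarrow> \<not> trivial i j k)"
  by (simp add: is_order_def trivial_def)

lemma is_order_sym: "i \<in> I \<Longrightarrow> j \<in> I \<Longrightarrow> is_order r \<alpha> \<alpha>' i j m \<Longrightarrow> is_order r \<alpha> \<alpha>' j i m"
  unfolding is_order_iff using trivial_sym by blast

text \<open>The second hypothesis says that adding multiples of \<open>\<beta>\<close> does not
  change the shift caused by \<open>T\<close>, so the contributions of the iterates simply add
  up.\<close>

lemma act_transvection:
  assumes "\<And>\<mu>. T \<mu> = (\<lambda>k. \<mu> k + \<l> \<mu> * \<beta> k)" "\<And>c \<mu>. T (\<lambda>k. \<mu> k + c * \<beta> k) = (\<lambda>k. T \<mu> k + c * \<beta> k)"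
  shows "(T ^^ q) \<mu> = (\<lambda>k. \<mu> k + int q * \<l> \<mu> * \<beta> k)"
proof (induction q)
  case (Suc q)
  have "(T ^^ Suc q) \<mu> = T (\<lambda>k. \<mu> k + (int q * \<l> \<mu>) * \<beta> k)" using Suc by simp
  also have "\<dots> = (\<lambda>k. (\<mu> k + \<l> \<mu> * \<beta> k) + (int q * \<l> \<mu>) * \<beta> k)"
    unfolding assms(2) by (simp add: assms(1))
  finally show ?case by (simp add: algebra_simps)
qed simp

text \<open>If an alternating word shorter than the order of \<open>s\<^sub>a s\<^sub>b\<close> made the next simple root negative,
  then the product of two reflections with proportional roots would be a transvection in the finite
  dihedral group generated by \<open>s\<^sub>a\<close> and \<open>s\<^sub>b\<close>, hence trivial, which contradicts the order.\<close>

lemma pos_altw: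
  "a \<in> I \<Longrightarrow> b \<in> I \<Longrightarrow> is_order r \<alpha> \<alpha>' a b m \<Longrightarrow> k < m \<Longrightarrow> pos (act (altw a b k) (\<alpha> (letter a b k)))"
proof (induction k arbitrary: a b)
  case 0
  then show ?case by (simp add: letter_def pos_simple)
next
  case (Suc k)
  let ?x = "altw b a k" and ?t = "letter b a k"
  let ?\<delta> = "act ?x (\<alpha> ?t)"
  have x: "set ?x \<subseteq> I" and t: "?t \<in> I"
    using set_altw[of b a k] letter_in[of b a k] Suc.prems by auto
  have \<delta>: "?\<delta> \<in> \<Phi>" "pos ?\<delta>"
    using act_\<Phi>[OF x simple[OF t]] Suc.IH[of b a] is_order_sym Suc.prems by auto
  show ?case
  proof (rule ccontr)
    assume "\<not> ?thesis"
    then have "\<not> pos (s a ?\<delta>)" by (simp add: letter_Suc)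
    then have "neg (s a ?\<delta>)" using pos_or_neg[OF refl_\<Phi>[OF Suc.prems(1) \<delta>(1)]] by blast
    then obtain c where c: "c > 0" "?\<delta> = (\<lambda>k. c * \<alpha> a k)"
      using flip_simple[OF \<delta> Suc.prems(1)] by blast
    \<comment> \<open>By the palindrome \<open>T\<close> is the product of \<open>s a\<close> and
      the reflection in the root \<open>?\<delta>\<close>; it is also the power \<open>Suc k\<close>
      of the product of \<open>s a\<close> and \<open>s b\<close>.\<close>
    define T where "T = act (altw a b (2 * Suc k))"
    have "altw a b (2 * Suc k) = a # ?x @ ?t # rev ?x"
      unfolding altw_palindrome by simp
    then have T: "T \<mu> = s a (act ?x (s ?t (act (rev ?x) \<mu>)))" for \<mu> by (simp add: T_def)
    have inner: "act ?x (s ?t (act (rev ?x) \<mu>)) =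
        (\<lambda>k. 1 * \<mu> k + (- pairing r (\<alpha>' ?t) (act (rev ?x) \<mu>) * c) * \<alpha> a k)" for \<mu>
    proof -
      have eq: "s ?t (act (rev ?x) \<mu>) = (\<lambda>k. 1 * act (rev ?x) \<mu> k +
          (- pairing r (\<alpha>' ?t) (act (rev ?x) \<mu>)) * \<alpha> ?t k)" by (simp add: refl_def)
      have "act ?x (s ?t (act (rev ?x) \<mu>)) = (\<lambda>k. 1 * act ?x (act (rev ?x) \<mu>) k +
          (- pairing r (\<alpha>' ?t) (act (rev ?x) \<mu>)) * ?\<delta> k)"
        by (subst eq) (rule act_linear)
      then show ?thesis unfolding act_rev'[OF x] by (simp only: c(2) mult.assoc)
    qed
    define l where "l \<mu> = - pairing r (\<alpha>' a) \<mu> + pairing r (\<alpha>' ?t) (act (rev ?x) \<mu>) * c" for \<mu>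
    have T1: "T \<mu> = (\<lambda>k. \<mu> k + l \<mu> * \<alpha> a k)" for \<mu>
      unfolding T inner s_linear s_simple[OF Suc.prems(1)] by (simp add: refl_def l_def algebra_simps)
    have "act (rev ?x) ?\<delta> = \<alpha> ?t" by (rule act_rev[OF x])
    then have "(\<lambda>k. c * act (rev ?x) (\<alpha> a) k) = \<alpha> ?t" unfolding c(2) act_scale .
    then have "pairing r (\<alpha>' ?t) (\<lambda>k. c * act (rev ?x) (\<alpha> a) k) = 2" using pairing_2[OF t] by simp
    then have "c * pairing r (\<alpha>' ?t) (act (rev ?x) (\<alpha> a)) = 2"
      using pairing_linear[of r "\<alpha>' ?t" c "act (rev ?x) (\<alpha> a)" 0 "\<alpha> a"] by simp
    \<comment> \<open>Both reflections send \<open>\<alpha> a\<close> to its negative, so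
      \<open>T\<close> fixes it: the two pairings contribute -2 and 2.\<close>
    then have l0: "l (\<alpha> a) = 0" using pairing_2[OF Suc.prems(1)] by (simp add: l_def mult.commute)
    have T2: "T (\<lambda>k. \<mu> k + d * \<alpha> a k) = (\<lambda>k. T \<mu> k + d * \<alpha> a k)" for d \<mu>
    proof -
      have "T (\<lambda>k. 1 * \<mu> k + d * \<alpha> a k) = (\<lambda>k. 1 * T \<mu> k + d * T (\<alpha> a) k)"
        unfolding T_def by (rule act_linear)
      then show ?thesis using T1[of "\<alpha> a"] l0 by simp
    qed
    have Tm: "(T ^^ m) \<mu> = \<mu>" if "\<mu> \<in> lattice r" for \<mu>
    proof -
      have "((s a \<circ> s b) ^^ m) \<mu> = \<mu>" using Suc.prems(3) that by (simp add: is_order_iff trivial_def)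
      then have "(((s a \<circ> s b) ^^ m) ^^ j) \<mu> = \<mu>" for j by (induction j) simp_all
      then have "(((s a \<circ> s b) ^^ m) ^^ Suc k) \<mu> = \<mu>" .
      then show ?thesis unfolding T_def act_altw_even
        by (simp only: funpow_mult mult.commute)
    qed
    \<comment> \<open>The power \<open>m\<close> of \<open>T\<close> is the identity on the lattice,
      while as the iterate of a transvection it adds \<open>m\<close> times \<open>l \<mu>\<close>
      times the root; hence \<open>l\<close> vanishes.\<close>
    have "T \<mu> = \<mu>" if "\<mu> \<in> lattice r" for \<mu>
    proof -
      have eq: "(\<lambda>k. \<mu> k + int m * l \<mu> * \<alpha> a k) = \<mu>"
        using Tm[OF that] act_transvection[of T l "\<alpha> a" m \<mu>, OF T1 T2] by simp
      have "int m * l \<mu> * \<alpha> a k = 0" for k using fun_cong[OF eq, of k] by simp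
      moreover obtain k where "\<alpha> a k \<noteq> 0" using \<Phi>_nonzero[OF simple[OF Suc.prems(1)]] by auto
      moreover have "m > 0" using Suc.prems(4) by simp
      ultimately have "l \<mu> = 0" by (metis mult_eq_0_iff of_nat_0_eq_iff less_irrefl)
      then show ?thesis using T1[of \<mu>] by simp
    qed
    then have "trivial a b (Suc k)" unfolding trivial_iff T_def by blast
    then show False using Suc.prems(3,4) by (simp add: is_order_iff)
  qed
qed

text \<open>The reversed word applies \<open>c\<close> first and turns \<open>\<alpha> c\<close>
  into its negative; the remaining letters alternate and keep \<open>\<alpha> c\<close> positive by
  \<open>pos_altw\<close>.\<close>

lemma neg_rev_altw:
  assumes "c \<in> I" "d \<in> I" "is_order r \<alpha> \<alpha>' c d m" "q < m"
  shows "neg (act (rev (altw c d (Suc q))) (\<alpha> c))"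
proof -
  have "pos (act (rev (altw d c q)) (\<alpha> c))"
  proof (cases "even q")
    case True
    then show ?thesis using pos_altw[OF assms] by (simp add: rev_altw letter_def)
  next
    case False
    then show ?thesis using pos_altw[OF assms(2,1) is_order_sym[OF assms(1-3)] assms(4)]
      by (simp add: rev_altw letter_def)
  qed
  moreover have "act (rev (altw c d (Suc q))) (\<alpha> c) = (\<lambda>k. - act (rev (altw d c q)) (\<alpha> c) k)"
    using act_scale[of "rev (altw d c q)" "-1" "\<alpha> c"] by (simp add: s_simple[OF assms(1)])
  ultimately show ?thesis by (simp add: neg_def)
qed

text \<open>The roots \<open>\<beta> k\<close>, simple roots pushed forward by the prefixes of the
  word, are the classical inversions of the inverse element. They are positive by
  \<open>pos_altw\<close>, lie on \<open>m\<close> different rays and become negative under the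
  inverse of every word for the same element, so \<open>card_inversions\<close> bounds its
  length.\<close>

lemma reduced_altw:
  assumes a: "a \<in> I" and b: "b \<in> I" and m: "is_order r \<alpha> \<alpha>' a b m"
  shows "reduced_word r I \<alpha> \<alpha>' (altw a b m)"
  unfolding reduced_word_def
proof (intro conjI allI impI)
  have set: "set (altw x y k) \<subseteq> I" if "x \<in> I" "y \<in> I" for x y k using set_altw[of x y k] that by auto
  show "set (altw a b m) \<subseteq> I" by (rule set[OF a b])
  fix w' assume "set w' \<subseteq> I \<and> same_element r \<alpha> \<alpha>' (altw a b m) w'"
  then have w': "set w' \<subseteq> I" and same: "same_element r \<alpha> \<alpha>' (altw a b m) w'" by simp_all
  define \<beta> where "\<beta> k = act (altw a b k) (\<alpha> (letter a b k))" for k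
  have let_in: "letter x y k \<in> I" if "x \<in> I" "y \<in> I" for x y k using letter_in[of x y k] that by auto
  have \<beta>_root: "\<beta> k \<in> \<Phi>" for k
    unfolding \<beta>_def by (intro act_\<Phi> set simple let_in a b)
  have split: "is_order r \<alpha> \<alpha>' (letter a b k) (letter b a k) m" for k
    using m is_order_sym[OF a b m] by (simp add: letter_def)
  have \<beta>_neg: "neg (act (rev (altw a b m)) (\<beta> k))" if k: "k < m" for k
  proof -
    obtain q where q: "m = k + Suc q" using k by (metis add_Suc_right less_iff_Suc_add)
    have "act (rev (altw a b m)) (\<beta> k) =
        act (rev (altw (letter a b k) (letter b a k) (Suc q))) (act (rev (altw a b k)) (\<beta> k))"
      unfolding q altw_append by simp
    also have "act (rev (altw a b k)) (\<beta> k) = \<alpha> (letter a b k)"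
      unfolding \<beta>_def by (rule act_rev[OF set[OF a b]])
    finally show ?thesis using neg_rev_altw[OF let_in[OF a b] let_in[OF b a] split, of q] q by simp
  qed
  \<comment> \<open>Removing the common prefix of length \<open>k\<close> leaves
    \<open>\<alpha> ?c\<close> proportional to \<open>s ?c ?y\<close> with \<open>?y\<close>
    positive; applying \<open>s ?c\<close> gives a vanishing combination of two positive elements
    with positive coefficients.\<close>
  have no_prop: "\<not> proportional (\<beta> k) (\<beta> l)" if kl: "k < l" "l < m" for k l
  proof
    assume "proportional (\<beta> k) (\<beta> l)"
    then obtain p q where pq: "p > 0" "q > 0" "\<And>j. p * \<beta> k j = q * \<beta> l j" unfolding proportional_def by blast
    let ?c = "letter a b k" and ?d = "letter b a k"
    have c: "?c \<in> I" and d: "?d \<in> I" by (intro let_in a b)+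
    obtain u where u: "l = k + Suc u" using kl(1) by (metis add_Suc_right less_iff_Suc_add)
    have "act (rev (altw a b k)) (\<beta> l) = act (altw ?c ?d (Suc u)) (\<alpha> (letter a b l))"
      unfolding \<beta>_def u altw_append foldr_append o_apply by (rule act_rev[OF set[OF a b]])
    moreover have "letter a b l = letter ?d ?c u" by (auto simp: u letter_def)
    ultimately have l: "act (rev (altw a b k)) (\<beta> l) = s ?c (act (altw ?d ?c u) (\<alpha> (letter ?d ?c u)))"
      by simp
    have k: "act (rev (altw a b k)) (\<beta> k) = \<alpha> ?c"
      unfolding \<beta>_def by (rule act_rev[OF set[OF a b]])
    let ?y = "act (altw ?d ?c u) (\<alpha> (letter ?d ?c u))"
    have "(\<lambda>j. p * \<beta> k j) = (\<lambda>j. q * \<beta> l j)" using pq(3) by blast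
    then have "act (rev (altw a b k)) (\<lambda>j. p * \<beta> k j) = act (rev (altw a b k)) (\<lambda>j. q * \<beta> l j)" by simp
    then have "(\<lambda>j. p * \<alpha> ?c j) = (\<lambda>j. q * s ?c ?y j)" unfolding act_scale k l .
    then have "s ?c (\<lambda>j. p * \<alpha> ?c j + 0 * \<alpha> ?c j) = s ?c (\<lambda>j. q * s ?c ?y j + 0 * \<alpha> ?c j)" by simp
    then have "(\<lambda>j. - (p * \<alpha> ?c j)) = (\<lambda>j. q * ?y j)"
      unfolding s_linear s_invol[OF c] s_simple[OF c] by simp
    then have "p * \<alpha> ?c j + q * ?y j = 0" for j by (metis add.right_inverse)
    moreover have "pos ?y"
      using pos_altw[OF d c is_order_sym[OF c d split]] u kl(2) by simp
    ultimately have "\<alpha> ?c = (\<lambda>_. 0)" using pos_add_eq_0[OF pos_simple[OF c] _ pq(1,2)] by blast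
    then show False using \<Phi>_nonzero[OF simple[OF c]] by blast
  qed
  have prop_sym: "proportional \<delta> \<epsilon> \<Longrightarrow> proportional \<epsilon> \<delta>" for \<delta> \<epsilon> unfolding proportional_def by metis
  have prop_eq: "k = l" if "k < m" "l < m" "proportional (\<beta> k) (\<beta> l)" for k l
    using no_prop[of k l] no_prop[of l k] that prop_sym by (metis linorder_neqE_nat)
  have prop_refl: "proportional \<delta> \<delta>" for \<delta> unfolding proportional_def by (intro exI[of _ "1::int"] conjI allI) simp_all
  have "inj_on \<beta> {..<m}" using prop_eq prop_refl by (intro inj_onI) (metis lessThan_iff)
  then have card: "card (\<beta> ` {..<m}) = m" by (simp add: card_image)
  have inv: "act (rev w') \<mu> = act (rev (altw a b m)) \<mu>" if \<mu>: "\<mu> \<in> lattice r" for \<mu>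
  proof -
    let ?\<nu> = "act (rev (altw a b m)) \<mu>"
    have "?\<nu> \<in> lattice r" using set[OF a b] \<mu> by (intro act_lattice) simp_all
    then have "act w' ?\<nu> = act (altw a b m) ?\<nu>" using same by (simp add: same_element_def)
    also have "\<dots> = \<mu>" by (rule act_rev'[OF set[OF a b]])
    finally show ?thesis using act_rev[OF w', of ?\<nu>] by simp
  qed
  have "card (\<beta> ` {..<m}) \<le> length (rev w')"
  proof (rule card_inversions)
    show "\<beta> ` {..<m} \<subseteq> \<Phi>" using \<beta>_root by blast
    show "pos \<delta>" if "\<delta> \<in> \<beta> ` {..<m}" for \<delta>
      using that pos_altw[OF a b m] unfolding \<beta>_def by blast
    show "\<delta> = \<epsilon>" if "\<delta> \<in> \<beta> ` {..<m}" "\<epsilon> \<in> \<beta> ` {..<m}" "proportional \<delta> \<epsilon>" for \<delta> \<epsilon>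
      using that prop_eq by auto
    show "neg (act (rev w') \<delta>)" if "\<delta> \<in> \<beta> ` {..<m}" for \<delta>
      using that \<beta>_neg inv[OF \<Phi>_lattice[OF \<beta>_root]] by auto
  qed (use w' in simp_all)
  then show "length (altw a b m) \<le> length w'" using card by simp
qed

text \<open>The word of length \<open>2 * m\<close> is trivial and consists of one alternating word
  followed by the reverse, that is the inverse, of the other.\<close>

lemma same_element_altw:
  assumes a: "a \<in> I" and b: "b \<in> I" and m: "is_order r \<alpha> \<alpha>' a b m"
  shows "same_element r \<alpha> \<alpha>' (altw a b m) (altw b a m)"
  unfolding same_element_def
proof
  fix \<mu> assume \<mu>: "\<mu> \<in> lattice r"
  have set: "set (altw b a m) \<subseteq> I" using set_altw[of b a m] a b by auto
  let ?\<nu> = "act (altw b a m) \<mu>"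
  have "altw a b (2 * m) = altw a b m @ rev (altw b a m)"
    using altw_append[of a b m m] by (simp add: rev_altw letter_def mult_2)
  then have "act (altw a b (2 * m)) ?\<nu> = act (altw a b m) (act (rev (altw b a m)) ?\<nu>)" by simp
  also have "\<dots> = act (altw a b m) \<mu>" by (simp only: act_rev[OF set])
  finally show "act (altw a b m) \<mu> = act (altw b a m) \<mu>"
    using m act_lattice[OF set \<mu>] by (simp add: is_order_iff trivial_iff)
qed

end

section \<open>The root datum of a reductive group\<close>

lemma matrix_inv_both:
  assumes "invertible (A :: 'a::semiring_1^'n^'n)"
  shows "A ** matrix_inv A = mat 1" "matrix_inv A ** A = mat 1"
proof -
  have "\<exists>A'. A ** A' = mat 1 \<and> A' ** A = mat 1" using assms unfolding invertible_def .
  from someI_ex[OF this] show "A ** matrix_inv A = mat 1" "matrix_inv A ** A = mat 1"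
    unfolding matrix_inv_def by blast+
qed

lemma conj_eq_iff:
  fixes T :: "'a::semiring_1^'n^'n"
  assumes "invertible T"
  shows "T ** M ** matrix_inv T = N \<longleftrightarrow> T ** M = N ** T"
proof
  assume "T ** M ** matrix_inv T = N"
  then have "N ** T = T ** M ** (matrix_inv T ** T)" by (simp only: matrix_mul_assoc)
  then show "T ** M = N ** T" by (simp add: matrix_inv_both(2)[OF assms])
next
  assume "T ** M = N ** T"
  then have "T ** M ** matrix_inv T = N ** (T ** matrix_inv T)" by (simp only: matrix_mul_assoc)
  then show "T ** M ** matrix_inv T = N" by (simp add: matrix_inv_both(1)[OF assms])
qed

lemma mat_mult_left: "(mat c ** A) $ i $ j = c * (A :: 'a::comm_semiring_1^'n^'n) $ i $ j"
proof -
  have "(mat c ** A) $ i $ j = (\<Sum>k\<in>UNIV. if i = k then c * A $ i $ j else 0)"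
    unfolding matrix_matrix_mult_def mat_def vec_lambda_beta by (rule sum.cong) auto
  then show ?thesis by simp
qed

lemma mat_mult_right: "(A ** mat c) $ i $ j = c * (A :: 'a::comm_semiring_1^'n^'n) $ i $ j"
proof -
  have "(A ** mat c) $ i $ j = (\<Sum>k\<in>UNIV. if k = j then c * A $ i $ j else 0)"
    unfolding matrix_matrix_mult_def mat_def vec_lambda_beta by (rule sum.cong) (auto simp: mult.commute)
  then show ?thesis by simp
qed

lemma mat_commute: "A ** mat c = mat c ** (A :: 'a::comm_semiring_1^'n^'n)"
  by (simp add: vec_eq_iff mat_mult_left mat_mult_right)

lemma matrix_mult_add_left: "(A + B) ** C = A ** C + B ** (C :: 'a::semiring_1^'n^'m)"
  by (simp add: matrix_matrix_mult_def vec_eq_iff sum.distrib distrib_right)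

lemma mat2_mult: "mat2 a b c d ** mat2 a' b' c' d' =
    mat2 (a * a' + b * c') (a * b' + b * d') (c * a' + d * c') (c * b' + d * d')"
  by (simp add: mat2_def matrix_matrix_mult_def vec_eq_iff forall_2 sum_2)

lemma det_mat2: "det (mat2 a b c d) = a * d - b * c"
  by (simp add: mat2_def det_2)

lemma cochr_torus: "s \<noteq> 0 \<Longrightarrow> cochr r v s \<in> torus r"
  by (simp add: cochr_def torus_def)

lemma tmult_torus: "x \<in> torus r \<Longrightarrow> y \<in> torus r \<Longrightarrow> tmult x y \<in> torus r"
  by (simp add: tmult_def torus_def)

lemma chr_nonzero: "x \<in> torus r \<Longrightarrow> chr r \<mu> x \<noteq> 0"
  by (simp add: chr_def torus_def)

lemma chr_tmult: "chr r \<mu> (tmult x y) = chr r \<mu> x * chr r \<mu> y"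
  by (simp add: chr_def tmult_def power_int_mult_distrib prod.distrib)

lemma power_int_sum:
  assumes "(s :: 'a::field) \<noteq> 0"
  shows "(\<Prod>i\<in>A. s powi f i) = s powi (\<Sum>i\<in>A. f i)"
  by (induction A rule: infinite_finite_induct) (simp_all add: power_int_add assms)

lemma chr_cochr: "(s :: 'k::field) \<noteq> 0 \<Longrightarrow> chr r \<mu> (cochr r v s) = s powi pairing r v \<mu>"
  by (simp add: chr_def cochr_def pairing_def power_int_mult[symmetric] power_int_sum)

lemma chr_combination:
  assumes "x \<in> torus r"
  shows "chr r (\<lambda>k. \<mu> k - p * \<beta> k) x = chr r \<mu> x * chr r \<beta> x powi (- p)"
proof -
  have "x i powi (\<mu> i - p * \<beta> i) = x i powi \<mu> i * (x i powi \<beta> i) powi (- p)" if "i < r" for i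
  proof -
    have "x i powi (\<mu> i + \<beta> i * (- p)) = x i powi \<mu> i * x i powi (\<beta> i * (- p))"
      by (rule power_int_add) (use assms that in \<open>simp add: torus_def\<close>)
    also have "x i powi (\<beta> i * (- p)) = (x i powi \<beta> i) powi (- p)" by (rule power_int_mult)
    finally show ?thesis by (simp add: mult.commute)
  qed
  then have "chr r (\<lambda>k. \<mu> k - p * \<beta> k) x = chr r \<mu> x * (\<Prod>i<r. (x i powi \<beta> i) powi (- p))"
    unfolding chr_def prod.distrib[symmetric] by (intro prod.cong) simp_all
  moreover have "(\<Prod>i\<in>S. (x i powi \<beta> i) powi (- p)) = (\<Prod>i\<in>S. x i powi \<beta> i) powi (- p)" for S
    by (induction S rule: infinite_finite_induct) (simp_all add: power_int_mult_distrib)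
  ultimately show ?thesis by (simp add: chr_def)
qed

section \<open>Coroots from homomorphisms of SL2\<close>

lemma is_corootE:
  fixes G :: "(complex^'n^'n) set"
  assumes "is_coroot G r \<tau> \<beta> \<beta>'"
  obtains \<phi> :: "complex^2^2 \<Rightarrow> complex^'n^'n" where
    "\<And>A. det A = 1 \<Longrightarrow> \<phi> A \<in> G"
    "\<And>A B. det A = 1 \<Longrightarrow> det B = 1 \<Longrightarrow> \<phi> (A ** B) = \<phi> A ** \<phi> B"
    "\<And>s. s \<noteq> 0 \<Longrightarrow> \<phi> (mat2 s 0 0 (inverse s)) = \<tau> (cochr r \<beta>' s)"
    "inj (\<lambda>a. \<phi> (mat2 1 a 0 1))"
    "\<And>x a. x \<in> torus r \<Longrightarrow>
      \<tau> x ** \<phi> (mat2 1 a 0 1) ** matrix_inv (\<tau> x) = \<phi> (mat2 1 (chr r \<beta> x * a) 0 1)"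
    "\<And>x a. x \<in> torus r \<Longrightarrow>
      \<tau> x ** \<phi> (mat2 1 0 a 1) ** matrix_inv (\<tau> x) = \<phi> (mat2 1 0 (inverse (chr r \<beta> x) * a) 1)"
proof -
  from assms obtain \<phi> :: "complex^2^2 \<Rightarrow> complex^'n^'n" where \<phi>:
    "\<forall>A. det A = 1 \<longrightarrow> \<phi> A \<in> G"
    "\<forall>A B. det A = 1 \<and> det B = 1 \<longrightarrow> \<phi> (A ** B) = \<phi> A ** \<phi> B"
    "\<forall>s. s \<noteq> 0 \<longrightarrow> \<phi> (mat2 s 0 0 (inverse s)) = \<tau> (cochr r \<beta>' s)"
    "inj (\<lambda>a. \<phi> (mat2 1 a 0 1))"
    "\<forall>x\<in>torus r. \<forall>a.
       \<tau> x ** \<phi> (mat2 1 a 0 1) ** matrix_inv (\<tau> x) = \<phi> (mat2 1 (chr r \<beta> x * a) 0 1) \<and>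
       \<tau> x ** \<phi> (mat2 1 0 a 1) ** matrix_inv (\<tau> x) = \<phi> (mat2 1 0 (inverse (chr r \<beta> x) * a) 1)"
    unfolding is_coroot_def by (elim conjE exE) (rule that)
  show thesis
    by (rule that[of \<phi>]) (simp_all add: \<phi>)
qed

text \<open>Conjugating the unipotent element with parameter 1 by the image of the diagonal matrix
  with entries 2 and 1/2 gives the parameter 4 by a computation in SL2, and 2 to the power of the
  pairing by the action of the torus. The parametrization is injective, so the two agree.\<close>

lemma coroot_pairing:
  assumes coroot: "is_coroot G r \<tau> \<beta> \<beta>'" and inv: "\<And>x. x \<in> torus r \<Longrightarrow> invertible (\<tau> x)"
  shows "pairing r \<beta>' \<beta> = 2"
proof -
  obtain \<phi> :: "complex^2^2 \<Rightarrow> complex^'a^'a" where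
    mult: "\<And>A B. det A = 1 \<Longrightarrow> det B = 1 \<Longrightarrow> \<phi> (A ** B) = \<phi> A ** \<phi> B"
    and diag: "\<And>s. s \<noteq> 0 \<Longrightarrow> \<phi> (mat2 s 0 0 (inverse s)) = \<tau> (cochr r \<beta>' s)"
    and inj: "inj (\<lambda>a. \<phi> (mat2 1 a 0 1))"
    and act: "\<And>x a. x \<in> torus r \<Longrightarrow>
      \<tau> x ** \<phi> (mat2 1 a 0 1) ** matrix_inv (\<tau> x) = \<phi> (mat2 1 (chr r \<beta> x * a) 0 1)"
    by (rule is_corootE[OF coroot]) (rule that)
  let ?x = "cochr r \<beta>' (2 :: complex)" and ?p = "pairing r \<beta>' \<beta>"
  have x: "?x \<in> torus r" by (rule cochr_torus) simp
  have D: "\<phi> (mat2 2 0 0 (inverse 2)) = \<tau> ?x" by (rule diag) simp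
  have chr: "chr r \<beta> ?x = 2 powi ?p" by (rule chr_cochr) simp
  have "\<tau> ?x ** \<phi> (mat2 1 1 0 1) = \<phi> (mat2 1 (2 powi ?p) 0 1) ** \<tau> ?x"
    using act[OF x, of 1] by (simp add: conj_eq_iff[OF inv[OF x]] chr)
  moreover have "\<tau> ?x ** \<phi> (mat2 1 1 0 1) = \<phi> (mat2 1 4 0 1) ** \<tau> ?x"
    unfolding D[symmetric] by (subst (1 2) mult[symmetric]) (simp_all add: det_mat2 mat2_mult)
  ultimately have eq: "\<phi> (mat2 1 (2 powi ?p) 0 1) ** \<tau> ?x = \<phi> (mat2 1 4 0 1) ** \<tau> ?x" by simp
  have "\<phi> (mat2 1 (2 powi ?p) 0 1) = \<phi> (mat2 1 4 0 1)"
  proof -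
    have "\<phi> (mat2 1 (2 powi ?p) 0 1) ** (\<tau> ?x ** matrix_inv (\<tau> ?x)) =
        \<phi> (mat2 1 4 0 1) ** (\<tau> ?x ** matrix_inv (\<tau> ?x))"
      unfolding matrix_mul_assoc eq ..
    then show ?thesis by (simp add: matrix_inv_both(1)[OF inv[OF x]])
  qed
  then have "(2 :: complex) powi ?p = 4" using inj by (auto dest: injD)
  then have "cmod (2 powi ?p) = 4" by simp
  then have p: "(2 :: real) powi ?p = 2 powi 2" by (simp add: norm_power_int)
  show ?thesis
  proof (rule ccontr)
    assume "?p \<noteq> 2"
    then have "?p < 2 \<or> 2 < ?p" by linarith
    then show False
      using power_int_strict_increasing[of ?p 2 "2 :: real"] power_int_strict_increasing[of 2 ?p "2 :: real"] p
      by auto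
  qed
qed

text \<open>Conjugation by \<open>N\<close> preserves \<open>G\<close>, so composing an equation of
  \<open>G\<close> with it gives an equation of \<open>G\<close> again, whose derivative at the
  identity vanishes in the direction \<open>M\<close>.\<close>

lemma lie_algebra_conj:
  assumes N: "N \<in> G" "invertible N" and G: "\<And>A. A \<in> G \<Longrightarrow> N ** A ** matrix_inv N \<in> G"
    and M: "M \<in> lie_algebra G"
  shows "N ** M ** matrix_inv N \<in> lie_algebra G"
  unfolding lie_algebra_def
proof (intro CollectI allI impI)
  fix p :: "('a \<times> 'a, complex) pol"
  assume p: "\<forall>A\<in>G. peval id p (entries A) = 0"
  let ?N = "matrix_inv N"
  \<comment> \<open>Entry \<open>(i, j)\<close> of the conjugate, as a linear polynomial in the
    entries of the matrix.\<close>
  define c where "c = (\<lambda>(i, j). \<Sum>k\<in>UNIV. (\<Sum>l\<in>UNIV. pconst (N $ i $ l) * pvar (l, k)) * pconst (?N $ k $ j)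
    :: ('a \<times> 'a, complex) pol)"
  obtain p' where p': "\<And>x. peval id p (\<lambda>v. peval id (c v) x) = peval id p' x"
    using idh.peval_subst[of p c] by blast
  have "(\<lambda>v. peval id (c v) (entries A)) = entries (N ** A ** ?N)" for A
    by (auto simp: fun_eq_iff c_def entries_def idh.peval_simps matrix_matrix_mult_def)
  with p' have conj: "peval id p' (entries A) = peval id p (entries (N ** A ** ?N))" for A by metis
  have "\<forall>A\<in>G. peval id p' (entries A) = 0" using p G by (simp add: conj)
  then have "((\<lambda>s. peval id p' (entries (mat 1 + mat s ** M))) has_field_derivative 0) (at 0)"
    using M unfolding lie_algebra_def by blast
  moreover have "N ** (mat 1 + mat s ** M) ** ?N = mat 1 + mat s ** (N ** M ** ?N)" for s
  proof -
    have "N ** (mat 1 + mat s ** M) ** ?N = N ** ?N + N ** mat s ** M ** ?N"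
      by (simp add: matrix_add_ldistrib matrix_mult_add_left matrix_mul_assoc)
    also have "N ** mat s ** M ** ?N = mat s ** (N ** M ** ?N)"
      by (simp add: mat_commute matrix_mul_assoc)
    finally show ?thesis by (simp add: matrix_inv_both(1)[OF N(2)])
  qed
  ultimately show "((\<lambda>s. peval id p (entries (mat 1 + mat s ** (N ** M ** ?N)))) has_field_derivative 0) (at 0)"
    unfolding conj by simp
qed

text \<open>The image of the Weyl element of \<open>SL\<^sub>2\<close> normalizes the torus and induces the reflection on it;
  it is a product of unipotents, on which the torus acts through the root and its inverse.\<close>

lemma is_root_refl:
  fixes G :: "(complex^'n^'n) set"
  assumes coroot: "is_coroot G r \<tau> \<beta> \<beta>'" and inv: "\<And>x. x \<in> torus r \<Longrightarrow> invertible (\<tau> x)"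
    and hom: "\<And>x y. x \<in> torus r \<Longrightarrow> y \<in> torus r \<Longrightarrow> \<tau> (tmult x y) = \<tau> x ** \<tau> y"
    and G: "gl_subgroup G" and \<beta>: "\<beta> \<in> lattice r" and \<mu>: "is_root G r \<tau> \<mu>"
  shows "is_root G r \<tau> (\<lambda>k. \<mu> k - pairing r \<beta>' \<mu> * \<beta> k)"
proof -
  obtain \<phi> :: "complex^2^2 \<Rightarrow> complex^'n^'n" where
    \<phi>G: "\<And>A. det A = 1 \<Longrightarrow> \<phi> A \<in> G"
    and mult: "\<And>A B. det A = 1 \<Longrightarrow> det B = 1 \<Longrightarrow> \<phi> (A ** B) = \<phi> A ** \<phi> B"
    and diag: "\<And>s. s \<noteq> 0 \<Longrightarrow> \<phi> (mat2 s 0 0 (inverse s)) = \<tau> (cochr r \<beta>' s)"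
    and up: "\<And>x a. x \<in> torus r \<Longrightarrow>
      \<tau> x ** \<phi> (mat2 1 a 0 1) ** matrix_inv (\<tau> x) = \<phi> (mat2 1 (chr r \<beta> x * a) 0 1)"
    and low: "\<And>x a. x \<in> torus r \<Longrightarrow>
      \<tau> x ** \<phi> (mat2 1 0 a 1) ** matrix_inv (\<tau> x) = \<phi> (mat2 1 0 (inverse (chr r \<beta> x) * a) 1)"
    by (rule is_corootE[OF coroot]) (rule that)
  define N where "N = \<phi> (mat2 0 1 (-1) 0)"
  let ?N = "matrix_inv N"
  have NG: "N \<in> G" unfolding N_def by (rule \<phi>G) (simp add: det_mat2)
  have N_inv: "invertible N" "?N \<in> G" using G NG unfolding gl_subgroup_def by blast+
  note NN = matrix_inv_both[OF N_inv(1)]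
  \<comment> \<open>The factorization of antidiagonal matrices into three unitriangular ones;
    \<open>b = 1\<close> gives \<open>N\<close>.\<close>
  have bruhat: "\<phi> (mat2 0 b (- inverse b) 0) =
      \<phi> (mat2 1 b 0 1) ** \<phi> (mat2 1 0 (- inverse b) 1) ** \<phi> (mat2 1 b 0 1)" if "b \<noteq> 0" for b
  proof -
    have "mat2 0 b (- inverse b) 0 = mat2 1 b 0 1 ** mat2 1 0 (- inverse b) 1 ** mat2 1 b 0 1"
      using that by (simp add: mat2_mult)
    moreover have "det (mat2 1 b 0 1 ** mat2 1 0 (- inverse b) 1) = 1"
      by (simp add: mat2_mult det_mat2)
    ultimately show ?thesis by (simp add: mult det_mat2)
  qed
  \<comment> \<open>Moving the torus element through the three factors rescales 1 to
    \<open>chr r \<beta> x\<close>; comparison with \<open>N\<close> leaves a value of the coroot,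
    so conjugation by \<open>N\<close> induces the reflection on the torus.\<close>
  have \<tau>N: "\<tau> x ** N = N ** \<tau> (tmult (cochr r \<beta>' (inverse (chr r \<beta> x))) x)" if x: "x \<in> torus r" for x
  proof -
    let ?b = "chr r \<beta> x"
    have b: "?b \<noteq> 0" by (rule chr_nonzero[OF x])
    note iff = conj_eq_iff[OF inv[OF x]]
    have u: "\<tau> x ** \<phi> (mat2 1 1 0 1) = \<phi> (mat2 1 ?b 0 1) ** \<tau> x"
      using up[OF x, of 1] by (simp add: iff)
    have l: "\<tau> x ** \<phi> (mat2 1 0 (-1) 1) = \<phi> (mat2 1 0 (- inverse ?b) 1) ** \<tau> x"
      using low[OF x, of "-1"] by (simp add: iff)
    have "\<tau> x ** N = \<tau> x ** \<phi> (mat2 1 1 0 1) ** \<phi> (mat2 1 0 (-1) 1) ** \<phi> (mat2 1 1 0 1)"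
      unfolding N_def using bruhat[of 1] by (simp add: matrix_mul_assoc)
    also have "\<dots> = \<phi> (mat2 1 ?b 0 1) ** (\<tau> x ** \<phi> (mat2 1 0 (-1) 1)) ** \<phi> (mat2 1 1 0 1)"
      unfolding u by (simp only: matrix_mul_assoc)
    also have "\<dots> = \<phi> (mat2 1 ?b 0 1) ** \<phi> (mat2 1 0 (- inverse ?b) 1) ** (\<tau> x ** \<phi> (mat2 1 1 0 1))"
      unfolding l by (simp only: matrix_mul_assoc)
    also have "\<dots> = \<phi> (mat2 0 ?b (- inverse ?b) 0) ** \<tau> x"
      unfolding u bruhat[OF b] by (simp only: matrix_mul_assoc)
    also have "mat2 0 ?b (- inverse ?b) 0 = mat2 0 1 (-1) 0 ** mat2 (inverse ?b) 0 0 (inverse (inverse ?b))"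
      by (simp add: mat2_mult)
    also have "\<phi> \<dots> = \<phi> (mat2 0 1 (-1) 0) ** \<phi> (mat2 (inverse ?b) 0 0 (inverse (inverse ?b)))"
      by (rule mult) (use b in \<open>simp_all add: det_mat2\<close>)
    also have "\<phi> (mat2 (inverse ?b) 0 0 (inverse (inverse ?b))) = \<tau> (cochr r \<beta>' (inverse ?b))"
      by (rule diag) (use b in simp)
    also note N_def[symmetric]
    finally show ?thesis using b x by (simp add: hom cochr_torus matrix_mul_assoc)
  qed
  obtain M where M: "M \<in> lie_algebra G" "M \<noteq> 0"
    and Mx: "\<And>x. x \<in> torus r \<Longrightarrow> \<tau> x ** M ** matrix_inv (\<tau> x) = mat (chr r \<mu> x) ** M"
    using \<mu> unfolding is_root_def by blast
  let ?M = "N ** M ** ?N" and ?\<mu> = "\<lambda>k. \<mu> k - pairing r \<beta>' \<mu> * \<beta> k"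
  have "?M \<in> lie_algebra G"
    by (rule lie_algebra_conj[OF NG N_inv(1) _ M(1)]) (use G NG N_inv in \<open>auto simp: gl_subgroup_def\<close>)
  moreover have "?M \<noteq> 0"
  proof
    assume "?M = 0"
    then have "?N ** ?M ** N = 0" by simp
    moreover have "?N ** ?M ** N = (?N ** N) ** M ** (?N ** N)" by (simp only: matrix_mul_assoc)
    ultimately show False using M(2) by (simp add: NN)
  qed
  moreover have "\<tau> x ** ?M ** matrix_inv (\<tau> x) = mat (chr r ?\<mu> x) ** ?M" if x: "x \<in> torus r" for x
    unfolding conj_eq_iff[OF inv[OF x]]
  proof -
    let ?b = "chr r \<beta> x"
    let ?y = "tmult (cochr r \<beta>' (inverse ?b)) x"
    have b: "?b \<noteq> 0" by (rule chr_nonzero[OF x])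
    have y: "?y \<in> torus r" using b x by (intro tmult_torus cochr_torus) simp_all
    have "chr r \<mu> ?y = inverse ?b powi pairing r \<beta>' \<mu> * chr r \<mu> x"
      unfolding chr_tmult using b by (simp add: chr_cochr)
    also have "\<dots> = chr r ?\<mu> x"
      unfolding chr_combination[OF x] by (simp add: power_int_minus power_int_inverse)
    finally have c: "chr r \<mu> ?y = chr r ?\<mu> x" .
    have yM: "\<tau> ?y ** M = mat (chr r ?\<mu> x) ** M ** \<tau> ?y"
      using Mx[OF y] unfolding conj_eq_iff[OF inv[OF y]] c .
    have "\<tau> ?y ** ?N = (?N ** N) ** \<tau> ?y ** ?N" by (simp add: NN)
    also have "\<dots> = ?N ** (N ** \<tau> ?y) ** ?N" by (simp only: matrix_mul_assoc)
    also have "\<dots> = ?N ** \<tau> x ** (N ** ?N)" unfolding \<tau>N[OF x, symmetric] by (simp only: matrix_mul_assoc)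
    finally have yN: "\<tau> ?y ** ?N = ?N ** \<tau> x" by (simp add: NN)
    have "\<tau> x ** ?M = (\<tau> x ** N) ** M ** ?N" by (simp only: matrix_mul_assoc)
    also have "\<dots> = N ** (\<tau> ?y ** M) ** ?N" unfolding \<tau>N[OF x] by (simp only: matrix_mul_assoc)
    also have "\<dots> = (N ** mat (chr r ?\<mu> x)) ** M ** (\<tau> ?y ** ?N)" unfolding yM by (simp only: matrix_mul_assoc)
    also have "\<dots> = mat (chr r ?\<mu> x) ** ?M ** \<tau> x" unfolding yN mat_commute by (simp only: matrix_mul_assoc)
    finally show "\<tau> x ** ?M = mat (chr r ?\<mu> x) ** ?M ** \<tau> x" .
  qed
  moreover have "?\<mu> \<in> lattice r" using \<mu> \<beta> by (simp add: is_root_def lattice_def)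
  moreover have "?\<mu> \<noteq> (\<lambda>_. 0)"
  proof
    assume 0: "?\<mu> = (\<lambda>_. 0)"
    let ?p = "pairing r \<beta>' \<mu>"
    \<comment> \<open>Then \<open>\<mu>\<close> is \<open>?p\<close> times \<open>\<beta>\<close>,
      and pairing with the coroot gives \<open>?p = 2 * ?p\<close>, so \<open>\<mu>\<close> is
      zero.\<close>
    have eq: "\<mu> = (\<lambda>k. ?p * \<beta> k + 0 * \<beta> k)" using fun_cong[OF 0] by (simp add: fun_eq_iff)
    have "?p = ?p * 2 + 0 * 2"
      by (subst (1) eq, subst pairing_linear) (simp only: coroot_pairing[OF coroot inv])
    then have "\<mu> = (\<lambda>_. 0)" using eq by simp
    then show False using \<mu> by (simp add: is_root_def)
  qed
  ultimately show ?thesis unfolding is_root_def by blast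
qed

lemma root_data_of_group:
  fixes G :: "(complex^'n^'n) set"
  assumes "reductive_group G" "split_maximal_torus G r \<tau>" "simple_roots G r \<tau> I \<alpha>"
    and coroot: "\<And>i. i \<in> I \<Longrightarrow> is_coroot G r \<tau> (\<alpha> i) (\<alpha>' i)"
  shows "root_data r I \<alpha> \<alpha>' {\<beta>. is_root G r \<tau> \<beta>}"
proof -
  have G: "gl_subgroup G" using assms(1) by (simp add: reductive_group_def)
  have \<tau>: "\<tau> ` torus r \<subseteq> G" and hom: "\<And>x y. x \<in> torus r \<Longrightarrow> y \<in> torus r \<Longrightarrow> \<tau> (tmult x y) = \<tau> x ** \<tau> y"
    using assms(2) by (simp_all add: split_maximal_torus_def gl_torus_def)
  have inv: "invertible (\<tau> x)" if "x \<in> torus r" for x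
    using that \<tau> G unfolding gl_subgroup_def by blast
  note roots = assms(3)[unfolded simple_roots_def]
  note fin = roots[THEN conjunct1]
    and simple = roots[THEN conjunct2, THEN conjunct1, rule_format]
    and indep = roots[THEN conjunct2, THEN conjunct2, THEN conjunct1, rule_format]
    and decomp = roots[THEN conjunct2, THEN conjunct2, THEN conjunct2, rule_format]
  show ?thesis
  proof
    show "pairing r (\<alpha>' i) (\<alpha> i) = 2" if "i \<in> I" for i
      using coroot_pairing[of G r \<tau> "\<alpha> i" "\<alpha>' i"] coroot[OF that] inv by blast
    show "refl r \<alpha> \<alpha>' i \<beta> \<in> {\<beta>. is_root G r \<tau> \<beta>}" if "i \<in> I" "\<beta> \<in> {\<beta>. is_root G r \<tau> \<beta>}" for i \<beta>
    proof -
      have "\<alpha> i \<in> lattice r" using simple[OF that(1)] by (simp add: is_root_def)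
      moreover have "is_root G r \<tau> \<beta>" using that(2) by simp
      ultimately have "is_root G r \<tau> (\<lambda>k. \<beta> k - pairing r (\<alpha>' i) \<beta> * \<alpha> i k)"
        using is_root_refl[of G r \<tau> "\<alpha> i" "\<alpha>' i" \<beta>] coroot[OF that(1)] inv hom G by blast
      then show ?thesis by (simp add: refl_def)
    qed
    show "a i = 0" if "\<And>k. (\<Sum>i\<in>I. a i * \<alpha> i k) = 0" "i \<in> I" for a :: "'a \<Rightarrow> int" and i
      by (rule indep[OF that])
    show "\<exists>a :: 'a \<Rightarrow> int. \<beta> = (\<lambda>k. \<Sum>i\<in>I. a i * \<alpha> i k) \<and> ((\<forall>i\<in>I. a i \<ge> 0) \<or> (\<forall>i\<in>I. a i \<le> 0))"
      if "\<beta> \<in> {\<beta>. is_root G r \<tau> \<beta>}" for \<beta>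
      using that by (intro decomp) simp
  qed (use fin simple in \<open>simp_all add: is_root_def\<close>)
qed

section \<open>Tropical identities and braid relations\<close>

lemma decay_exp: "decay (\<lambda>y. exp (- (l * y))) l"
proof -
  have "eventually (\<lambda>y. l = - ln (exp (- (l * y))) / y) at_top"
    using eventually_gt_at_top[of "0::real"] by eventually_elim simp
  then have "((\<lambda>y. - ln (exp (- (l * y))) / y) \<longlongrightarrow> l) at_top"
    by (rule Lim_transform_eventually[OF tendsto_const])
  then show ?thesis by (simp add: decay_def)
qed

lemma decay_pos: "decay f c \<Longrightarrow> f y > 0"
  by (simp add: decay_def)

lemma tends_to_cocharD:
  assumes "tends_to_cochar n x v"
  shows "v \<in> lattice n" "x y \<in> pos_points n" "i < n \<Longrightarrow> decay (\<lambda>y. cmod (x y i)) (of_int (v i))"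
  using assms by (simp_all add: tends_to_cochar_def)

lemma tends_case_nat:
  assumes "decay f (of_int c)" "tends_to_cochar n x v"
  shows "tends_to_cochar (Suc n) (\<lambda>y. case_nat (complex_of_real (f y)) (x y)) (case_nat c v)"
  unfolding tends_to_cochar_def
proof (intro conjI allI impI)
  show "case_nat c v \<in> lattice (Suc n)"
    using tends_to_cocharD(1)[OF assms(2)] by (auto simp: lattice_def split: nat.split)
  show "case_nat (complex_of_real (f y)) (x y) \<in> pos_points (Suc n)" for y
    by (rule case_nat_pos[OF decay_pos[OF assms(1)] tends_to_cocharD(2)[OF assms(2)]])
  fix i assume i: "i < Suc n"
  show "decay (\<lambda>y. cmod (case i of 0 \<Rightarrow> complex_of_real (f y) | Suc j \<Rightarrow> x y j)) (of_int (case_nat c v i))"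
  proof (cases i)
    case 0
    have "(\<lambda>y. \<bar>f y\<bar>) = f" using decay_pos[OF assms(1)] by (simp add: fun_eq_iff less_imp_le)
    then show ?thesis using 0 assms(1) by simp
  next
    case (Suc j)
    then show ?thesis using i tends_to_cocharD(3)[OF assms(2), of j] by simp
  qed
qed

lemma decay_chr:
  assumes "tends_to_cochar r \<sigma> s"
  shows "decay (\<lambda>y. cmod (chr r \<mu> (\<sigma> y))) (of_int (pairing r s \<mu>))"
proof -
  have "decay (\<lambda>y. \<Prod>i<r. cmod (\<sigma> y i) powi \<mu> i) (\<Sum>i<r. of_int (\<mu> i) * of_int (s i))"
    by (intro decay_prod decay_powi tends_to_cocharD(3)[OF assms]) auto
  then show ?thesis
    by (simp add: chr_def pairing_def prod_norm[symmetric] norm_power_int mult.commute)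
qed

lemma pairing_add_left: "pairing r (\<lambda>k. u k + c * v k) \<mu> = pairing r u \<mu> + c * pairing r v \<mu>"
  by (simp add: pairing_def sum_distrib_left sum.distrib algebra_simps)

lemma alternating_foldr: "alternating (s i) (s j) m = foldr s (altw i j m)"
  by (induction m arbitrary: i j) simp_all

context positive_crystal
begin

definition TE :: "'i \<Rightarrow> int \<Rightarrow> (nat \<Rightarrow> int) \<Rightarrow> (nat \<Rightarrow> int)" where
  "TE i c v = trop (Suc n) n (e_theta X n \<theta> (e i)) (case_nat c v)"

definition TG :: "(nat \<Rightarrow> int) \<Rightarrow> (nat \<Rightarrow> int)" where
  "TG = trop n r (\<gamma> \<circ>\<^sub>m \<theta>)"

lemma tends_E:
  assumes "i \<in> I" "decay f (of_int c)" "tends_to_cochar n x v"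
  shows "tends_to_cochar n (\<lambda>y. E i (complex_of_real (f y)) (x y)) (TE i c v)"
proof -
  note t = tends_case_nat[OF assms(2,3)]
  show ?thesis
    unfolding E_def TE_def trop_pos_rep[OF rep_e[OF assms(1)] tends_to_cocharD(1)[OF t]]
    by (rule tends_to_cochar_quot_map[OF rep_e[OF assms(1)] t])
qed

lemma tends_\<Gamma>:
  assumes "tends_to_cochar n x v"
  shows "tends_to_cochar r (\<lambda>y. \<Gamma> (x y)) (TG v)"
  unfolding \<Gamma>_def TG_def trop_pos_rep[OF rep_\<gamma> tends_to_cocharD(1)[OF assms]]
  by (rule tends_to_cochar_quot_map[OF rep_\<gamma> assms])

lemma TE_lattice:
  assumes "i \<in> I" "v \<in> lattice n"
  shows "TE i c v \<in> lattice n"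
proof -
  obtain x where x: "tends_to_cochar n x v" using tends_to_cochar_exists[OF assms(2)] by blast
  show ?thesis by (rule tends_to_cocharD(1)[OF tends_E[OF assms(1) decay_exp x]])
qed

lemma TG_lattice:
  assumes "v \<in> lattice n"
  shows "TG v \<in> lattice r"
proof -
  obtain x where x: "tends_to_cochar n x v" using tends_to_cochar_exists[OF assms] by blast
  show ?thesis by (rule tends_to_cocharD(1)[OF tends_\<Gamma>[OF x]])
qed

text \<open>The constant parameter 1 has rate 0, so this is what unitality becomes.\<close>

lemma TE_0:
  assumes "i \<in> I" "v \<in> lattice n"
  shows "TE i 0 v = v"
proof -
  obtain x where x: "tends_to_cochar n x v" using tends_to_cochar_exists[OF assms(2)] by blast
  have "tends_to_cochar n (\<lambda>y. E i (complex_of_real 1) (x y)) (TE i 0 v)"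
    by (rule tends_E[OF assms(1) _ x]) (simp add: decay_const)
  then have "tends_to_cochar n x (TE i 0 v)"
    using E_1[OF assms(1) tends_to_cocharD(2)[OF x]] by simp
  then show ?thesis by (rule tends_to_cochar_unique[OF _ x])
qed

text \<open>Parameters are realized by exponentials with rates \<open>c\<close> and
  \<open>d\<close>; their product has rate \<open>c + d\<close>, and the action property on positive
  points does the rest.\<close>

lemma TE_add:
  assumes "i \<in> I" "v \<in> lattice n"
  shows "TE i c (TE i d v) = TE i (c + d) v"
proof -
  obtain x where x: "tends_to_cochar n x v" using tends_to_cochar_exists[OF assms(2)] by blast
  let ?f = "\<lambda>c y. exp (- (real_of_int c * y))"
  have "tends_to_cochar n (\<lambda>y. E i (complex_of_real (?f c y)) (E i (complex_of_real (?f d y)) (x y)))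
      (TE i c (TE i d v))"
    by (intro tends_E[OF assms(1) decay_exp] x)
  moreover have "E i (complex_of_real (?f c y)) (E i (complex_of_real (?f d y)) (x y)) =
      E i (complex_of_real (?f c y * ?f d y)) (x y)" for y
    by (rule E_mult[OF assms(1) _ _ tends_to_cocharD(2)[OF x]]) simp_all
  ultimately have 1: "tends_to_cochar n (\<lambda>y. E i (complex_of_real (?f c y * ?f d y)) (x y)) (TE i c (TE i d v))"
    by (simp only:)
  have "decay (\<lambda>y. ?f c y * ?f d y) (of_int (c + d))"
    unfolding of_int_add by (intro decay_mult decay_exp)
  from tends_to_cochar_unique[OF 1 tends_E[OF assms(1) this x]] show ?thesis .
qed

lemma TG_TE:
  assumes "i \<in> I" "v \<in> lattice n" "\<alpha>' i \<in> lattice r"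
  shows "TG (TE i c v) = (\<lambda>k. TG v k + c * \<alpha>' i k)"
proof -
  obtain x where x: "tends_to_cochar n x v" using tends_to_cochar_exists[OF assms(2)] by blast
  let ?f = "\<lambda>y. exp (- (real_of_int c * y))"
  have 1: "tends_to_cochar r (\<lambda>y. \<Gamma> (E i (complex_of_real (?f y)) (x y))) (TG (TE i c v))"
    by (intro tends_\<Gamma> tends_E[OF assms(1) decay_exp] x)
  have eq: "\<Gamma> (E i (complex_of_real (?f y)) (x y)) =
      tmult (cochr r (\<alpha>' i) (complex_of_real (?f y))) (\<Gamma> (x y))" for y
    by (rule \<Gamma>_E[OF assms(1) _ tends_to_cocharD(2)[OF x]]) simp
  note \<Gamma>x = tends_\<Gamma>[OF x]
  have "tends_to_cochar r (\<lambda>y. \<Gamma> (E i (complex_of_real (?f y)) (x y))) (\<lambda>k. TG v k + c * \<alpha>' i k)"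
    unfolding tends_to_cochar_def
  proof (intro conjI allI impI)
    show "(\<lambda>k. TG v k + c * \<alpha>' i k) \<in> lattice r"
      using tends_to_cocharD(1)[OF \<Gamma>x] assms(3) by (simp add: lattice_def)
    show "\<Gamma> (E i (complex_of_real (?f y)) (x y)) \<in> pos_points r" for y
      by (rule tends_to_cocharD(2)[OF 1])
    fix k assume k: "k < r"
    have "decay (\<lambda>y. ?f y powi \<alpha>' i k * cmod (\<Gamma> (x y) k)) (of_int (\<alpha>' i k) * of_int c + of_int (TG v k))"
      by (intro decay_mult decay_powi decay_exp tends_to_cocharD(3)[OF \<Gamma>x k])
    then show "decay (\<lambda>y. cmod (\<Gamma> (E i (complex_of_real (?f y)) (x y)) k)) (of_int (TG v k + c * \<alpha>' i k))"
      unfolding eq using k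
      by (simp add: tmult_def cochr_def norm_mult norm_power_int mult.commute add.commute del: of_real_exp)
  qed
  from tends_to_cochar_unique[OF 1 this] show ?thesis .
qed

text \<open>\<open>EW\<close> on the level of rates: \<open>s\<close> is the tropical parameter, and
  each character of the torus becomes the pairing with it.\<close>

primrec TW :: "'i list \<Rightarrow> (nat \<Rightarrow> int) \<Rightarrow> (nat \<Rightarrow> int) \<Rightarrow> (nat \<Rightarrow> int)" where
  "TW [] s v = v"
| "TW (i # w) s v = TE i (pairing r s (fold (refl r \<alpha> \<alpha>') w (\<alpha> i))) (TW w s v)"

lemma TW_lattice: "set w \<subseteq> I \<Longrightarrow> v \<in> lattice n \<Longrightarrow> TW w s v \<in> lattice n"
  by (induction w) (simp_all add: TE_lattice)

lemma tends_EW: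
  assumes "tends_to_cochar r \<sigma> s" "tends_to_cochar n x v"
  shows "set w \<subseteq> I \<Longrightarrow> tends_to_cochar n (\<lambda>y. EW w (cat r (\<sigma> y) (x y))) (TW w s v)"
proof (induction w)
  case Nil
  then show ?case using assms(2) by simp
next
  case (Cons i w)
  let ?\<mu> = "fold (refl r \<alpha> \<alpha>') w (\<alpha> i)"
  \<comment> \<open>At a positive point the character is a positive real, so it equals its modulus,
    the form in which its rate is known.\<close>
  have c: "chr r ?\<mu> (cat r (\<sigma> y) (x y)) = complex_of_real (cmod (chr r ?\<mu> (\<sigma> y)))" for y
  proof -
    obtain a where "a > 0" "chr r ?\<mu> (\<sigma> y) = complex_of_real a"
      using chr_pos[OF tends_to_cocharD(2)[OF assms(1)], of r] by auto
    then show ?thesis by (simp add: chr_cat)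
  qed
  show ?case
    unfolding EW.simps TW.simps c using Cons
    by (intro tends_E decay_chr[OF assms(1)]) simp_all
qed

lemma TW_eq:
  assumes "set w \<subseteq> I" "set w' \<subseteq> I" "s \<in> lattice r" "v \<in> lattice n"
    and "rat_eq (torus_var r \<otimes>\<^sub>v X) (e_word r \<alpha> \<alpha>' e w) (e_word r \<alpha> \<alpha>' e w')"
  shows "TW w s v = TW w' s v"
proof -
  obtain \<sigma> where \<sigma>: "tends_to_cochar r \<sigma> s" using tends_to_cochar_exists[OF assms(3)] by blast
  obtain x where x: "tends_to_cochar n x v" using tends_to_cochar_exists[OF assms(4)] by blast
  have "EW w (cat r (\<sigma> y) (x y)) = EW w' (cat r (\<sigma> y) (x y))" for y
    by (rule EW_eq[OF assms(1,2,5) cat_pos[OF tends_to_cocharD(2)[OF \<sigma>] tends_to_cocharD(2)[OF x]]])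
  then show ?thesis
    using tends_to_cochar_unique[OF tends_EW[OF \<sigma> x assms(1)]] tends_EW[OF \<sigma> x assms(2)] by simp
qed

lemma bij_TE: "i \<in> I \<Longrightarrow> bij_betw (TE i 1) (lattice n) (lattice n)"
  by (rule bij_betw_byWitness[where f' = "TE i (- 1)"])
     (auto simp: TE_add TE_0 TE_lattice)

text \<open>The family \<open>TE i\<close> is an action of the integers, so the reflection, an
  iterate whose exponent depends on the point, is a single \<open>TE\<close>.\<close>

lemma iter_TE:
  assumes i: "i \<in> I" and b: "b \<in> lattice n"
  shows "iter_int (lattice n) (TE i 1) c b = TE i c b"
proof -
  have up: "(TE i 1 ^^ k) b = TE i (int k) b" for k
    by (induction k) (simp_all add: TE_0[OF i b] TE_add[OF i b])
  have inv: "inv_into (lattice n) (TE i 1) v = TE i (- 1) v" if "v \<in> lattice n" for v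
  proof (rule inv_into_f_eq)
    show "inj_on (TE i 1) (lattice n)" using bij_TE[OF i] by (simp add: bij_betw_def)
  qed (simp_all add: TE_lattice TE_add TE_0 i that)
  have down: "(inv_into (lattice n) (TE i 1) ^^ k) b = TE i (- int k) b" for k
  proof (induction k)
    case (Suc k)
    have "TE i (- 1) (TE i (- int k) b) = TE i (- int (Suc k)) b"
      unfolding TE_add[OF i b] by simp
    with Suc show ?case using inv[OF TE_lattice[OF i b]] by simp
  qed (simp add: TE_0[OF i b])
  show ?thesis using up[of "nat c"] down[of "nat (- c)"] by (simp add: iter_int_def)
qed

abbreviation "refl_B \<equiv> crystal_refl r \<alpha> (lattice n) TG (\<lambda>i. TE i 1)"

lemma crystal_refl_TE:
  "i \<in> I \<Longrightarrow> b \<in> lattice n \<Longrightarrow> refl_B i b = TE i (- pairing r (TG b) (\<alpha> i)) b"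
  unfolding crystal_refl_def by (rule iter_TE)

text \<open>The exponent of a reflection is read off at the current point, while a word uses
  characters of one fixed parameter. They match because the weight of the current point is the
  reflected weight of \<open>v\<close>, and moving the reflections across the pairing produces
  exactly the character attached to the letter. The second conjunct carries this through the
  induction.\<close>

lemma foldr_crystal_refl:
  assumes "set w \<subseteq> I" "v \<in> lattice n" and coroot: "\<And>i. i \<in> I \<Longrightarrow> \<alpha>' i \<in> lattice r"
  shows "foldr refl_B w v = TW w (\<lambda>k. - TG v k) v \<and>
    (\<forall>\<mu>. pairing r (TG (TW w (\<lambda>k. - TG v k) v)) \<mu> = pairing r (TG v) (fold (refl r \<alpha> \<alpha>') w \<mu>))"
  using assms(1)
proof (induction w)
  case (Cons i w)
  have i: "i \<in> I" and w: "set w \<subseteq> I" using Cons.prems by auto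
  let ?b = "TW w (\<lambda>k. - TG v k) v"
  let ?c = "pairing r (\<lambda>k. - TG v k) (fold (refl r \<alpha> \<alpha>') w (\<alpha> i))"
  have b: "?b \<in> lattice n" by (rule TW_lattice[OF w assms(2)])
  have IH: "foldr refl_B w v = ?b"
      "\<And>\<mu>. pairing r (TG ?b) \<mu> = pairing r (TG v) (fold (refl r \<alpha> \<alpha>') w \<mu>)"
    using Cons.IH[OF w] by blast+
  have c: "- pairing r (TG ?b) (\<alpha> i) = ?c"
    unfolding IH(2) by (simp add: pairing_def sum_negf)
  have "foldr refl_B (i # w) v = TW (i # w) (\<lambda>k. - TG v k) v"
    using IH(1) crystal_refl_TE[OF i b] by (simp add: c)
  moreover have "pairing r (TG (TE i ?c ?b)) \<mu> = pairing r (TG v) (fold (refl r \<alpha> \<alpha>') (i # w) \<mu>)" for \<mu>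
  proof -
    have "pairing r (TG (TE i ?c ?b)) \<mu> = pairing r (TG ?b) \<mu> + ?c * pairing r (\<alpha>' i) \<mu>"
      unfolding TG_TE[OF i b coroot[OF i]]
      by (rule pairing_add_left)
    also have "\<dots> = pairing r (TG ?b) (\<lambda>k. 1 * \<mu> k + (- pairing r (\<alpha>' i) \<mu>) * \<alpha> i k)"
      unfolding pairing_linear c[symmetric] by simp
    also have "\<dots> = pairing r (TG ?b) (refl r \<alpha> \<alpha>' i \<mu>)" by (simp add: refl_def)
    finally show ?thesis unfolding IH(2) by simp
  qed
  ultimately show ?case by simp
qed simp

end

theorem theorem2p11:
  fixes G :: "(complex^'n^'n) set" and \<tau> :: "(nat \<Rightarrow> complex) \<Rightarrow> complex^'n^'n"
    and r n :: nat and I :: "'i set" and \<alpha> \<alpha>' :: "'i \<Rightarrow> nat \<Rightarrow> int"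
    and X :: "'x atlas" and \<gamma> :: "'x \<rightharpoonup> (nat \<Rightarrow> complex)"
    and e :: "'i \<Rightarrow> complex \<times> 'x \<rightharpoonup> 'x" and \<theta> :: "(nat \<Rightarrow> complex) \<rightharpoonup> 'x"
  assumes "reductive_group G" and "split_maximal_torus G r \<tau>"
    and "simple_roots G r \<tau> I \<alpha>" and "\<And>i. i \<in> I \<Longrightarrow> is_coroot G r \<tau> (\<alpha> i) (\<alpha>' i)"
    and "geometric_crystal r I \<alpha> \<alpha>' X \<gamma> e"
    and "positive_structure r I X \<gamma> e n \<theta>"
  defines "gam \<equiv> trop n r (\<gamma> \<circ>\<^sub>m \<theta>)"
    and "ee \<equiv> \<lambda>(i::'i) (c::int) v. trop (Suc n) n (e_theta X n \<theta> (e i)) (case_nat c v)"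
  shows "free_W_crystal r I \<alpha> \<alpha>' (lattice n) gam (\<lambda>i. ee i 1)"
proof -
  interpret root_data r I \<alpha> \<alpha>' "{\<beta>. is_root G r \<tau> \<beta>}"
    by (rule root_data_of_group[OF assms(1-4)])
  have bir: "birational_iso (torus_var n) X \<theta>" and pos\<gamma>: "positive_map n r (\<gamma> \<circ>\<^sub>m \<theta>)"
    and pose: "\<And>i. i \<in> I \<Longrightarrow> positive_map (Suc n) n (e_theta X n \<theta> (e i))"
    using assms(6) unfolding positive_structure_def by blast+
  obtain C D where CD: "pos_rep n r (\<gamma> \<circ>\<^sub>m \<theta>) C D" using pos_rep_exists[OF pos\<gamma>] by blast
  have "\<exists>A B. pos_rep (Suc n) n (e_theta X n \<theta> (e i)) A B" if "i \<in> I" for i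
    by (rule pos_rep_exists[OF pose[OF that]])
  then obtain A B where AB: "\<And>i. i \<in> I \<Longrightarrow> pos_rep (Suc n) n (e_theta X n \<theta> (e i)) (A i) (B i)"
    by metis
  interpret positive_crystal r n I \<alpha> \<alpha>' X \<gamma> e \<theta> A B C D
    by unfold_locales (use assms(5) bir AB CD fold_simple_nonzero in auto)
  have gam: "gam = TG" and ee: "(\<lambda>i. ee i 1) = (\<lambda>i. TE i 1)"
    by (simp_all add: gam_def TG_def ee_def TE_def fun_eq_iff)
  have coroot: "\<alpha>' i \<in> lattice r" if "i \<in> I" for i
    using assms(4)[OF that] by (simp add: is_coroot_def)
  have "free_precrystal r I \<alpha>' (lattice n) TG (\<lambda>i. TE i 1)"
    unfolding free_precrystal_def using TG_lattice bij_TE TG_TE[where c = 1] coroot by auto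
  moreover have "alternating (refl_B i) (refl_B j) m b = alternating (refl_B j) (refl_B i) m b"
    if i: "i \<in> I" and j: "j \<in> I" and m: "is_order r \<alpha> \<alpha>' i j m" and b: "b \<in> lattice n" for i j m b
  proof -
    have set: "set (altw i j m) \<subseteq> I" "set (altw j i m) \<subseteq> I" using set_altw i j by fastforce+
    have "rat_eq (torus_var r \<otimes>\<^sub>v X) (e_word r \<alpha> \<alpha>' e (altw i j m)) (e_word r \<alpha> \<alpha>' e (altw j i m))"
      using assms(5) reduced_altw[OF i j m] reduced_altw[OF j i is_order_sym[OF i j m]]
        same_element_altw[OF i j m] unfolding geometric_crystal_def by blast
    moreover have "(\<lambda>k. - TG b k) \<in> lattice r" using TG_lattice[OF b] by (simp add: lattice_def)
    \<comment> \<open>The parameter depends only on \<open>b\<close>, so both words are compared at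
      the same tropical parameter.\<close>
    ultimately have "TW (altw i j m) (\<lambda>k. - TG b k) b = TW (altw j i m) (\<lambda>k. - TG b k) b"
      using TW_eq[OF set _ b] by blast
    then show ?thesis
      unfolding alternating_foldr using foldr_crystal_refl[OF set(1) b coroot]
        foldr_crystal_refl[OF set(2) b coroot] by simp
  qed
  ultimately show ?thesis
    unfolding gam ee free_W_crystal_def by blast
qed

end
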